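(* Let $\lambda_1,\dots,\lambda_N\in\mathbb{C}$ and $K\in\mathbb{Z}_{\ge1}$ satisfy $\lambda_i-\lambda_{i+1}\in\mathbb{Z}_{\ge0}$ for $1\le i\le N-1$ and $\lambda_N-\lambda_1+K\in\mathbb{Z}_{\ge0}$, let $\Lambda$ be the corresponding dominant integral weight, let $\alpha\in\mathbb{C}$, and assume $K\hbar=-N\varepsilon_1$. Let $L(\Lambda,\alpha)$ be the evaluation module of $Y_{\varepsilon_1,\varepsilon_2}(\hat{\mathfrak{sl}}_N)$ and $v_\Lambda$ its highest weight vector. Then $$x_{i,r}^{+}v_\Lambda=0,\qquad h_{i,r}v_\Lambda=a_i^{\,r}\langle h_i,\Lambda\rangle v_\Lambda$$ for all $i\in\mathbb{Z}/N\mathbb{Z}$ and $r\ge0$, where $$a_0=\alpha-N\varepsilon_1+\hbar\lambda_N=\alpha+(\lambda_N+K)\hbar,\qquad a_i=\alpha-i\varepsilon_1+\hbar\lambda_i=\alpha+\Big(\lambda_i+\frac{i}{N}K\Big)\hbar\quad(1\le i\le N-1).$$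
   Context: Fix an integer $N\ge 3$ and parameters $\varepsilon_1,\varepsilon_2\in\mathbb{C}$; put $\hbar=\varepsilon_1+\varepsilon_2$ and $\{x,y\}=xy+yx$. **Affine Yangian.** $Y_{\varepsilon_1,\varepsilon_2}(\hat{\mathfrak{sl}}_N)$ is the associative unital $\mathbb{C}$-algebra generated by $x_{i,r}^{+},x_{i,r}^{-},h_{i,r}$ ($i\in\mathbb{Z}/N\mathbb{Z}$, $r\in\mathbb{Z}_{\ge 0}$) with relations $$[h_{i,r},h_{j,s}]=0,\quad [x_{i,r}^{+},x_{j,s}^{-}]=\delta_{ij}h_{i,r+s},\quad [h_{i,0},x_{j,r}^{\pm}]=\pm a_{ij}x_{j,r}^{\pm},$$ $$[h_{i,r+1},x_{j,s}^{\pm}]-[h_{i,r},x_{j,s+1}^{\pm}]=\pm a_{ij}\tfrac{\varepsilon_1+\varepsilon_2}{2}\{h_{i,r},x_{j,s}^{\pm}\}-m_{ij}\tfrac{\varepsilon_1-\varepsilon_2}{2}[h_{i,r},x_{j,s}^{\pm}],$$ $$[x_{i,r+1}^{\pm},x_{j,s}^{\pm}]-[x_{i,r}^{\pm},x_{j,s+1}^{\pm}]=\pm a_{ij}\tfrac{\varepsilon_1+\varepsilon_2}{2}\{x_{i,r}^{\pm},x_{j,s}^{\pm}\}-m_{ij}\tfrac{\varepsilon_1-\varepsilon_2}{2}[x_{i,r}^{\pm},x_{j,s}^{\pm}],$$ $$\sum_{w\in\mathfrak{S}_{1-a_{ij}}}[x_{i,r_{w(1)}}^{\pm},[x_{i,r_{w(2)}}^{\pm},\dots,[x_{i,r_{w(1-a_{ij})}}^{\pm},x_{j,s}^{\pm}]\dots]]=0\quad(i\ne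 j),$$ where $a_{ij}=2$ if $i=j$, $-1$ if $i=j\pm1$, $0$ otherwise; $m_{ij}=1$ if $j=i-1$, $-1$ if $j=i+1$, $0$ otherwise (indices in $\mathbb{Z}/N\mathbb{Z}$). **Affine Lie algebra.** $E_{i,j}$ denotes the matrix units of $\mathfrak{gl}_N$, with indices regarded in $\mathbb{Z}/N\mathbb{Z}$; $\mathbf{1}=\sum_{i=1}^N E_{i,i}$; $X(s)=X\otimes t^s$ and $X=X(0)$. The Lie algebra $\hat{\mathfrak{sl}}_N=\mathfrak{sl}_N\otimes\mathbb{C}[t,t^{-1}]\oplus\mathbb{C}c$ has bracket $[X(r),Y(s)]=[X,Y](r+s)+r\delta_{r+s,0}\mathrm{tr}(XY)c$, $c$ central. The Heisenberg algebra $\hat{\mathfrak a}=\mathbb{C}\mathbf{1}\otimes\mathbb{C}[t,t^{-1}]\oplus\mathbb{C}c'$ has bracket $[\mathbf{1}(r),\mathbf{1}(s)]=r\delta_{r+s,0}Nc'$, $c'$ central. Set $\hat{\mathfrak{gl}}_N=\hat{\mathfrak{gl}}_N^{(+)}=(\hat{\mathfrak{sl}}_N\oplus\hat{\mathfrak a})/(c'-(c+N))$, so $[X(r),Y(s)]=[X,Y](r+s)+r\delta_{r+s,0}(\mathrm{tr}(XY)c+\mathrm{tr}(X)\mathrm{tr}(Y))$ for $X,Y\in\mathfrak{gl}_N$. Set $$x_0^+=E_{N,1}(1),\ x_0^-=E_{1,N}(-1),\ h_0=E_{N,N}-E_{1,1}+c,\qquad x_i^+=E_{i,i+1},\ x_i^-=E_{i+1,i},\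 h_i=E_{i,i}-E_{i+1,i+1}\ (1\le i\le N-1).$$ Let $\hat{\mathfrak n}_+=\bigoplus_{i<j,\,s\ge0}\mathbb{C}E_{i,j}(s)\oplus\bigoplus_{i\ge j,\,s>0}\mathbb{C}E_{i,j}(s)$, $\hat{\mathfrak n}_-=\bigoplus_{i>j,\,s\le0}\mathbb{C}E_{i,j}(s)\oplus\bigoplus_{i\le j,\,s<0}\mathbb{C}E_{i,j}(s)$ ($1\le i,j\le N$), and let $\hat{\mathfrak h}$ be the span of the $h_i$ and $\mathbf{1}$. Grade $U(\hat{\mathfrak n}_\pm)$ by $\deg X(s)=s$, and define $$U(\hat{\mathfrak{gl}}_N)_{\mathrm{comp},+}=\bigoplus_{k\in\mathbb{Z}}\ \prod_{r,s\ge0,\ s-r=k}\Big(U(\hat{\mathfrak n}_-)[-r]\otimes U(\hat{\mathfrak h})\otimes U(\hat{\mathfrak n}_+)[s]\Big)$$ with its natural algebra structure containing $U(\hat{\mathfrak{gl}}_N)$; it acts on highest weight modules of $\hat{\mathfrak{gl}}_N$. The central element $c$ is evaluated at a complex number, also denoted $c$ (here $c=K$). **Evaluation map.** When $\hbar c=-N\varepsilon_1$, for $\alpha\in\mathbb{C}$ there is an algebra homomorphism $\mathrm{ev}^+_\alpha\colon Y_{\varepsilon_1,\varepsilon_2}(\hat{\mathfrak{sl}}_N)\to U(\hat{\mathfrak{gl}}_N)_{\mathrm{comp},+}$ uniquely determined by $x_{i,0}^\pm\mapsto x_i^\pm$, $h_{i,0}\mapsto h_i$ and $$x_{0,1}^{+}\mapsto(\alpha-N\varepsilon_1)x_0^{+}+\hbar\sum_{s\ge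 0}\sum_{k=1}^N E_{N,k}(-s)E_{k,1}(s+1),\quad x_{0,1}^{-}\mapsto(\alpha-N\varepsilon_1)x_0^{-}+\hbar\sum_{s\ge 0}\sum_{k=1}^N E_{1,k}(-s-1)E_{k,N}(s),$$ $$h_{0,1}\mapsto(\alpha-N\varepsilon_1)h_0-\hbar E_{N,N}(E_{1,1}-c)+\hbar\sum_{s\ge 0}\sum_{k=1}^N\Big(E_{N,k}(-s)E_{k,N}(s)-E_{1,k}(-s-1)E_{k,1}(s+1)\Big),$$ and for $1\le i\le N-1$, $$x_{i,1}^{+}\mapsto(\alpha-i\varepsilon_1)x_i^{+}+\hbar\sum_{s\ge 0}\Big(\sum_{k=1}^i E_{i,k}(-s)E_{k,i+1}(s)+\sum_{k=i+1}^N E_{i,k}(-s-1)E_{k,i+1}(s+1)\Big),$$ $$x_{i,1}^{-}\mapsto(\alpha-i\varepsilon_1)x_i^{-}+\hbar\sum_{s\ge 0}\Big(\sum_{k=1}^i E_{i+1,k}(-s)E_{k,i}(s)+\sum_{k=i+1}^N E_{i+1,k}(-s-1)E_{k,i}(s+1)\Big),$$ $$\begin{aligned}h_{i,1}\mapsto&(\alpha-i\varepsilon_1)h_i-\hbar E_{i,i}E_{i+1,i+1}+\hbar\sum_{s\ge 0}\Big(\sum_{k=1}^i E_{i,k}(-s)E_{k,i}(s)+\sum_{k=i+1}^N E_{i,k}(-s-1)E_{k,i}(s+1)\\&-\sum_{k=1}^i E_{i+1,k}(-s)E_{k,i+1}(s)-\sum_{k=i+1}^N E_{i+1,k}(-s-1)E_{k,i+1}(s+1)\Big).\end{aligned}$$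 **Evaluation module.** Given $\lambda_1,\dots,\lambda_N$ and $K$ as in the claim, $\Lambda$ is the dominant integral weight of $\hat{\mathfrak{gl}}_N$ with $\langle E_{i,i},\Lambda\rangle=\lambda_i$ ($1\le i\le N$) and $\langle c,\Lambda\rangle=K$. $L(\Lambda)$ is the integrable irreducible highest weight $\hat{\mathfrak{gl}}_N$-module with highest weight $\Lambda$, with fixed highest weight vector $v_\Lambda$ (so $\hat{\mathfrak n}_+v_\Lambda=0$, $E_{i,i}v_\Lambda=\lambda_iv_\Lambda$, $c$ acts by $K$). $L(\Lambda,\alpha)$ is the $Y_{\varepsilon_1,\varepsilon_2}(\hat{\mathfrak{sl}}_N)$-module obtained by pulling back $L(\Lambda)$ via $\mathrm{ev}^+_\alpha$, and $v_\Lambda$ is regarded as a vector of $L(\Lambda,\alpha)$. *)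

theory Defs
  imports
    Complex_Main
    "HOL-Library.Poly_Mapping"
    "HOL-Combinatorics.Permutations"
    "HOL-Algebra.QuotRing"
    "HOL-Algebra.Module"
begin

section \<open>Associative algebras over the complex numbers\<close>

text \<open>
  A unital associative (not necessarily commutative) complex algebra is represented by a record of
  the type \<^typ>\<open>(complex, 'a) module\<close>: a ring in the sense of \<^theory>\<open>HOL-Algebra.Ring\<close> together with
  a scalar multiplication.
\<close>

definition alg_hom :: "(complex, 'a) module \<Rightarrow> (complex, 'b) module \<Rightarrow> ('a \<Rightarrow> 'b) set" where
  "alg_hom A B = {f \<in> ring_hom A B. \<forall>z. \<forall>x\<in>carrier A. f (z \<odot>\<^bsub>A\<^esub> x) = z \<odot>\<^bsub>B\<^esub> f x}"

definition quotient_algebra :: "(complex, 'a) module \<Rightarrow> 'a set \<Rightarrow> (complex, 'a set) module" where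
  "quotient_algebra A I =
    \<lparr>carrier = carrier (A Quot I), mult = mult (A Quot I), one = one (A Quot I),
     zero = zero (A Quot I), add = add (A Quot I),
     smult = (\<lambda>z S. \<Union>p\<in>S. I +>\<^bsub>A\<^esub> (z \<odot>\<^bsub>A\<^esub> p))\<rparr>"

text \<open>
  Words form a monoid under concatenation, so the convolution product of
  \<^theory>\<open>HOL-Library.Poly_Mapping\<close> makes the finitely supported functions on words the free algebra.
\<close>

datatype 'g fword = Word (letters: "'g list")

instantiation fword :: (type) monoid_add
begin

definition zero_fword :: "'a fword" where
  "0 = Word []"

definition plus_fword :: "'a fword \<Rightarrow> 'a fword \<Rightarrow> 'a fword" where
  "u + w = Word (letters u @ letters w)"

instance
  by standard (simp_all add: zero_fword_def plus_fword_def)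

end

type_synonym 'g free = "'g fword \<Rightarrow>\<^sub>0 complex"

definition cst :: "complex \<Rightarrow> 'g free" where
  "cst z = Poly_Mapping.single 0 z"

definition monom_word :: "'g list \<Rightarrow> 'g free" where
  "monom_word gs = Poly_Mapping.single (Word gs) 1"

definition gen :: "'g \<Rightarrow> 'g free" where
  "gen g = monom_word [g]"

definition free_algebra :: "'g set \<Rightarrow> (complex, 'g free) module" where
  "free_algebra G =
    \<lparr>carrier = {p. \<forall>w\<in>Poly_Mapping.keys p. set (letters w) \<subseteq> G},
     mult = (*), one = 1, zero = 0, add = (+), smult = (\<lambda>z p. cst z * p)\<rparr>"

definition relation_ideal :: "'g set \<Rightarrow> 'g free set \<Rightarrow> 'g free set" where
  "relation_ideal G R = Idl\<^bsub>free_algebra G\<^esub> R"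

definition presented_algebra :: "'g set \<Rightarrow> 'g free set \<Rightarrow> (complex, 'g free set) module" where
  "presented_algebra G R = quotient_algebra (free_algebra G) (relation_ideal G R)"

definition presented_class :: "'g set \<Rightarrow> 'g free set \<Rightarrow> 'g free \<Rightarrow> 'g free set" where
  "presented_class G R p = relation_ideal G R +>\<^bsub>free_algebra G\<^esub> p"

definition comm :: "'a::ring \<Rightarrow> 'a \<Rightarrow> 'a" where
  "comm x y = x * y - y * x"

definition anticomm :: "'a::ring \<Rightarrow> 'a \<Rightarrow> 'a" where
  "anticomm x y = x * y + y * x"

definition end_algebra :: "(complex \<Rightarrow> 'v::ab_group_add \<Rightarrow> 'v) \<Rightarrow> (complex, 'v \<Rightarrow> 'v) module" where
  "end_algebra scale =
    \<lparr>carrier = {f. Vector_Spaces.linear scale scale f},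
     mult = (\<circ>), one = id, zero = (\<lambda>_. 0), add = (\<lambda>f g x. f x + g x),
     smult = (\<lambda>z f x. scale z (f x))\<rparr>"


section \<open>The affine Yangian\<close>

text \<open>The index set $\mathbb{Z}/N\mathbb{Z}$ is represented by \<open>{0..<N}\<close>, for $N \ge 3$.\<close>

datatype pm = Pl | Mi

fun pm_sign :: "pm \<Rightarrow> complex" where
  "pm_sign Pl = 1"
| "pm_sign Mi = - 1"

datatype yangian_gen = Xgen pm nat nat | Hgen nat nat

definition yangian_gens :: "nat \<Rightarrow> yangian_gen set" where
  "yangian_gens N = {Xgen \<sigma> i r |\<sigma> i r. i < N} \<union> {Hgen i r |i r. i < N}"

abbreviation xg :: "pm \<Rightarrow> nat \<Rightarrow> nat \<Rightarrow> yangian_gen free" where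
  "xg \<sigma> i r \<equiv> gen (Xgen \<sigma> i r)"

abbreviation hg :: "nat \<Rightarrow> nat \<Rightarrow> yangian_gen free" where
  "hg i r \<equiv> gen (Hgen i r)"

definition cartan_mat :: "nat \<Rightarrow> nat \<Rightarrow> nat \<Rightarrow> int" where
  "cartan_mat N i j =
    (if i = j then 2 else if i = (j + 1) mod N \<or> j = (i + 1) mod N then - 1 else 0)"

definition m_mat :: "nat \<Rightarrow> nat \<Rightarrow> nat \<Rightarrow> int" where
  "m_mat N i j = (if i = (j + 1) mod N then 1 else if j = (i + 1) mod N then - 1 else 0)"

inductive_set yangian_rels :: "nat \<Rightarrow> complex \<Rightarrow> complex \<Rightarrow> yangian_gen free set"
  for N :: nat and \<epsilon>1 \<epsilon>2 :: complex
  where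
    hh: "\<lbrakk>i < N; j < N\<rbrakk> \<Longrightarrow> comm (hg i r) (hg j s) \<in> yangian_rels N \<epsilon>1 \<epsilon>2"
  | xx: "\<lbrakk>i < N; j < N\<rbrakk> \<Longrightarrow>
      comm (xg Pl i r) (xg Mi j s) - (if i = j then hg i (r + s) else 0) \<in> yangian_rels N \<epsilon>1 \<epsilon>2"
  | h0x: "\<lbrakk>i < N; j < N\<rbrakk> \<Longrightarrow>
      comm (hg i 0) (xg \<sigma> j r) - cst (pm_sign \<sigma> * of_int (cartan_mat N i j)) * xg \<sigma> j r
        \<in> yangian_rels N \<epsilon>1 \<epsilon>2"
  | hx: "\<lbrakk>i < N; j < N\<rbrakk> \<Longrightarrow>
      comm (hg i (r + 1)) (xg \<sigma> j s) - comm (hg i r) (xg \<sigma> j (s + 1))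
      - (cst (pm_sign \<sigma> * of_int (cartan_mat N i j) * ((\<epsilon>1 + \<epsilon>2) / 2)) * anticomm (hg i r) (xg \<sigma> j s)
         - cst (of_int (m_mat N i j) * ((\<epsilon>1 - \<epsilon>2) / 2)) * comm (hg i r) (xg \<sigma> j s))
        \<in> yangian_rels N \<epsilon>1 \<epsilon>2"
  | xx_same: "\<lbrakk>i < N; j < N\<rbrakk> \<Longrightarrow>
      comm (xg \<sigma> i (r + 1)) (xg \<sigma> j s) - comm (xg \<sigma> i r) (xg \<sigma> j (s + 1))
      - (cst (pm_sign \<sigma> * of_int (cartan_mat N i j) * ((\<epsilon>1 + \<epsilon>2) / 2)) * anticomm (xg \<sigma> i r) (xg \<sigma> j s)
         - cst (of_int (m_mat N i j) * ((\<epsilon>1 - \<epsilon>2) / 2)) * comm (xg \<sigma> i r) (xg \<sigma> j s))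
        \<in> yangian_rels N \<epsilon>1 \<epsilon>2"
  | serre: "\<lbrakk>i < N; j < N; i \<noteq> j; m = nat (1 - cartan_mat N i j)\<rbrakk> \<Longrightarrow>
      (\<Sum>w | w permutes {1..m}.
          foldr (\<lambda>k z. comm (xg \<sigma> i (r (w k))) z) [1..<m + 1] (xg \<sigma> j s))
        \<in> yangian_rels N \<epsilon>1 \<epsilon>2"

definition affine_yangian ::
    "nat \<Rightarrow> complex \<Rightarrow> complex \<Rightarrow> (complex, yangian_gen free set) module" where
  "affine_yangian N \<epsilon>1 \<epsilon>2 = presented_algebra (yangian_gens N) (yangian_rels N \<epsilon>1 \<epsilon>2)"

definition yX :: "nat \<Rightarrow> complex \<Rightarrow> complex \<Rightarrow> pm \<Rightarrow> nat \<Rightarrow> nat \<Rightarrow> yangian_gen free set" where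
  "yX N \<epsilon>1 \<epsilon>2 \<sigma> i r = presented_class (yangian_gens N) (yangian_rels N \<epsilon>1 \<epsilon>2) (xg \<sigma> i r)"

definition yH :: "nat \<Rightarrow> complex \<Rightarrow> complex \<Rightarrow> nat \<Rightarrow> nat \<Rightarrow> yangian_gen free set" where
  "yH N \<epsilon>1 \<epsilon>2 i r = presented_class (yangian_gens N) (yangian_rels N \<epsilon>1 \<epsilon>2) (hg i r)"


section \<open>The enveloping algebra of affine $\mathfrak{gl}_N$ at a fixed central value\<close>

text \<open>
  \<open>EE i j s\<close> is $E_{i,j}(s)$ with $1 \le i,j \le N$, and \<open>CC\<close> is $c$.  Because of the identification
  $c' = c + N$ the bracket of two elements $E_{i,j}(s)$ contains the number
  $\mathrm{tr}(X)\mathrm{tr}(Y)$, so it is an identity in the enveloping algebra, which is therefore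
  presented by these generators.  The last relation evaluates $c$ at the complex number \<open>\<kappa>\<close>.
\<close>

datatype gl_gen = EE nat nat int | CC

definition gl_gens :: "nat \<Rightarrow> gl_gen set" where
  "gl_gens N = {EE i j s |i j s. i \<in> {1..N} \<and> j \<in> {1..N}} \<union> {CC}"

inductive_set gl_rels :: "nat \<Rightarrow> complex \<Rightarrow> gl_gen free set"
  for N :: nat and \<kappa> :: complex
  where
    bracket: "\<lbrakk>i \<in> {1..N}; j \<in> {1..N}; k \<in> {1..N}; l \<in> {1..N}\<rbrakk> \<Longrightarrow>
      comm (gen (EE i j r)) (gen (EE k l s))
      - ((if j = k then gen (EE i l (r + s)) else 0) - (if l = i then gen (EE k j (r + s)) else 0)
         + (if r + s = 0
            then cst (of_int r) * ((if j = k \<and> l = i then gen CC else 0)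
                                   + (if i = j \<and> k = l then 1 else 0))
            else 0))
        \<in> gl_rels N \<kappa>"
  | central: "\<lbrakk>i \<in> {1..N}; j \<in> {1..N}\<rbrakk> \<Longrightarrow> comm (gen CC) (gen (EE i j r)) \<in> gl_rels N \<kappa>"
  | level: "gen CC - cst \<kappa> \<in> gl_rels N \<kappa>"

definition U_gl :: "nat \<Rightarrow> complex \<Rightarrow> (complex, gl_gen free set) module" where
  "U_gl N \<kappa> = presented_algebra (gl_gens N) (gl_rels N \<kappa>)"

definition U_class :: "nat \<Rightarrow> complex \<Rightarrow> gl_gen free \<Rightarrow> gl_gen free set" where
  "U_class N \<kappa> p = presented_class (gl_gens N) (gl_rels N \<kappa>) p"

definition n_plus :: "nat \<Rightarrow> gl_gen set" where
  "n_plus N = {EE i j s |i j s. i \<in> {1..N} \<and> j \<in> {1..N} \<and> (i < j \<and> 0 \<le> s \<or> j \<le> i \<and> 0 < s)}"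

definition n_minus :: "nat \<Rightarrow> gl_gen set" where
  "n_minus N = {EE i j s |i j s. i \<in> {1..N} \<and> j \<in> {1..N} \<and> (j < i \<and> s \<le> 0 \<or> i \<le> j \<and> s < 0)}"

text \<open>
  The $h_i$ ($0 \le i < N$) and $\mathbf{1}$ have the same span as the following elements; note
  $c = h_0 + \dots + h_{N-1}$.
\<close>

definition h_cartan :: "nat \<Rightarrow> gl_gen set" where
  "h_cartan N = {EE i i 0 |i. i \<in> {1..N}} \<union> {CC}"

fun gl_deg :: "gl_gen \<Rightarrow> int" where
  "gl_deg (EE i j s) = s"
| "gl_deg CC = 0"


section \<open>The completed enveloping algebra\<close>

text \<open>
  By the Poincare-Birkhoff-Witt theorem, multiplication identifies
  $U(\hat{\mathfrak n}_-)[-r] \otimes U(\hat{\mathfrak h}) \otimes U(\hat{\mathfrak n}_+)[s]$ with the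
  subspace \<open>U_tri N \<kappa> r s\<close> of the enveloping algebra.
\<close>

definition tri_words :: "nat \<Rightarrow> nat \<Rightarrow> nat \<Rightarrow> gl_gen list set" where
  "tri_words N r s =
    {a @ b @ d |a b d. set a \<subseteq> n_minus N \<and> set b \<subseteq> h_cartan N \<and> set d \<subseteq> n_plus N \<and>
       sum_list (map gl_deg a) = - int r \<and> sum_list (map gl_deg d) = int s}"

definition U_tri :: "nat \<Rightarrow> complex \<Rightarrow> nat \<Rightarrow> nat \<Rightarrow> gl_gen free set set" where
  "U_tri N \<kappa> r s = U_class N \<kappa> ` {p. Poly_Mapping.keys p \<subseteq> Word ` tri_words N r s}"

text \<open>
  An element of the completion is the family \<open>u\<close> of its components \<open>u r s \<in> U_tri N \<kappa> r s\<close>; only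
  finitely many total degrees $s - r$ occur.
\<close>

definition comp_carrier :: "nat \<Rightarrow> complex \<Rightarrow> (nat \<Rightarrow> nat \<Rightarrow> gl_gen free set) set" where
  "comp_carrier N \<kappa> =
    {u. (\<forall>r s. u r s \<in> U_tri N \<kappa> r s) \<and>
        finite {int s - int r |r s. u r s \<noteq> \<zero>\<^bsub>U_gl N \<kappa>\<^esub>}}"

text \<open>
  The multiplication of the enveloping algebra is extended by continuity.  The topology is given by
  the subspaces \<open>comp_nbhd N \<kappa> m\<close> of all elements whose components vanish for $s < m$, and \<open>u\<close> is the
  limit of its truncations \<open>comp_trunc N \<kappa> u n\<close> to $s < n$, which are finite sums and hence lie in the
  enveloping algebra.  By the Poincare-Birkhoff-Witt theorem \<open>is_comp_prod N \<kappa> u v w\<close> determines \<open>w\<close>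
  uniquely, so the choice operator in the product of \<open>U_comp\<close> is harmless.
\<close>

definition comp_trunc ::
    "nat \<Rightarrow> complex \<Rightarrow> (nat \<Rightarrow> nat \<Rightarrow> gl_gen free set) \<Rightarrow> nat \<Rightarrow> gl_gen free set" where
  "comp_trunc N \<kappa> u n =
    finsum (U_gl N \<kappa>) (\<lambda>(r, s). u r s) {(r, s). s < n \<and> u r s \<noteq> \<zero>\<^bsub>U_gl N \<kappa>\<^esub>}"

definition comp_nbhd :: "nat \<Rightarrow> complex \<Rightarrow> nat \<Rightarrow> gl_gen free set set" where
  "comp_nbhd N \<kappa> m =
    U_class N \<kappa> ` {p. Poly_Mapping.keys p \<subseteq> Word ` (\<Union>r. \<Union>s\<in>{m..}. tri_words N r s)}"

definition is_comp_prod ::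
    "nat \<Rightarrow> complex \<Rightarrow> (nat \<Rightarrow> nat \<Rightarrow> gl_gen free set) \<Rightarrow> (nat \<Rightarrow> nat \<Rightarrow> gl_gen free set)
      \<Rightarrow> (nat \<Rightarrow> nat \<Rightarrow> gl_gen free set) \<Rightarrow> bool" where
  "is_comp_prod N \<kappa> u v w \<longleftrightarrow>
    w \<in> comp_carrier N \<kappa> \<and>
    (\<forall>m. \<forall>\<^sub>F n in sequentially.
       (comp_trunc N \<kappa> u n \<otimes>\<^bsub>U_gl N \<kappa>\<^esub> comp_trunc N \<kappa> v n) \<ominus>\<^bsub>U_gl N \<kappa>\<^esub> comp_trunc N \<kappa> w n
         \<in> comp_nbhd N \<kappa> m)"

text \<open>
  \<open>comp_word N \<kappa> gs\<close> is the image in the completion of a word that is already in triangular form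
  (letters of \<open>n_minus\<close>, then \<open>h_cartan\<close>, then \<open>n_plus\<close>); its two degrees are determined by the signs
  of the degrees of the letters.  It is only applied to such words.
\<close>

definition comp_word :: "nat \<Rightarrow> complex \<Rightarrow> gl_gen list \<Rightarrow> nat \<Rightarrow> nat \<Rightarrow> gl_gen free set" where
  "comp_word N \<kappa> gs =
    (\<lambda>r s. if r = (\<Sum>g\<leftarrow>gs. nat (- gl_deg g)) \<and> s = (\<Sum>g\<leftarrow>gs. nat (gl_deg g))
           then U_class N \<kappa> (monom_word gs) else \<zero>\<^bsub>U_gl N \<kappa>\<^esub>)"

definition U_comp :: "nat \<Rightarrow> complex \<Rightarrow> (complex, nat \<Rightarrow> nat \<Rightarrow> gl_gen free set) module" where
  "U_comp N \<kappa> =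
    \<lparr>carrier = comp_carrier N \<kappa>,
     mult = (\<lambda>u v. SOME w. is_comp_prod N \<kappa> u v w),
     one = comp_word N \<kappa> [],
     zero = (\<lambda>r s. \<zero>\<^bsub>U_gl N \<kappa>\<^esub>),
     add = (\<lambda>u v r s. u r s \<oplus>\<^bsub>U_gl N \<kappa>\<^esub> v r s),
     smult = (\<lambda>z u r s. z \<odot>\<^bsub>U_gl N \<kappa>\<^esub> u r s)\<rparr>"

text \<open>Infinite sum over \<open>n\<close> of elements of the completion; componentwise finite in all uses.\<close>

definition comp_series ::
    "nat \<Rightarrow> complex \<Rightarrow> (nat \<Rightarrow> nat \<Rightarrow> nat \<Rightarrow> gl_gen free set) \<Rightarrow> nat \<Rightarrow> nat \<Rightarrow> gl_gen free set" where
  "comp_series N \<kappa> f =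
    (\<lambda>r s. \<Oplus>\<^bsub>U_gl N \<kappa>\<^esub>n\<in>{n. f n r s \<noteq> \<zero>\<^bsub>U_gl N \<kappa>\<^esub>}. f n r s)"


section \<open>The evaluation map\<close>

fun chevalley :: "nat \<Rightarrow> pm \<Rightarrow> nat \<Rightarrow> gl_gen" where
  "chevalley N Pl i = (if i = 0 then EE N 1 1 else EE i (i + 1) 0)"
| "chevalley N Mi i = (if i = 0 then EE 1 N (- 1) else EE (i + 1) i 0)"

definition ev_x0 :: "nat \<Rightarrow> complex \<Rightarrow> pm \<Rightarrow> nat \<Rightarrow> nat \<Rightarrow> nat \<Rightarrow> gl_gen free set" where
  "ev_x0 N \<kappa> \<sigma> i = comp_word N \<kappa> [chevalley N \<sigma> i]"

definition ev_h0 :: "nat \<Rightarrow> complex \<Rightarrow> nat \<Rightarrow> nat \<Rightarrow> nat \<Rightarrow> gl_gen free set" where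
  "ev_h0 N \<kappa> i =
    (let U = U_comp N \<kappa>; M = comp_word N \<kappa> in
     if i = 0 then (M [EE N N 0] \<ominus>\<^bsub>U\<^esub> M [EE 1 1 0]) \<oplus>\<^bsub>U\<^esub> M [CC]
     else M [EE i i 0] \<ominus>\<^bsub>U\<^esub> M [EE (i + 1) (i + 1) 0])"

definition ev_xp1 ::
    "nat \<Rightarrow> complex \<Rightarrow> complex \<Rightarrow> complex \<Rightarrow> complex \<Rightarrow> nat \<Rightarrow> nat \<Rightarrow> nat \<Rightarrow> gl_gen free set" where
  "ev_xp1 N \<epsilon>1 \<epsilon>2 \<kappa> \<alpha> i =
    (let U = U_comp N \<kappa>; M = comp_word N \<kappa>; hb = \<epsilon>1 + \<epsilon>2 in
     if i = 0 then
       ((\<alpha> - of_nat N * \<epsilon>1) \<odot>\<^bsub>U\<^esub> ev_x0 N \<kappa> Pl 0) \<oplus>\<^bsub>U\<^esub>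
       (hb \<odot>\<^bsub>U\<^esub> comp_series N \<kappa> (\<lambda>s.
          \<Oplus>\<^bsub>U\<^esub>k\<in>{1..N}. M [EE N k (- int s), EE k 1 (int s + 1)]))
     else
       ((\<alpha> - of_nat i * \<epsilon>1) \<odot>\<^bsub>U\<^esub> ev_x0 N \<kappa> Pl i) \<oplus>\<^bsub>U\<^esub>
       (hb \<odot>\<^bsub>U\<^esub> comp_series N \<kappa> (\<lambda>s.
          (\<Oplus>\<^bsub>U\<^esub>k\<in>{1..i}. M [EE i k (- int s), EE k (i + 1) (int s)]) \<oplus>\<^bsub>U\<^esub>
          (\<Oplus>\<^bsub>U\<^esub>k\<in>{i+1..N}. M [EE i k (- int s - 1), EE k (i + 1) (int s + 1)]))))"

definition ev_xm1 ::
    "nat \<Rightarrow> complex \<Rightarrow> complex \<Rightarrow> complex \<Rightarrow> complex \<Rightarrow> nat \<Rightarrow> nat \<Rightarrow> nat \<Rightarrow> gl_gen free set" where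
  "ev_xm1 N \<epsilon>1 \<epsilon>2 \<kappa> \<alpha> i =
    (let U = U_comp N \<kappa>; M = comp_word N \<kappa>; hb = \<epsilon>1 + \<epsilon>2 in
     if i = 0 then
       ((\<alpha> - of_nat N * \<epsilon>1) \<odot>\<^bsub>U\<^esub> ev_x0 N \<kappa> Mi 0) \<oplus>\<^bsub>U\<^esub>
       (hb \<odot>\<^bsub>U\<^esub> comp_series N \<kappa> (\<lambda>s.
          \<Oplus>\<^bsub>U\<^esub>k\<in>{1..N}. M [EE 1 k (- int s - 1), EE k N (int s)]))
     else
       ((\<alpha> - of_nat i * \<epsilon>1) \<odot>\<^bsub>U\<^esub> ev_x0 N \<kappa> Mi i) \<oplus>\<^bsub>U\<^esub>
       (hb \<odot>\<^bsub>U\<^esub> comp_series N \<kappa> (\<lambda>s.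
          (\<Oplus>\<^bsub>U\<^esub>k\<in>{1..i}. M [EE (i + 1) k (- int s), EE k i (int s)]) \<oplus>\<^bsub>U\<^esub>
          (\<Oplus>\<^bsub>U\<^esub>k\<in>{i+1..N}. M [EE (i + 1) k (- int s - 1), EE k i (int s + 1)]))))"

definition ev_h1 ::
    "nat \<Rightarrow> complex \<Rightarrow> complex \<Rightarrow> complex \<Rightarrow> complex \<Rightarrow> nat \<Rightarrow> nat \<Rightarrow> nat \<Rightarrow> gl_gen free set" where
  "ev_h1 N \<epsilon>1 \<epsilon>2 \<kappa> \<alpha> i =
    (let U = U_comp N \<kappa>; M = comp_word N \<kappa>; hb = \<epsilon>1 + \<epsilon>2 in
     if i = 0 then
       (((\<alpha> - of_nat N * \<epsilon>1) \<odot>\<^bsub>U\<^esub> ev_h0 N \<kappa> 0) \<ominus>\<^bsub>U\<^esub>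
        (hb \<odot>\<^bsub>U\<^esub> (M [EE N N 0, EE 1 1 0] \<ominus>\<^bsub>U\<^esub> M [EE N N 0, CC]))) \<oplus>\<^bsub>U\<^esub>
       (hb \<odot>\<^bsub>U\<^esub> comp_series N \<kappa> (\<lambda>s.
          \<Oplus>\<^bsub>U\<^esub>k\<in>{1..N}. (M [EE N k (- int s), EE k N (int s)] \<ominus>\<^bsub>U\<^esub>
                       M [EE 1 k (- int s - 1), EE k 1 (int s + 1)])))
     else
       (((\<alpha> - of_nat i * \<epsilon>1) \<odot>\<^bsub>U\<^esub> ev_h0 N \<kappa> i) \<ominus>\<^bsub>U\<^esub>
        (hb \<odot>\<^bsub>U\<^esub> M [EE i i 0, EE (i + 1) (i + 1) 0])) \<oplus>\<^bsub>U\<^esub>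
       (hb \<odot>\<^bsub>U\<^esub> comp_series N \<kappa> (\<lambda>s.
          (((\<Oplus>\<^bsub>U\<^esub>k\<in>{1..i}. M [EE i k (- int s), EE k i (int s)]) \<oplus>\<^bsub>U\<^esub>
            (\<Oplus>\<^bsub>U\<^esub>k\<in>{i+1..N}. M [EE i k (- int s - 1), EE k i (int s + 1)])) \<ominus>\<^bsub>U\<^esub>
           (\<Oplus>\<^bsub>U\<^esub>k\<in>{1..i}. M [EE (i + 1) k (- int s), EE k (i + 1) (int s)])) \<ominus>\<^bsub>U\<^esub>
          (\<Oplus>\<^bsub>U\<^esub>k\<in>{i+1..N}. M [EE (i + 1) k (- int s - 1), EE k (i + 1) (int s + 1)]))))"

definition is_evaluation_map ::
    "nat \<Rightarrow> complex \<Rightarrow> complex \<Rightarrow> complex \<Rightarrow> complex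
      \<Rightarrow> (yangian_gen free set \<Rightarrow> nat \<Rightarrow> nat \<Rightarrow> gl_gen free set) \<Rightarrow> bool" where
  "is_evaluation_map N \<epsilon>1 \<epsilon>2 \<kappa> \<alpha> ev \<longleftrightarrow>
    ev \<in> alg_hom (affine_yangian N \<epsilon>1 \<epsilon>2) (U_comp N \<kappa>) \<and>
    (\<forall>i<N.
       (\<forall>\<sigma>. ev (yX N \<epsilon>1 \<epsilon>2 \<sigma> i 0) = ev_x0 N \<kappa> \<sigma> i) \<and>
       ev (yH N \<epsilon>1 \<epsilon>2 i 0) = ev_h0 N \<kappa> i \<and>
       ev (yX N \<epsilon>1 \<epsilon>2 Pl i 1) = ev_xp1 N \<epsilon>1 \<epsilon>2 \<kappa> \<alpha> i \<and>
       ev (yX N \<epsilon>1 \<epsilon>2 Mi i 1) = ev_xm1 N \<epsilon>1 \<epsilon>2 \<kappa> \<alpha> i \<and>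
       ev (yH N \<epsilon>1 \<epsilon>2 i 1) = ev_h1 N \<epsilon>1 \<epsilon>2 \<kappa> \<alpha> i)"


section \<open>Highest weight modules and evaluation modules\<close>

text \<open>
  The weight $\Lambda$ is given by \<open>lam i\<close> $= \langle E_{i,i}, \Lambda\rangle$ for $1 \le i \le N$ and
  \<open>K\<close> $= \langle c, \Lambda\rangle$.
\<close>

definition dominant_integral_weight :: "nat \<Rightarrow> (nat \<Rightarrow> complex) \<Rightarrow> nat \<Rightarrow> bool" where
  "dominant_integral_weight N lam K \<longleftrightarrow>
    (\<forall>i\<in>{1..N-1}. lam i - lam (i + 1) \<in> \<nat>) \<and> lam N - lam 1 + of_nat K \<in> \<nat>"

definition coroot_pairing :: "nat \<Rightarrow> (nat \<Rightarrow> complex) \<Rightarrow> nat \<Rightarrow> nat \<Rightarrow> complex" where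
  "coroot_pairing N lam K i =
    (if i = 0 then lam N - lam 1 + of_nat K else lam i - lam (i + 1))"

text \<open>A module is a vector space with an algebra homomorphism \<open>\<rho>\<close> to its endomorphisms.\<close>

definition is_gl_module ::
    "nat \<Rightarrow> complex \<Rightarrow> (complex \<Rightarrow> 'v::ab_group_add \<Rightarrow> 'v) \<Rightarrow> (gl_gen free set \<Rightarrow> 'v \<Rightarrow> 'v) \<Rightarrow> bool" where
  "is_gl_module N \<kappa> scale \<rho> \<longleftrightarrow>
    vector_space scale \<and> \<rho> \<in> alg_hom (U_gl N \<kappa>) (end_algebra scale)"

definition is_highest_weight_vector ::
    "nat \<Rightarrow> (nat \<Rightarrow> complex) \<Rightarrow> nat \<Rightarrow> (complex \<Rightarrow> 'v::ab_group_add \<Rightarrow> 'v)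
      \<Rightarrow> (gl_gen free set \<Rightarrow> 'v \<Rightarrow> 'v) \<Rightarrow> 'v \<Rightarrow> bool" where
  "is_highest_weight_vector N lam K scale \<rho> v \<longleftrightarrow>
    v \<noteq> 0 \<and>
    (\<forall>g\<in>n_plus N. \<rho> (U_class N (of_nat K) (gen g)) v = 0) \<and>
    (\<forall>i\<in>{1..N}. \<rho> (U_class N (of_nat K) (gen (EE i i 0))) v = scale (lam i) v) \<and>
    \<rho> (U_class N (of_nat K) (gen CC)) v = scale (of_nat K) v"

definition is_irreducible ::
    "nat \<Rightarrow> complex \<Rightarrow> (complex \<Rightarrow> 'v::ab_group_add \<Rightarrow> 'v) \<Rightarrow> (gl_gen free set \<Rightarrow> 'v \<Rightarrow> 'v) \<Rightarrow> bool" where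
  "is_irreducible N \<kappa> scale \<rho> \<longleftrightarrow>
    (\<exists>x::'v. x \<noteq> 0) \<and>
    (\<forall>W. Modules.module.subspace scale W \<and> (\<forall>u\<in>carrier (U_gl N \<kappa>). \<forall>x\<in>W. \<rho> u x \<in> W)
       \<longrightarrow> W = {0} \<or> W = UNIV)"

text \<open>Integrable: diagonalizable over the Cartan subalgebra, Chevalley generators locally nilpotent.\<close>

definition is_integrable ::
    "nat \<Rightarrow> complex \<Rightarrow> (complex \<Rightarrow> 'v::ab_group_add \<Rightarrow> 'v) \<Rightarrow> (gl_gen free set \<Rightarrow> 'v \<Rightarrow> 'v) \<Rightarrow> bool" where
  "is_integrable N \<kappa> scale \<rho> \<longleftrightarrow>
    Modules.module.span scale
      {x. \<exists>\<mu>. \<forall>g\<in>h_cartan N. \<rho> (U_class N \<kappa> (gen g)) x = scale (\<mu> g) x} = UNIV \<and>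
    (\<forall>\<sigma>. \<forall>i<N. \<forall>x. \<exists>n. (\<rho> (U_class N \<kappa> (gen (chevalley N \<sigma> i))) ^^ n) x = 0)"

text \<open>
  \<open>(scale, \<rho>)\<close> is $L(\Lambda)$ with highest weight vector \<open>v\<close>.  This determines the pair up to a unique
  isomorphism; irreducibility makes the module generated by \<open>v\<close>.
\<close>

definition is_L ::
    "nat \<Rightarrow> (nat \<Rightarrow> complex) \<Rightarrow> nat \<Rightarrow> (complex \<Rightarrow> 'v::ab_group_add \<Rightarrow> 'v)
      \<Rightarrow> (gl_gen free set \<Rightarrow> 'v \<Rightarrow> 'v) \<Rightarrow> 'v \<Rightarrow> bool" where
  "is_L N lam K scale \<rho> v \<longleftrightarrow>
    is_gl_module N (of_nat K) scale \<rho> \<and>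
    is_irreducible N (of_nat K) scale \<rho> \<and>
    is_integrable N (of_nat K) scale \<rho> \<and>
    is_highest_weight_vector N lam K scale \<rho> v"

text \<open>
  Action of the completion on a highest weight module: for a fixed vector \<open>x\<close> only finitely many
  components act non-trivially, since components with large $s$ annihilate \<open>x\<close>.
\<close>

definition comp_act ::
    "(gl_gen free set \<Rightarrow> 'v \<Rightarrow> 'v::ab_group_add) \<Rightarrow> (nat \<Rightarrow> nat \<Rightarrow> gl_gen free set) \<Rightarrow> 'v \<Rightarrow> 'v" where
  "comp_act \<rho> u x = (\<Sum>(r, s) | \<rho> (u r s) x \<noteq> 0. \<rho> (u r s) x)"

text \<open>Pullback of the module \<open>\<rho>\<close> along \<open>ev\<close>; for $L(\Lambda)$ this is $L(\Lambda,\alpha)$.\<close>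

definition eval_act ::
    "(gl_gen free set \<Rightarrow> 'v \<Rightarrow> 'v::ab_group_add)
      \<Rightarrow> (yangian_gen free set \<Rightarrow> nat \<Rightarrow> nat \<Rightarrow> gl_gen free set) \<Rightarrow> yangian_gen free set \<Rightarrow> 'v \<Rightarrow> 'v" where
  "eval_act \<rho> ev y x = comp_act \<rho> (ev y) x"

end

theory Submission
  imports Defs
begin

text \<open>
  For a fixed node $i$ the generators with index $i$ satisfy the relations of the Yangian of
  $\mathfrak{sl}_2$, and these relations propagate information from the degrees $r = 0, 1$ to all $r$
  (\<open>rank_one_highest_weight\<close>).  The commutator of $h_{i,1}$ with $x^\pm_{i,r}$ equals
  $\pm 2 x^\pm_{i,r+1}$ up to a multiple of $\{h_{i,0}, x^\pm_{i,r}\}$.  If $v$ is an eigenvector of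
  $h_{i,0}$ and $h_{i,1}$ with $x^+_{i,0} v = 0$, this gives $x^+_{i,r} v = 0$ for all $r$; if moreover
  $x^-_{i,1} v = a\, x^-_{i,0} v$, it gives $x^-_{i,r} v = a^r x^-_{i,0} v$, hence
  $h_{i,r} v = x^+_{i,0} x^-_{i,r} v = a^r h_{i,0} v$.  Since $h_{i,1} = [x^+_{i,0}, x^-_{i,1}]$, the
  eigenvalue of $h_{i,1}$ follows from the same data.

  It remains to compute $x^-_{i,1} v_\Lambda$ from the evaluation map.  Every summand of the series
  $\mathrm{ev}(x^-_{i,1})$ ends in some $E_{k,i}(s)$, and the highest weight vector is killed by all of
  these except the Cartan element $E_{i,i}(0)$, which multiplies it by $\lambda_i$.  What is left is
  $(\alpha - i\varepsilon_1 + \hbar\lambda_i)$ times $x^-_{i,0} v_\Lambda$, so $a = a_i$; for $i = 0$, the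
  indices of $E$ and $\lambda$ and the factor in front of $\varepsilon_1$ are $N$
  (\<open>yact_xm1_zero\<close>, \<open>yact_xm1_nonzero\<close>).

  Both steps presuppose that pulling back along the evaluation map produces a module, that is, that the
  completed enveloping algebra acts multiplicatively on a highest weight module (\<open>comp_act_mult\<close>).
  The product of the completion is specified as a limit of products of truncations, so such a limit must
  be shown to exist (\<open>comp_prod_exists\<close>).  The source of this is the spanning half of the
  Poincare-Birkhoff-Witt theorem with control of degrees (\<open>triangular_straightening\<close>,
  \<open>triangular_times_triangular\<close>): in the triangular form of a product, the degree of the
  $\hat{\mathfrak n}_+$ part is bounded below by that of the right factor and by that of the left factor
  minus a constant, so that each component receives finitely many contributions.  The same
  straightening shows that $\hat{\mathfrak n}_+$ parts of large degree kill any given vector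
  (\<open>smooth\<close>); on a given vector, elements of the completion thus act through their truncations, and
  multiplicativity passes to the limit.
\<close>

section \<open>Polynomials in a free algebra\<close>

abbreviation word_span :: "'g list set \<Rightarrow> 'g free set" where
  "word_span S \<equiv> {p. Poly_Mapping.keys p \<subseteq> Word ` S}"

lemma cst_0 [simp]: "cst 0 = (0 :: 'g free)"
  by (simp add: cst_def)

lemma cst_1 [simp]: "cst 1 = (1 :: 'g free)"
  by (simp add: cst_def)

lemma cst_minus: "cst (- a) = (- cst a :: 'g free)"
  by (simp add: cst_def single_uminus)

lemma monom_word_Nil [simp]: "monom_word [] = (1 :: 'g free)"
  by (simp add: monom_word_def zero_fword_def[symmetric])

lemma monom_word_append: "monom_word (u @ w) = (monom_word u * monom_word w :: 'g free)"
  by (simp add: monom_word_def mult_single plus_fword_def)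

lemma monom_word_Cons: "monom_word (g # w) = (gen g * monom_word w :: 'g free)"
  using monom_word_append[of "[g]" w] by (simp add: gen_def)

lemma cst_times_monom_word: "cst c * monom_word w = Poly_Mapping.single (Word w) c"
  by (simp add: monom_word_def cst_def mult_single zero_fword_def plus_fword_def)

lemma poly_eq_sum_monomials:
  "(p :: 'g free) = (\<Sum>w\<in>Poly_Mapping.keys p. cst (Poly_Mapping.lookup p w) * monom_word (letters w))"
proof (rule poly_mapping_eqI)
  fix k
  have "(\<Sum>w\<in>Poly_Mapping.keys p. Poly_Mapping.lookup (Poly_Mapping.single w (Poly_Mapping.lookup p w)) k)
      = (\<Sum>w\<in>Poly_Mapping.keys p. if k = w then Poly_Mapping.lookup p w else 0)"
    by (rule sum.cong) (auto simp: lookup_single when_def)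
  then show "Poly_Mapping.lookup p k = Poly_Mapping.lookup
      (\<Sum>w\<in>Poly_Mapping.keys p. cst (Poly_Mapping.lookup p w) * monom_word (letters w)) k"
    by (simp add: cst_times_monom_word lookup_sum in_keys_iff)
qed

text \<open>
  Scalars sit on the empty word, which commutes with every word; so they are central although the
  polynomials do not commute.
\<close>
lemma cst_commute: "cst c * p = (p * cst c :: 'g free)"
proof -
  have "cst c * (cst a * monom_word w) = (cst a * monom_word w) * cst c" for a and w :: "'g list"
    by (simp add: cst_def monom_word_def mult_single zero_fword_def plus_fword_def mult.commute)
  then have "cst c * (\<Sum>w\<in>X. cst (f w) * monom_word (letters w)) =
      (\<Sum>w\<in>X. cst (f w) * monom_word (letters w)) * cst c" for X and f :: "'g fword \<Rightarrow> complex"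
    by (simp only: sum_distrib_left sum_distrib_right)
  from this[of "Poly_Mapping.lookup p" "Poly_Mapping.keys p"] show ?thesis
    by (simp only: poly_eq_sum_monomials[symmetric])
qed

lemma word_span_0 [simp]: "0 \<in> word_span S"
  by simp

lemma word_span_add: "p \<in> word_span S \<Longrightarrow> q \<in> word_span S \<Longrightarrow> p + q \<in> word_span S"
  using keys_add[of p q] by blast

lemma word_span_uminus: "(p :: 'g free) \<in> word_span S \<Longrightarrow> - p \<in> word_span S"
  by (auto simp: in_keys_iff)

lemma word_span_diff:
  "(p :: 'g free) \<in> word_span S \<Longrightarrow> q \<in> word_span S \<Longrightarrow> p - q \<in> word_span S"
  using word_span_add[of p S "- q"] word_span_uminus[of q S] by simp

lemma word_span_sum:
  assumes "\<And>x. x \<in> A \<Longrightarrow> (f x :: 'g free) \<in> word_span S"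
  shows "(\<Sum>x\<in>A. f x) \<in> word_span S"
  using assms
proof (induction A rule: infinite_finite_induct)
  case (insert x A)
  then show ?case using word_span_add[of "f x" S "sum f A"] by simp
qed auto

lemma word_span_single: "w \<in> S \<Longrightarrow> cst c * monom_word w \<in> word_span S"
  by (auto simp: cst_times_monom_word)

lemma word_span_monom: "w \<in> S \<Longrightarrow> monom_word w \<in> word_span S"
  by (auto simp: monom_word_def)

lemma word_span_mono: "S \<subseteq> T \<Longrightarrow> p \<in> word_span S \<Longrightarrow> p \<in> word_span T"
  by blast

text \<open>
  Linear extension: properties closed under addition only have to be checked on scaled words.
\<close>
lemma word_span_induct [consumes 1, case_names zero add monom]:
  assumes "(p :: 'g free) \<in> word_span S" "P 0" "\<And>p q. P p \<Longrightarrow> P q \<Longrightarrow> P (p + q)"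
    and "\<And>c w. w \<in> S \<Longrightarrow> P (cst c * monom_word w)"
  shows "P p"
proof -
  have "P (\<Sum>w\<in>A. cst (Poly_Mapping.lookup p w) * monom_word (letters w))"
    if "A \<subseteq> Poly_Mapping.keys p" for A
    using that
  proof (induction A rule: infinite_finite_induct)
    case (insert w A)
    then have "letters w \<in> S" using assms(1) by auto
    with insert show ?case using assms(3,4) by simp
  qed (auto simp: assms(2))
  then show ?thesis using poly_eq_sum_monomials[of p] by (metis order_refl)
qed

lemma word_span_mult:
  assumes "(p :: 'g free) \<in> word_span S" "q \<in> word_span T"
    and "\<And>u w. u \<in> S \<Longrightarrow> w \<in> T \<Longrightarrow> u @ w \<in> V"
  shows "p * q \<in> word_span V"
proof -
  have "Poly_Mapping.keys (p * q) \<subseteq> {a + b |a b. a \<in> Poly_Mapping.keys p \<and> b \<in> Poly_Mapping.keys q}"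
    by (rule keys_mult)
  also have "\<dots> \<subseteq> Word ` V"
  proof
    fix x assume "x \<in> {a + b |a b. a \<in> Poly_Mapping.keys p \<and> b \<in> Poly_Mapping.keys q}"
    then obtain u w where "u \<in> S" "w \<in> T" "x = Word u + Word w"
      using assms(1,2) by blast
    then show "x \<in> Word ` V"
      using assms(3)[of u w] by (simp add: plus_fword_def)
  qed
  finally show ?thesis by simp
qed

lemma carrier_free_algebra: "carrier (free_algebra G) = word_span (lists G)"
proof -
  have "set (letters w) \<subseteq> G \<longleftrightarrow> w \<in> Word ` lists G" for w
    by (cases w) (auto simp: in_lists_conv_set)
  then show ?thesis by (auto simp: free_algebra_def)
qed

definition word_part :: "('g list \<Rightarrow> bool) \<Rightarrow> 'g free \<Rightarrow> 'g free" where
  "word_part P p = Poly_Mapping.mapp (\<lambda>w c. if P (letters w) then c else 0) p"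

lemma lookup_word_part:
  "Poly_Mapping.lookup (word_part P p) w = (if P (letters w) then Poly_Mapping.lookup p w else 0)"
  by (auto simp: word_part_def mapp.rep_eq in_keys_iff)

lemma word_part_0 [simp]: "word_part P 0 = 0"
  by (rule poly_mapping_eqI) (simp add: lookup_word_part)

lemma word_part_add: "word_part P (p + q) = word_part P p + word_part P q"
  by (rule poly_mapping_eqI) (simp add: lookup_word_part lookup_add)

lemma word_part_sum: "word_part P (\<Sum>x\<in>A. f x) = (\<Sum>x\<in>A. word_part P (f x))"
  by (induction A rule: infinite_finite_induct) (auto simp: word_part_add)

lemma word_part_compl: "p = word_part P p + word_part (\<lambda>w. \<not> P w) p"
  by (rule poly_mapping_eqI) (simp add: lookup_word_part lookup_add)

lemma word_span_part: "p \<in> word_span S \<Longrightarrow> word_part P p \<in> word_span {w \<in> S. P w}"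
proof
  assume p: "p \<in> word_span S"
  have "x \<in> Word ` {w \<in> S. P w}" if "x \<in> Poly_Mapping.keys (word_part P p)" for x
  proof (cases x)
    case (Word w)
    with that have "P w" "x \<in> Poly_Mapping.keys p"
      by (auto simp: in_keys_iff lookup_word_part split: if_splits)
    with p Word show ?thesis by auto
  qed
  then show "Poly_Mapping.keys (word_part P p) \<subseteq> Word ` {w \<in> S. P w}" by blast
qed

lemma word_part_eq_0: "p \<in> word_span S \<Longrightarrow> (\<And>w. w \<in> S \<Longrightarrow> \<not> P w) \<Longrightarrow> word_part P p = 0"
  using word_span_part[of p S P] by (auto simp: poly_mapping_eq_iff fun_eq_iff in_keys_iff)

section \<open>Algebras given by generators and relations\<close>

text \<open>
  Calculations are carried out with polynomials modulo the ideal of the relations; this locale relates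
  them to the operations on residue classes.
\<close>
locale presentation =
  fixes G :: "'g set" and R :: "'g free set"
  assumes rels: "R \<subseteq> carrier (free_algebra G)"
begin

abbreviation F where "F \<equiv> carrier (free_algebra G)"
abbreviation J where "J \<equiv> relation_ideal G R"
abbreviation A where "A \<equiv> presented_algebra G R"
abbreviation cls where "cls \<equiv> presented_class G R"

lemma free_simps:
  "mult (free_algebra G) = (*)" "one (free_algebra G) = 1" "zero (free_algebra G) = 0"
  "add (free_algebra G) = (+)" "smult (free_algebra G) = (\<lambda>z p. cst z * p)"
  by (simp_all add: free_algebra_def)

lemma F_add: "p \<in> F \<Longrightarrow> q \<in> F \<Longrightarrow> p + q \<in> F"
  unfolding carrier_free_algebra by (rule word_span_add)
lemma F_diff: "p \<in> F \<Longrightarrow> q \<in> F \<Longrightarrow> p - q \<in> F"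
  unfolding carrier_free_algebra by (rule word_span_diff)
lemma F_uminus: "p \<in> F \<Longrightarrow> - p \<in> F"
  unfolding carrier_free_algebra by (rule word_span_uminus)
lemma F_mult: "p \<in> F \<Longrightarrow> q \<in> F \<Longrightarrow> p * q \<in> F"
  unfolding carrier_free_algebra by (erule word_span_mult) auto
lemma F_monom: "set w \<subseteq> G \<Longrightarrow> monom_word w \<in> F"
  unfolding carrier_free_algebra by (intro word_span_monom) auto
lemma F_gen: "g \<in> G \<Longrightarrow> gen g \<in> F"
  unfolding gen_def by (intro F_monom) auto
lemma F_1: "1 \<in> F"
  using F_monom[of "[]"] by simp
lemma F_0: "0 \<in> F"
  unfolding carrier_free_algebra by simp
lemma F_cst: "cst c \<in> F"
  unfolding carrier_free_algebra using word_span_single[of "[]" "lists G" c] by simp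
lemma F_sum: "(\<And>x. x \<in> X \<Longrightarrow> f x \<in> F) \<Longrightarrow> (\<Sum>x\<in>X. f x) \<in> F"
  unfolding carrier_free_algebra by (rule word_span_sum)

lemmas F_intros = F_add F_diff F_uminus F_mult F_monom F_gen F_1 F_0 F_cst F_sum

lemma ring_free: "ring (free_algebra G)"
proof (intro ringI abelian_groupI monoidI)
  fix x assume "x \<in> F"
  then show "\<exists>y\<in>F. y \<oplus>\<^bsub>free_algebra G\<^esub> x = \<zero>\<^bsub>free_algebra G\<^esub>"
    by (intro bexI[of _ "- x"] F_uminus) (simp_all add: free_simps)
qed (auto simp: free_simps algebra_simps intro: F_intros)

lemma ideal_J: "ideal J (free_algebra G)"
  unfolding relation_ideal_def using ring.genideal_ideal[OF ring_free rels] .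

sublocale ideal J "free_algebra G"
  by (rule ideal_J)

lemma J_add: "p \<in> J \<Longrightarrow> q \<in> J \<Longrightarrow> p + q \<in> J"
  using additive_subgroup.a_closed[OF additive_subgroup_axioms, of p q] by (simp add: free_simps)

lemma J_0: "0 \<in> J"
  using additive_subgroup.zero_closed[OF additive_subgroup_axioms] by (simp add: free_simps)

lemma J_mult_left: "p \<in> J \<Longrightarrow> q \<in> F \<Longrightarrow> q * p \<in> J"
  using I_l_closed[of p q] by (simp add: free_simps)

lemma J_mult_right: "p \<in> J \<Longrightarrow> q \<in> F \<Longrightarrow> p * q \<in> J"
  using I_r_closed[of p q] by (simp add: free_simps)

lemma J_uminus: "p \<in> J \<Longrightarrow> - p \<in> J"
  using J_mult_left[OF _ F_cst, of p "- 1"] by (simp add: cst_minus)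

lemma rel_J: "p \<in> R \<Longrightarrow> p \<in> J"
  unfolding relation_ideal_def using ring.genideal_self[OF ring_free rels] by blast

definition eqv (infix "\<approx>" 50) where "p \<approx> q \<longleftrightarrow> p - q \<in> J"

lemma eqv_refl [simp, intro]: "p \<approx> p"
  by (simp add: eqv_def J_0)

lemma eqv_sym: "p \<approx> q \<Longrightarrow> q \<approx> p"
  using J_uminus[of "p - q"] by (simp add: eqv_def)

lemma eqv_trans [trans]: "p \<approx> q \<Longrightarrow> q \<approx> r \<Longrightarrow> p \<approx> r"
  using J_add[of "p - q" "q - r"] by (simp add: eqv_def)

lemma eqv_add: "p \<approx> q \<Longrightarrow> p' \<approx> q' \<Longrightarrow> p + p' \<approx> q + q'"
  using J_add[of "p - q" "p' - q'"] by (simp add: eqv_def algebra_simps)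

lemma eqv_uminus: "p \<approx> q \<Longrightarrow> - p \<approx> - q"
  using J_uminus[of "p - q"] by (simp add: eqv_def algebra_simps)

lemma eqv_diff: "p \<approx> q \<Longrightarrow> p' \<approx> q' \<Longrightarrow> p - p' \<approx> q - q'"
  using eqv_add[OF _ eqv_uminus] by fastforce

lemma eqv_sum: "(\<And>x. x \<in> X \<Longrightarrow> f x \<approx> g x) \<Longrightarrow> (\<Sum>x\<in>X. f x) \<approx> (\<Sum>x\<in>X. g x)"
  by (induction X rule: infinite_finite_induct) (auto intro: eqv_add)

lemma eqv_mult_left: "p \<approx> q \<Longrightarrow> r \<in> F \<Longrightarrow> r * p \<approx> r * q"
  using J_mult_left[of "p - q" r] by (simp add: eqv_def algebra_simps)

lemma eqv_mult_right: "p \<approx> q \<Longrightarrow> r \<in> F \<Longrightarrow> p * r \<approx> q * r"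
  using J_mult_right[of "p - q" r] by (simp add: eqv_def algebra_simps)

lemma cls_eq: "cls p = {h + p |h. h \<in> J}"
  by (auto simp: presented_class_def a_r_coset_def' free_simps)

lemma cls_eq_iff: "cls p = cls q \<longleftrightarrow> p \<approx> q"
proof
  assume "cls p = cls q"
  moreover have "p \<in> cls p" using J_0 by (force simp: cls_eq)
  ultimately obtain h where "h \<in> J" "p = h + q" by (auto simp: cls_eq)
  then show "p \<approx> q" by (simp add: eqv_def)
next
  have "cls p \<subseteq> cls q" if "p \<approx> q" for p q
  proof
    fix x assume "x \<in> cls p"
    then obtain h where h: "h \<in> J" "x = h + p" by (auto simp: cls_eq)
    then have "h + (p - q) \<in> J" "x = (h + (p - q)) + q"
      using that J_add by (auto simp: eqv_def)
    then show "x \<in> cls q" unfolding cls_eq by blast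
  qed
  then show "p \<approx> q \<Longrightarrow> cls p = cls q" using eqv_sym by blast
qed

lemma mem_cls_iff: "x \<in> cls p \<longleftrightarrow> x \<approx> p"
proof -
  have "x = (x - p) + p" by simp
  then show ?thesis unfolding cls_eq eqv_def by (smt (verit) add_diff_cancel_right' mem_Collect_eq)
qed

lemma A_simps: "carrier A = cls ` F" "mult A = mult (free_algebra G Quot J)"
  "one A = cls 1" "zero A = cls 0" "add A = add (free_algebra G Quot J)"
proof -
  show "zero A = cls 0"
    using cls_eq[of 0] by (simp add: presented_algebra_def quotient_algebra_def FactRing_def)
qed (auto simp: presented_algebra_def quotient_algebra_def FactRing_def A_RCOSETS_def' presented_class_def free_simps)

lemma A_mult: "p \<in> F \<Longrightarrow> q \<in> F \<Longrightarrow> cls p \<otimes>\<^bsub>A\<^esub> cls q = cls (p * q)"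
  by (simp add: A_simps FactRing_def presented_class_def rcoset_mult_add free_simps)

lemma A_add: "p \<in> F \<Longrightarrow> q \<in> F \<Longrightarrow> cls p \<oplus>\<^bsub>A\<^esub> cls q = cls (p + q)"
  by (simp add: A_simps FactRing_def presented_class_def a_rcos_sum free_simps)

text \<open>
  The scalar multiple of a class is a union over all representatives of the class, which collapses
  because multiplication by a scalar maps the ideal into itself.
\<close>
lemma A_smult: assumes "p \<in> F" shows "z \<odot>\<^bsub>A\<^esub> cls p = cls (cst z * p)"
proof -
  have "z \<odot>\<^bsub>A\<^esub> cls p = (\<Union>q\<in>cls p. cls (cst z * q))"
    by (simp add: presented_algebra_def quotient_algebra_def presented_class_def free_simps)
  also have "\<dots> = (\<Union>q\<in>cls p. cls (cst z * p))"
    using F_cst by (intro SUP_cong refl) (auto simp: mem_cls_iff cls_eq_iff intro: eqv_mult_left)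
  also have "\<dots> = cls (cst z * p)"
    using mem_cls_iff[of p p] by auto
  finally show ?thesis .
qed

lemma ring_A: "ring A"
proof (intro ringI abelian_groupI monoidI)
  fix x assume "x \<in> carrier A"
  then obtain p where p: "p \<in> F" "x = cls p" by (auto simp: A_simps)
  then show "\<exists>y\<in>carrier A. y \<oplus>\<^bsub>A\<^esub> x = \<zero>\<^bsub>A\<^esub>"
    by (intro bexI[of _ "cls (- p)"]) (auto simp: A_add A_simps(1,4) F_uminus)
qed (auto simp: A_simps(1,3,4) A_mult A_add F_add F_mult F_1 F_0 algebra_simps)

sublocale quot: ring A
  by (rule ring_A)

lemma cls_carrier: "p \<in> F \<Longrightarrow> cls p \<in> carrier A"
  by (simp add: A_simps)

lemma A_uminus: "p \<in> F \<Longrightarrow> \<ominus>\<^bsub>A\<^esub> cls p = cls (- p)"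
  by (rule quot.minus_equality) (simp_all add: A_add A_simps(1,4) F_uminus)

lemma A_diff: "p \<in> F \<Longrightarrow> q \<in> F \<Longrightarrow> cls p \<ominus>\<^bsub>A\<^esub> cls q = cls (p - q)"
  by (simp add: a_minus_def A_uminus A_add F_uminus)

lemma A_finsum:
  "(\<And>x. x \<in> X \<Longrightarrow> f x \<in> F) \<Longrightarrow> finsum A (\<lambda>x. cls (f x)) X = cls (\<Sum>x\<in>X. f x)"
proof (induction X rule: infinite_finite_induct)
  case (insert x X)
  then show ?case
    by (subst quot.finsum_insert) (auto simp: A_add F_sum cls_carrier)
next
  case (infinite X)
  then show ?case by (simp add: quot.add.finprod_infinite A_simps)
qed (simp add: A_simps)

end

section \<open>Triangular straightening\<close>

definition pos_deg :: "gl_gen list \<Rightarrow> nat" where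
  "pos_deg w = (\<Sum>g\<leftarrow>w. nat (gl_deg g))"

definition neg_deg :: "gl_gen list \<Rightarrow> nat" where
  "neg_deg w = (\<Sum>g\<leftarrow>w. nat (- gl_deg g))"

definition word_deg :: "gl_gen list \<Rightarrow> int" where
  "word_deg w = (\<Sum>g\<leftarrow>w. gl_deg g)"

lemma deg_simps [simp]:
  "pos_deg [] = 0" "neg_deg [] = 0" "word_deg [] = 0"
  "pos_deg (g # w) = nat (gl_deg g) + pos_deg w" "neg_deg (g # w) = nat (- gl_deg g) + neg_deg w"
  "word_deg (g # w) = gl_deg g + word_deg w"
  "pos_deg (u @ w) = pos_deg u + pos_deg w" "neg_deg (u @ w) = neg_deg u + neg_deg w"
  "word_deg (u @ w) = word_deg u + word_deg w"
  by (simp_all add: pos_deg_def neg_deg_def word_deg_def)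

lemma word_deg_eq: "word_deg w = int (pos_deg w) - int (neg_deg w)"
  by (induction w) auto

lemma n_minus_pos_deg: "set a \<subseteq> n_minus N \<Longrightarrow> pos_deg a = 0"
  by (induction a) (auto simp: n_minus_def)

lemma n_plus_neg_deg: "set a \<subseteq> n_plus N \<Longrightarrow> neg_deg a = 0"
  by (induction a) (auto simp: n_plus_def)

lemma h_cartan_deg: "set a \<subseteq> h_cartan N \<Longrightarrow> pos_deg a = 0" "set a \<subseteq> h_cartan N \<Longrightarrow> neg_deg a = 0"
  by (induction a) (auto simp: h_cartan_def)

definition triangular :: "nat \<Rightarrow> gl_gen list set" where
  "triangular N = {a @ b @ d |a b d. set a \<subseteq> n_minus N \<and> set b \<subseteq> h_cartan N \<and> set d \<subseteq> n_plus N}"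

text \<open>
  The two degrees of a triangular word can be read off from the word alone, because letters of
  $\hat{\mathfrak n}_-$, $\hat{\mathfrak h}$ and $\hat{\mathfrak n}_+$ have degrees $\le 0$, $0$ and
  $\ge 0$.
\<close>
lemma tri_words_eq: "tri_words N r s = {w \<in> triangular N. neg_deg w = r \<and> pos_deg w = s}"
proof -
  have deg: "neg_deg (a @ b @ d) = r \<longleftrightarrow> sum_list (map gl_deg a) = - int r"
    "pos_deg (a @ b @ d) = s \<longleftrightarrow> sum_list (map gl_deg d) = int s"
    if "set a \<subseteq> n_minus N" "set b \<subseteq> h_cartan N" "set d \<subseteq> n_plus N" for a b d
    using that n_minus_pos_deg[of a N] n_plus_neg_deg[of d N] h_cartan_deg[of b N]
      word_deg_eq[of a] word_deg_eq[of d] by (auto simp: word_deg_def)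
  show ?thesis
  proof (intro Set.set_eqI iffI)
    fix w assume "w \<in> tri_words N r s"
    then obtain a b d where w: "w = a @ b @ d" "set a \<subseteq> n_minus N" "set b \<subseteq> h_cartan N"
        "set d \<subseteq> n_plus N" "sum_list (map gl_deg a) = - int r" "sum_list (map gl_deg d) = int s"
      unfolding tri_words_def by blast
    then have "w \<in> triangular N" unfolding triangular_def by blast
    with w deg[OF w(2-4)] show "w \<in> {w \<in> triangular N. neg_deg w = r \<and> pos_deg w = s}"
      by simp
  next
    fix w assume "w \<in> {w \<in> triangular N. neg_deg w = r \<and> pos_deg w = s}"
    then obtain a b d where w: "w = a @ b @ d" "set a \<subseteq> n_minus N" "set b \<subseteq> h_cartan N"
        "set d \<subseteq> n_plus N" "neg_deg w = r" "pos_deg w = s"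
      unfolding triangular_def by blast
    then have "sum_list (map gl_deg a) = - int r" "sum_list (map gl_deg d) = int s"
      using deg[OF w(2-4)] by simp_all
    with w(1-4) show "w \<in> tri_words N r s"
      unfolding tri_words_def by blast
  qed
qed

lemma gl_gens_cases:
  assumes "g \<in> gl_gens N"
  obtains "g \<in> n_minus N" | "g \<in> h_cartan N" | "g \<in> n_plus N"
proof (cases g)
  case (EE i j s)
  with assms have "i \<in> {1..N}" "j \<in> {1..N}" by (auto simp: gl_gens_def)
  then consider "g \<in> n_minus N" | "i = j" "s = 0" | "g \<in> n_plus N"
    unfolding n_minus_def n_plus_def EE
    by (smt (verit, ccfv_threshold) linorder_neqE_nat mem_Collect_eq order_le_less)
  then show ?thesis
    using that \<open>i \<in> {1..N}\<close> EE by cases (auto simp: h_cartan_def)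
qed (use that in \<open>auto simp: h_cartan_def\<close>)

lemma triangular_part_subset: "n_minus N \<subseteq> gl_gens N" "h_cartan N \<subseteq> gl_gens N" "n_plus N \<subseteq> gl_gens N"
  by (auto simp: n_minus_def h_cartan_def n_plus_def gl_gens_def)

lemma triangular_gens: "w \<in> triangular N \<Longrightarrow> set w \<subseteq> gl_gens N"
  unfolding triangular_def
  by clarify (auto dest: set_mp[OF triangular_part_subset(1)] set_mp[OF triangular_part_subset(2)]
      set_mp[OF triangular_part_subset(3)] dest!: set_mp)

lemma triangularI:
  "set a \<subseteq> n_minus N \<Longrightarrow> set b \<subseteq> h_cartan N \<Longrightarrow> set d \<subseteq> n_plus N \<Longrightarrow> a @ b @ d \<in> triangular N"
  unfolding triangular_def by blast

lemma triangular_sandwich: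
  assumes "w \<in> triangular N" "set a \<subseteq> n_minus N" "set d \<subseteq> n_plus N"
  shows "a @ w @ d \<in> triangular N"
proof -
  obtain a' b' d' where "w = a' @ b' @ d'" "set a' \<subseteq> n_minus N" "set b' \<subseteq> h_cartan N" "set d' \<subseteq> n_plus N"
    using assms(1) by (auto simp: triangular_def)
  then show ?thesis
    using triangularI[of "a @ a'" N b' "d' @ d"] assms(2,3) by simp
qed

context presentation
begin

text \<open>
  The polynomials that the relations rewrite to combinations of words in \<open>S\<close>.  Spanning statements
  about the presented algebra become membership statements.
\<close>
definition reducible :: "'g list set \<Rightarrow> 'g free set" where
  "reducible S = {p. \<exists>q\<in>word_span S. p \<approx> q}"

lemma reducible_span: "p \<in> word_span S \<Longrightarrow> p \<in> reducible S"
  unfolding reducible_def by blast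

lemma reducible_monom: "w \<in> S \<Longrightarrow> monom_word w \<in> reducible S"
  by (rule reducible_span) (rule word_span_monom)

lemma reducible_single: "w \<in> S \<Longrightarrow> cst c * monom_word w \<in> reducible S"
  by (rule reducible_span) (rule word_span_single)

lemma reducible_0: "0 \<in> reducible S"
  by (rule reducible_span) simp

lemma reducible_eqv: "p \<approx> q \<Longrightarrow> q \<in> reducible S \<Longrightarrow> p \<in> reducible S"
  unfolding reducible_def using eqv_trans by blast

lemma reducible_mono: "S \<subseteq> T \<Longrightarrow> p \<in> reducible S \<Longrightarrow> p \<in> reducible T"
  unfolding reducible_def by blast

lemma reducible_add:
  assumes "p \<in> reducible S" "q \<in> reducible S" shows "p + q \<in> reducible S"
proof -
  obtain p' q' where "p \<approx> p'" "q \<approx> q'" "p' \<in> word_span S" "q' \<in> word_span S"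
    using assms by (auto simp: reducible_def)
  then show ?thesis
    using eqv_add[of p p' q q'] word_span_add[of p' S q'] by (auto simp: reducible_def)
qed

text \<open>
  The rewriting may happen inside a product, and there it suffices to treat one word at a time.
\<close>
lemma reducible_mult:
  assumes "p \<in> reducible T" "u \<in> F" "v \<in> F" "\<And>q. q \<in> T \<Longrightarrow> u * monom_word q * v \<in> reducible S"
  shows "u * p * v \<in> reducible S"
proof -
  have cst: "cst c * q \<in> reducible S" if q: "q \<in> reducible S" for c q
  proof -
    obtain q' where q': "q \<approx> q'" "q' \<in> word_span S" using q by (auto simp: reducible_def)
    have "cst c * q' \<in> word_span S"
      by (rule word_span_mult[of _ "{[]}" _ S]) (use q'(2) word_span_single[of "[]" "{[]}" c] in auto)
    then show ?thesis
      using eqv_mult_left[OF q'(1) F_cst] by (auto simp: reducible_def)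
  qed
  obtain p' where p': "p \<approx> p'" "p' \<in> word_span T" using assms(1) by (auto simp: reducible_def)
  from p'(2) have "u * p' * v \<in> reducible S"
  proof (induction rule: word_span_induct)
    case (monom c w)
    have "u * (cst c * monom_word w) * v = cst c * (u * monom_word w * v)"
      by (metis cst_commute mult.assoc)
    then show ?case using cst assms(4)[OF monom] by simp
  qed (auto simp: reducible_0 reducible_add algebra_simps)
  then show ?thesis
    using reducible_eqv[OF eqv_mult_right[OF eqv_mult_left[OF p'(1)]]] assms(2,3) by blast
qed

lemmas reducible_mult_left = reducible_mult[of _ _ _ 1, simplified, OF _ _ F_1]
lemmas reducible_mult_right = reducible_mult[of _ _ 1, simplified, OF _ F_1]

end

lemma gl_rels_carrier: "gl_rels N \<kappa> \<subseteq> carrier (free_algebra (gl_gens N))"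
proof -
  have pres: "presentation (gl_gens N) {}" by unfold_locales simp
  have EE: "gen (EE i j s) \<in> carrier (free_algebra (gl_gens N))" if "i \<in> {1..N}" "j \<in> {1..N}" for i j s
    using that by (intro presentation.F_gen[OF pres]) (auto simp: gl_gens_def)
  have CC: "gen CC \<in> carrier (free_algebra (gl_gens N))"
    by (intro presentation.F_gen[OF pres]) (auto simp: gl_gens_def)
  have If: "(if b then p else q) \<in> carrier (free_algebra (gl_gens N))"
    if "p \<in> carrier (free_algebra (gl_gens N))" "q \<in> carrier (free_algebra (gl_gens N))" for b p q
    using that by simp
  have comm: "comm p q \<in> carrier (free_algebra (gl_gens N))"
    if "p \<in> carrier (free_algebra (gl_gens N))" "q \<in> carrier (free_algebra (gl_gens N))" for p q
    unfolding comm_def using that by (intro presentation.F_diff[OF pres] presentation.F_mult[OF pres])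
  show ?thesis
  proof
    fix p assume "p \<in> gl_rels N \<kappa>"
    then show "p \<in> carrier (free_algebra (gl_gens N))"
    proof cases
      case (bracket i j k l r s)
      show ?thesis
        unfolding bracket(1) using bracket(2-)
        by (intro presentation.F_diff[OF pres] presentation.F_add[OF pres] presentation.F_mult[OF pres]
            presentation.F_cst[OF pres] presentation.F_0[OF pres] presentation.F_1[OF pres] comm If EE CC)
    next
      case (central i j r)
      show ?thesis unfolding central(1) using central(2-) by (intro comm EE CC)
    next
      case level
      show ?thesis unfolding level
        by (intro presentation.F_diff[OF pres] presentation.F_cst[OF pres] CC)
    qed
  qed
qed

locale affine_gl =
  fixes N :: nat and \<kappa> :: complex
begin

sublocale presentation "gl_gens N" "gl_rels N \<kappa>"
  by unfold_locales (rule gl_rels_carrier)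

notation eqv (infix "\<approx>" 50)

text \<open>
  The bracket relation has a right-hand side of length at most one; that the commutator is shorter
  than the product is what makes straightening terminate, and homogeneity keeps track of the degree.
\<close>
lemma commutator_gens:
  assumes "g \<in> gl_gens N" "x \<in> gl_gens N"
  shows "\<exists>q\<in>word_span {w. set w \<subseteq> gl_gens N \<and> length w \<le> 1 \<and> word_deg w = gl_deg g + gl_deg x}.
    gen g * gen x \<approx> gen x * gen g + q"
proof -
  define S where "S = {w. set w \<subseteq> gl_gens N \<and> length w \<le> 1 \<and> word_deg w = gl_deg g + gl_deg x}"
  have "\<exists>q\<in>word_span S. gen g * gen x \<approx> gen x * gen g + q"
  proof (cases "g = CC \<or> x = CC")
    case True
    have "gen CC * gen y \<approx> gen y * gen CC" if "y \<in> gl_gens N" for y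
    proof (cases y)
      case (EE i j s)
      with that have "comm (gen CC) (gen y) \<in> gl_rels N \<kappa>"
        by (auto simp: gl_gens_def intro: gl_rels.central)
      then show ?thesis using rel_J by (auto simp: eqv_def comm_def)
    qed simp
    then have "gen g * gen x \<approx> gen x * gen g"
      using True assms eqv_sym by auto
    then show ?thesis
      by (intro bexI[of _ 0]) auto
  next
    case False
    then obtain i j r k l s where g: "g = EE i j r" and x: "x = EE k l s"
      by (metis gl_gen.exhaust)
    with assms have ij: "i \<in> {1..N}" "j \<in> {1..N}" "k \<in> {1..N}" "l \<in> {1..N}"
      by (auto simp: gl_gens_def)
    define q :: "gl_gen free" where "q = ((if j = k then gen (EE i l (r + s)) else 0) - (if l = i then gen (EE k j (r + s)) else 0)
         + (if r + s = 0
            then cst (of_int r) * ((if j = k \<and> l = i then gen CC else 0)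
                                   + (if i = j \<and> k = l then 1 else 0))
            else 0))"
    have "comm (gen g) (gen x) - q \<in> gl_rels N \<kappa>"
      unfolding q_def g x using ij by (rule gl_rels.bracket)
    then have "gen g * gen x \<approx> gen x * gen g + q"
      using rel_J by (auto simp: eqv_def comm_def algebra_simps)
    moreover have "q \<in> word_span S"
    proof -
      have S: "gen (EE i' j' (r + s)) \<in> word_span S" if "i' \<in> {1..N}" "j' \<in> {1..N}" for i' j'
        unfolding gen_def by (rule word_span_monom) (use that g x in \<open>auto simp: S_def gl_gens_def\<close>)
      have C: "cst c * gen CC \<in> word_span S" "cst c \<in> word_span S" if "r + s = 0" for c
        using word_span_single[of "[CC]" S c] word_span_single[of "[]" S c] that g x
        by (auto simp: S_def gl_gens_def gen_def)
      have If: "(if b then p else p') \<in> word_span S"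
        if "b \<Longrightarrow> p \<in> word_span S" "\<not> b \<Longrightarrow> p' \<in> word_span S" for b p p'
        using that by auto
      show ?thesis
        unfolding q_def distrib_left if_distrib[where f = "(*) _"] mult_1_right mult_zero_right
        using ij by (intro word_span_add word_span_diff If S C word_span_0) simp_all
    qed
    ultimately show ?thesis by blast
  qed
  then show ?thesis by (simp only: S_def)
qed

text \<open>
  Every $E_{k,l}(s)$ is a weight vector.  The central term of the bracket contains the factor $s$ but
  occurs only for $s = 0$, so it drops out.
\<close>
lemma n_plus_cartan_commute:
  assumes "g \<in> n_plus N" "x \<in> h_cartan N"
  shows "\<exists>c. gen g * gen x \<approx> gen x * gen g + cst c * gen g"
proof -
  obtain k l s where g: "g = EE k l s" and kl: "k \<in> {1..N}" "l \<in> {1..N}"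
    using assms(1) by (auto simp: n_plus_def)
  show ?thesis
  proof (cases x)
    case (EE i j r)
    with assms(2) have i: "i = j" "r = 0" "i \<in> {1..N}" by (auto simp: h_cartan_def)
    have rel: "comm (gen g) (gen x) - ((if l = i then gen (EE k i s) else 0) - (if i = k then gen (EE i l s) else 0)) \<in> gl_rels N \<kappa>"
      using gl_rels.bracket[OF kl i(3,3), where r = s and s = 0 and \<kappa> = \<kappa>] unfolding g EE i(1)[symmetric] i(2)
      by (cases "s = 0") (simp_all split: if_splits)
    have eq: "(if l = i then gen (EE k i s) else 0) - (if i = k then gen (EE i l s) else 0)
        = cst (of_bool (l = i) - of_bool (i = k)) * gen g"
      unfolding g by (cases "l = i"; cases "i = k") (simp_all add: cst_minus)
    have "gen g * gen x \<approx> gen x * gen g + cst (of_bool (l = i) - of_bool (i = k)) * gen g"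
      using rel_J[OF rel] unfolding eq eqv_def comm_def by (simp add: algebra_simps)
    then show ?thesis by blast
  next
    case CC
    have "comm (gen CC) (gen g) \<in> gl_rels N \<kappa>"
      unfolding g using kl by (rule gl_rels.central)
    then have "gen g * gen x \<approx> gen x * gen g"
      using rel_J eqv_sym unfolding CC by (auto simp: eqv_def comm_def)
    then show ?thesis by (intro exI[of _ 0]) simp
  qed
qed

text \<open>
  By the previous lemma a letter of $\hat{\mathfrak n}_+$ moves through Cartan letters at the cost of
  a scalar multiple of the word without the Cartan letter.
\<close>
lemma n_plus_times_borel_word:
  assumes "g \<in> n_plus N" "set b \<subseteq> h_cartan N" "set d \<subseteq> n_plus N"
  shows "gen g * monom_word (b @ d) \<in> reducible
    {b' @ d' |b' d'. set b' \<subseteq> h_cartan N \<and> set d' \<subseteq> n_plus N \<and> word_deg (b' @ d') = gl_deg g + word_deg (b @ d)}"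
    (is "_ \<in> reducible (?T b)")
  using assms(2)
proof (induction b)
  case Nil
  have "g # d \<in> ?T []"
    using assms(1,3) by (auto intro: exI[of _ "[]"])
  then show ?case
    using reducible_monom[of "g # d" "?T []"] by (simp add: monom_word_Cons)
next
  case (Cons x b)
  then have x: "x \<in> h_cartan N" and b: "set b \<subseteq> h_cartan N" by auto
  have gens: "gen g \<in> F" "gen x \<in> F" "monom_word (b @ d) \<in> F"
    using assms x triangular_part_subset[of N] triangular_gens[OF triangularI[of "[]" N b d]] b
    by (auto intro!: F_gen F_monom)
  have deg: "gl_deg x = 0" using x by (auto simp: h_cartan_def)
  have T: "?T (x # b) = ?T b"
    unfolding append_Cons deg_simps(6) deg add_0 ..
  obtain c where c: "gen g * gen x \<approx> gen x * gen g + cst c * gen g"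
    using n_plus_cartan_commute[OF assms(1) x] by blast
  have "gen g * monom_word ((x # b) @ d) = gen g * gen x * monom_word (b @ d)"
    by (simp add: monom_word_Cons mult.assoc)
  also have "\<dots> \<approx> (gen x * gen g + cst c * gen g) * monom_word (b @ d)"
    using eqv_mult_right[OF c gens(3)] .
  also have "\<dots> = gen x * (gen g * monom_word (b @ d)) + cst c * (gen g * monom_word (b @ d))"
    by (simp add: algebra_simps)
  finally have *: "gen g * monom_word ((x # b) @ d) \<approx> \<dots>" .
  have 1: "gen x * (gen g * monom_word (b @ d)) \<in> reducible (?T b)"
  proof (rule reducible_mult_left[OF Cons.IH[OF b] gens(2)])
    fix q assume "q \<in> ?T b"
    then obtain b' d' where "q = b' @ d'" "set b' \<subseteq> h_cartan N" "set d' \<subseteq> n_plus N"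
      "word_deg (b' @ d') = gl_deg g + word_deg (b @ d)" by blast
    then have "x # q = (x # b') @ d' \<and> set (x # b') \<subseteq> h_cartan N \<and> set d' \<subseteq> n_plus N \<and>
        word_deg ((x # b') @ d') = gl_deg g + word_deg (b @ d)"
      using x deg by simp
    then have "x # q \<in> ?T b" by blast
    then show "gen x * monom_word q \<in> reducible (?T b)"
      unfolding monom_word_Cons[symmetric] by (rule reducible_monom)
  qed
  have 2: "cst c * (gen g * monom_word (b @ d)) \<in> reducible (?T b)"
  proof (rule reducible_mult_left[OF Cons.IH[OF b] F_cst])
    fix q assume "q \<in> ?T b"
    then show "cst c * monom_word q \<in> reducible (?T b)" by (rule reducible_single)
  qed
  have "gen g * monom_word ((x # b) @ d) \<in> reducible (?T b)"
    by (rule reducible_eqv[OF * reducible_add[OF 1 2]])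
  then show ?case by (simp only: T)
qed

text \<open>
  Induction on the number of $\hat{\mathfrak n}_-$ letters, for all generators at once.  Moving the new
  generator past the first such letter leaves the induction hypothesis, multiplied by an
  $\hat{\mathfrak n}_-$ letter (which preserves triangular words), and a commutator term.  The latter
  consists of single generators and scalars in front of the shorter word, to which the induction hypothesis applies
  again.
\<close>
lemma gen_times_triangular:
  assumes "g \<in> gl_gens N" "set a \<subseteq> n_minus N" "set b \<subseteq> h_cartan N" "set d \<subseteq> n_plus N"
  shows "gen g * monom_word (a @ b @ d) \<in> reducible
    {w \<in> triangular N. word_deg w = gl_deg g + word_deg (a @ b @ d)}"
  using assms(1,2)
proof (induction a arbitrary: g)
  case Nil
  let ?T = "{w \<in> triangular N. word_deg w = gl_deg g + word_deg ([] @ b @ d)}"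
  have red: "gen g * monom_word ([] @ b @ d) \<in> reducible ?T" if "g # b @ d \<in> triangular N"
    unfolding append.left_neutral monom_word_Cons[symmetric]
    by (rule reducible_monom) (use that in simp)
  show ?case
    using Nil(1)
  proof (cases rule: gl_gens_cases)
    case 1
    then show ?thesis using red triangularI[of "[g]" N b d] assms(3,4) by simp
  next
    case 2
    then show ?thesis using red triangularI[of "[]" N "g # b" d] assms(3,4) by simp
  next
    case 3
    have "{b' @ d' |b' d'. set b' \<subseteq> h_cartan N \<and> set d' \<subseteq> n_plus N \<and>
        word_deg (b' @ d') = gl_deg g + word_deg (b @ d)} \<subseteq> ?T"
      using triangularI[of "[]" N] by auto
    from reducible_mono[OF this n_plus_times_borel_word[OF 3 assms(3,4)]]
    show ?thesis by simp
  qed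
next
  case (Cons x a)
  let ?w = "a @ b @ d"
  let ?T = "{w \<in> triangular N. word_deg w = gl_deg g + word_deg ((x # a) @ b @ d)}"
  from Cons.prems have x: "x \<in> n_minus N" and a: "set a \<subseteq> n_minus N" by auto
  have xg: "x \<in> gl_gens N" using x triangular_part_subset by blast
  have tri: "?w \<in> triangular N" by (rule triangularI) (use a assms in auto)
  have wF: "monom_word ?w \<in> F" using triangular_gens[OF tri] by (rule F_monom)
  obtain q where q: "gen g * gen x \<approx> gen x * gen g + q"
      "q \<in> word_span {w. set w \<subseteq> gl_gens N \<and> length w \<le> 1 \<and> word_deg w = gl_deg g + gl_deg x}"
    using commutator_gens[OF Cons.prems(1) xg] by blast
  have "gen g * monom_word ((x # a) @ b @ d) = gen g * gen x * monom_word ?w"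
    by (simp add: monom_word_Cons mult.assoc)
  also have "\<dots> \<approx> (gen x * gen g + q) * monom_word ?w"
    using eqv_mult_right[OF q(1) wF] .
  also have "\<dots> = gen x * (gen g * monom_word ?w) + q * monom_word ?w"
    by (simp add: algebra_simps)
  finally have *: "gen g * monom_word ((x # a) @ b @ d) \<approx> \<dots>" .
  have "gen x * (gen g * monom_word ?w) \<in> reducible ?T"
  proof (rule reducible_mult_left[OF Cons.IH[OF Cons.prems(1) a] F_gen[OF xg]])
    fix w assume w: "w \<in> {w \<in> triangular N. word_deg w = gl_deg g + word_deg ?w}"
    then have "x # w \<in> ?T"
      using triangular_sandwich[of w N "[x]" "[]"] x by auto
    then show "gen x * monom_word w \<in> reducible ?T"
      unfolding monom_word_Cons[symmetric] by (rule reducible_monom)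
  qed
  moreover have "q * monom_word ?w \<in> reducible ?T"
  proof (rule reducible_mult_right[OF reducible_span[OF q(2)] wF])
    fix u assume "u \<in> {w. set w \<subseteq> gl_gens N \<and> length w \<le> 1 \<and> word_deg w = gl_deg g + gl_deg x}"
    then consider "u = []" "gl_deg g + gl_deg x = 0"
      | y where "u = [y]" "y \<in> gl_gens N" "gl_deg y = gl_deg g + gl_deg x"
      by (cases u) auto
    then show "monom_word u * monom_word ?w \<in> reducible ?T"
    proof cases
      case 1
      with tri show ?thesis by (auto intro!: reducible_monom)
    next
      case 2
      show ?thesis
        using Cons.IH[OF 2(2) a] 2 by (simp add: gen_def add.assoc)
    qed
  qed
  ultimately show ?case
    by (rule reducible_eqv[OF * reducible_add])
qed

text \<open>
  The spanning half of the Poincare-Birkhoff-Witt theorem for the triangular decomposition, with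
  the total degree preserved.
\<close>
theorem triangular_straightening:
  assumes "set w \<subseteq> gl_gens N"
  shows "monom_word w \<in> reducible {u \<in> triangular N. word_deg u = word_deg w}"
  using assms
proof (induction w)
  case Nil
  show ?case
    by (rule reducible_monom) (use triangularI[of "[]" N "[]" "[]"] in auto)
next
  case (Cons g w)
  then have g: "g \<in> gl_gens N" by simp
  have "gen g * monom_word w \<in> reducible {u \<in> triangular N. word_deg u = word_deg (g # w)}"
  proof (rule reducible_mult_left[OF Cons.IH F_gen[OF g]])
    fix q assume "q \<in> {u \<in> triangular N. word_deg u = word_deg w}"
    then obtain a b d where "q = a @ b @ d" "set a \<subseteq> n_minus N" "set b \<subseteq> h_cartan N"
        "set d \<subseteq> n_plus N" "word_deg q = word_deg w"
      unfolding triangular_def by blast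
    then show "gen g * monom_word q \<in> reducible {u \<in> triangular N. word_deg u = word_deg (g # w)}"
      using gen_times_triangular[OF g, of a b d] by simp
  qed (use Cons.prems in auto)
  then show ?case by (simp add: monom_word_Cons)
qed

text \<open>
  The triangular words that can occur in the product of two triangular words of degrees \<open>(r, s)\<close> and
  \<open>(r', s')\<close>.  The two lower bounds on \<open>pos_deg\<close> are responsible for convergence: the first controls
  the right factor, the second the left one.
\<close>
definition product_words :: "nat \<Rightarrow> nat \<Rightarrow> nat \<Rightarrow> nat \<Rightarrow> gl_gen list set" where
  "product_words r s r' s' = {w \<in> triangular N. word_deg w = int s - int r + (int s' - int r') \<and>
     s' \<le> pos_deg w \<and> int s' + int s - int r' \<le> int (pos_deg w)}"

text \<open>
  In the product \<open>(a b d) (a' b' d')\<close> only the middle part \<open>b d a' b'\<close> has to be straightened, so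
  \<open>a\<close> stays on the left and \<open>d'\<close> on the right.  The letters \<open>d'\<close> contribute \<open>s'\<close> to the positive
  degree, and the middle part contributes at least its total degree \<open>s - r'\<close>.
\<close>
lemma triangular_times_triangular:
  assumes "u \<in> tri_words N r s" "w \<in> tri_words N r' s'"
  shows "monom_word u * monom_word w \<in> reducible (product_words r s r' s')"
proof -
  obtain a b d where u: "u = a @ b @ d" and abd: "set a \<subseteq> n_minus N" "set b \<subseteq> h_cartan N"
      "set d \<subseteq> n_plus N" "word_deg a = - int r" "word_deg d = int s"
    using assms(1) by (auto simp: tri_words_def word_deg_def)
  obtain a' b' d' where w: "w = a' @ b' @ d'" and abd': "set a' \<subseteq> n_minus N" "set b' \<subseteq> h_cartan N"
      "set d' \<subseteq> n_plus N" "word_deg a' = - int r'" "word_deg d' = int s'"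
    using assms(2) by (auto simp: tri_words_def word_deg_def)
  have b0: "word_deg b = 0" "word_deg b' = 0"
    using h_cartan_deg abd(2) abd'(2) by (simp_all add: word_deg_eq)
  have d': "pos_deg d' = s'" using abd'(3,5) n_plus_neg_deg word_deg_eq[of d'] by simp
  have gens: "monom_word a \<in> F" "monom_word d' \<in> F" "set (b @ d @ a' @ b') \<subseteq> gl_gens N"
    using abd abd' triangular_part_subset[of N] by (auto intro!: F_monom)
  have "monom_word a * monom_word (b @ d @ a' @ b') * monom_word d' \<in> reducible (product_words r s r' s')"
  proof (rule reducible_mult[OF triangular_straightening[OF gens(3)] gens(1,2)])
    fix q assume "q \<in> {u \<in> triangular N. word_deg u = word_deg (b @ d @ a' @ b')}"
    then have q: "q \<in> triangular N" "word_deg q = int s - int r'"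
      using abd(5) abd'(4) b0 by auto
    have "a @ q @ d' \<in> product_words r s r' s'"
      using triangular_sandwich[OF q(1) abd(1) abd'(3)] q(2) abd(4) abd'(5) d' word_deg_eq[of q]
      by (auto simp: product_words_def)
    then show "monom_word a * monom_word q * monom_word d' \<in> reducible (product_words r s r' s')"
      using reducible_monom[of "a @ q @ d'" "product_words r s r' s'"]
      by (simp add: monom_word_append mult.assoc)
  qed
  then show ?thesis by (simp add: u w monom_word_append mult.assoc)
qed

lemma tri_span_times_tri_span:
  assumes "p \<in> word_span (tri_words N r s)" "q \<in> word_span (tri_words N r' s')"
  shows "p * q \<in> reducible (product_words r s r' s')"
proof -
  have F: "p \<in> F" if "p \<in> word_span (tri_words N r s)" for p r s
    unfolding carrier_free_algebra
    by (rule word_span_mono[OF _ that]) (use triangular_gens[of _ N] in \<open>auto simp: tri_words_eq\<close>)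
  show ?thesis
  proof (rule reducible_mult_left[OF reducible_span[OF assms(2)] F[OF assms(1)]])
    fix w assume w: "w \<in> tri_words N r' s'"
    then have "monom_word w \<in> F" using F[OF word_span_monom] by blast
    then show "p * monom_word w \<in> reducible (product_words r s r' s')"
      by (rule reducible_mult_right[OF reducible_span[OF assms(1)]])
        (rule triangular_times_triangular[OF _ w])
  qed
qed

end

section \<open>The completed enveloping algebra\<close>

text \<open>
  The components of an element of the completion with total degrees in \<open>D\<close> and positive degree below
  \<open>n\<close>.  Only such components enter truncations, and there are finitely many of them.
\<close>
definition strip :: "int set \<Rightarrow> nat \<Rightarrow> (nat \<times> nat) set" where
  "strip D n = {(r, s). s < n \<and> int s - int r \<in> D}"

lemma finite_strip:
  assumes "finite D"
  shows "finite (strip D n)"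
proof (rule finite_subset)
  show "strip D n \<subseteq> (\<lambda>(d, s). (nat (int s - d), s)) ` (D \<times> {..<n})"
    unfolding strip_def
  proof clarify
    fix r s assume "s < n" "int s - int r \<in> D"
    then show "(r, s) \<in> (\<lambda>(d, s). (nat (int s - d), s)) ` (D \<times> {..<n})"
      by (intro image_eqI[of _ _ "(int s - int r, s)"]) auto
  qed
qed (use assms in simp)

context affine_gl
begin

lemma U_gl_eq: "U_gl N \<kappa> = A"
  by (simp add: U_gl_def)

lemma U_class_eq: "U_class N \<kappa> = cls"
  by (rule ext) (simp add: U_class_def)

abbreviation C where "C \<equiv> U_comp N \<kappa>"

lemma U_tri_eq: "U_tri N \<kappa> r s = cls ` word_span (tri_words N r s)"
  by (simp add: U_tri_def U_class_eq)

lemma triangular_span_F: "p \<in> word_span {w \<in> triangular N. P w} \<Longrightarrow> p \<in> F"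
  unfolding carrier_free_algebra
  by (rule word_span_mono[rotated]) (use triangular_gens[of _ N] in auto)

lemma tri_span_F: "p \<in> word_span (tri_words N r s) \<Longrightarrow> p \<in> F"
  unfolding tri_words_eq by (rule triangular_span_F)

lemma U_tri_carrier: "x \<in> U_tri N \<kappa> r s \<Longrightarrow> x \<in> carrier A"
  unfolding U_tri_eq using tri_span_F cls_carrier by blast

lemma U_tri_0: "\<zero>\<^bsub>A\<^esub> \<in> U_tri N \<kappa> r s"
  unfolding U_tri_eq A_simps(4) by (rule imageI) (rule word_span_0)

lemma U_tri_add:
  assumes "x \<in> U_tri N \<kappa> r s" "y \<in> U_tri N \<kappa> r s" shows "x \<oplus>\<^bsub>A\<^esub> y \<in> U_tri N \<kappa> r s"
proof -
  obtain p q where "x = cls p" "p \<in> word_span (tri_words N r s)" "y = cls q" "q \<in> word_span (tri_words N r s)"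
    using assms unfolding U_tri_eq by blast
  then show ?thesis
    using word_span_add[of p "tri_words N r s" q] tri_span_F by (simp add: A_add U_tri_eq)
qed

lemma U_tri_uminus:
  assumes "x \<in> U_tri N \<kappa> r s" shows "\<ominus>\<^bsub>A\<^esub> x \<in> U_tri N \<kappa> r s"
proof -
  obtain p where "x = cls p" "p \<in> word_span (tri_words N r s)"
    using assms unfolding U_tri_eq by blast
  then show ?thesis
    using word_span_uminus[of p "tri_words N r s"] tri_span_F by (simp add: A_uminus U_tri_eq)
qed

lemma U_tri_smult:
  assumes "x \<in> U_tri N \<kappa> r s" shows "z \<odot>\<^bsub>A\<^esub> x \<in> U_tri N \<kappa> r s"
proof -
  obtain p where p: "x = cls p" "p \<in> word_span (tri_words N r s)"
    using assms unfolding U_tri_eq by blast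
  have "cst z * p \<in> word_span (tri_words N r s)"
    by (rule word_span_mult[of _ "{[]}", OF _ p(2)]) (use word_span_single[of "[]" "{[]}" z] in auto)
  then show ?thesis
    using p tri_span_F by (simp add: A_smult U_tri_eq)
qed

lemma C_simps:
  "carrier C = comp_carrier N \<kappa>" "zero C = (\<lambda>r s. \<zero>\<^bsub>A\<^esub>)" "add C = (\<lambda>u v r s. u r s \<oplus>\<^bsub>A\<^esub> v r s)"
  "smult C = (\<lambda>z u r s. z \<odot>\<^bsub>A\<^esub> u r s)" "one C = comp_word N \<kappa> []"
  "mult C = (\<lambda>u v. SOME w. is_comp_prod N \<kappa> u v w)"
  by (simp_all add: U_comp_def U_gl_eq)

lemma C_carrier_iff:
  "u \<in> carrier C \<longleftrightarrow> (\<forall>r s. u r s \<in> U_tri N \<kappa> r s) \<and>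
     (\<exists>D. finite D \<and> (\<forall>r s. u r s \<noteq> \<zero>\<^bsub>A\<^esub> \<longrightarrow> int s - int r \<in> D))"
proof -
  have "finite {int s - int r |r s. u r s \<noteq> \<zero>\<^bsub>A\<^esub>} \<longleftrightarrow>
      (\<exists>D. finite D \<and> (\<forall>r s. u r s \<noteq> \<zero>\<^bsub>A\<^esub> \<longrightarrow> int s - int r \<in> D))"
  proof
    assume "\<exists>D. finite D \<and> (\<forall>r s. u r s \<noteq> \<zero>\<^bsub>A\<^esub> \<longrightarrow> int s - int r \<in> D)"
    then obtain D where "finite D" "\<forall>r s. u r s \<noteq> \<zero>\<^bsub>A\<^esub> \<longrightarrow> int s - int r \<in> D" by blast
    then show "finite {int s - int r |r s. u r s \<noteq> \<zero>\<^bsub>A\<^esub>}"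
      by (intro finite_subset[OF _ \<open>finite D\<close>]) blast
  qed blast
  then show ?thesis by (simp add: C_simps comp_carrier_def U_gl_eq)
qed

lemma C_carrierI:
  assumes "\<And>r s. u r s \<in> U_tri N \<kappa> r s" "finite D"
    and "\<And>r s. u r s \<noteq> \<zero>\<^bsub>A\<^esub> \<Longrightarrow> int s - int r \<in> D"
  shows "u \<in> carrier C"
  unfolding C_carrier_iff using assms by blast

lemma C_tri: "u \<in> carrier C \<Longrightarrow> u r s \<in> U_tri N \<kappa> r s"
  by (simp add: C_carrier_iff)

lemma C_degrees:
  assumes "u \<in> carrier C"
  shows "\<exists>D. finite D \<and> (\<forall>r s. u r s \<noteq> \<zero>\<^bsub>A\<^esub> \<longrightarrow> int s - int r \<in> D)"
  using assms unfolding C_carrier_iff by blast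

lemma C_component_carrier: "u \<in> carrier C \<Longrightarrow> u r s \<in> carrier A"
  by (rule U_tri_carrier) (rule C_tri)

lemma C_0: "\<zero>\<^bsub>C\<^esub> \<in> carrier C"
  unfolding C_simps(2) by (rule C_carrierI[where D = "{}"]) (simp_all add: U_tri_0)

lemma C_add: assumes "u \<in> carrier C" "v \<in> carrier C" shows "u \<oplus>\<^bsub>C\<^esub> v \<in> carrier C"
proof -
  obtain D where D: "finite D" "\<And>r s. u r s \<noteq> \<zero>\<^bsub>A\<^esub> \<Longrightarrow> int s - int r \<in> D"
    using C_degrees[OF assms(1)] by blast
  obtain E where E: "finite E" "\<And>r s. v r s \<noteq> \<zero>\<^bsub>A\<^esub> \<Longrightarrow> int s - int r \<in> E"
    using C_degrees[OF assms(2)] by blast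
  show ?thesis
    unfolding C_simps(3)
  proof (rule C_carrierI)
    show "u r s \<oplus>\<^bsub>A\<^esub> v r s \<in> U_tri N \<kappa> r s" for r s
      using assms by (intro U_tri_add C_tri)
    show "finite (D \<union> E)" using D(1) E(1) by simp
    fix r s assume nz: "u r s \<oplus>\<^bsub>A\<^esub> v r s \<noteq> \<zero>\<^bsub>A\<^esub>"
    have "u r s \<noteq> \<zero>\<^bsub>A\<^esub> \<or> v r s \<noteq> \<zero>\<^bsub>A\<^esub>"
      by (rule ccontr) (use nz in simp)
    then show "int s - int r \<in> D \<union> E"
      using D(2)[of r s] E(2)[of r s] by blast
  qed
qed

lemma C_smult: assumes "u \<in> carrier C" shows "z \<odot>\<^bsub>C\<^esub> u \<in> carrier C"
proof -
  obtain D where D: "finite D" "\<And>r s. u r s \<noteq> \<zero>\<^bsub>A\<^esub> \<Longrightarrow> int s - int r \<in> D"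
    using C_degrees[OF assms(1)] by blast
  have z0: "z \<odot>\<^bsub>A\<^esub> \<zero>\<^bsub>A\<^esub> = \<zero>\<^bsub>A\<^esub>"
    using A_smult[OF F_0] by (simp add: A_simps(4))
  show ?thesis
    unfolding C_simps(4)
  proof (rule C_carrierI[OF _ D(1)])
    show "z \<odot>\<^bsub>A\<^esub> u r s \<in> U_tri N \<kappa> r s" for r s
      using assms by (intro U_tri_smult C_tri)
    fix r s assume nz: "z \<odot>\<^bsub>A\<^esub> u r s \<noteq> \<zero>\<^bsub>A\<^esub>"
    show "int s - int r \<in> D"
      by (rule D(2)) (use nz z0 in metis)
  qed
qed

lemma C_uminus: assumes "u \<in> carrier C" shows "(\<lambda>r s. \<ominus>\<^bsub>A\<^esub> u r s) \<in> carrier C"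
proof -
  obtain D where D: "finite D" "\<And>r s. u r s \<noteq> \<zero>\<^bsub>A\<^esub> \<Longrightarrow> int s - int r \<in> D"
    using C_degrees[OF assms(1)] by blast
  show ?thesis
  proof (rule C_carrierI[OF _ D(1)])
    show "\<ominus>\<^bsub>A\<^esub> u r s \<in> U_tri N \<kappa> r s" for r s
      using assms by (intro U_tri_uminus C_tri)
    fix r s assume nz: "\<ominus>\<^bsub>A\<^esub> u r s \<noteq> \<zero>\<^bsub>A\<^esub>"
    show "int s - int r \<in> D"
      by (rule D(2)) (use nz quot.minus_zero in metis)
  qed
qed

lemma C_abelian_group: "abelian_group C"
proof (rule abelian_groupI)
  fix u v w assume uvw: "u \<in> carrier C" "v \<in> carrier C" "w \<in> carrier C"
  show "u \<oplus>\<^bsub>C\<^esub> v \<oplus>\<^bsub>C\<^esub> w = u \<oplus>\<^bsub>C\<^esub> (v \<oplus>\<^bsub>C\<^esub> w)"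
    unfolding C_simps(3) by (intro ext quot.a_assoc C_component_carrier uvw)
next
  fix u v assume uv: "u \<in> carrier C" "v \<in> carrier C"
  show "u \<oplus>\<^bsub>C\<^esub> v = v \<oplus>\<^bsub>C\<^esub> u"
    unfolding C_simps(3) by (intro ext quot.a_comm C_component_carrier uv)
next
  fix u assume u: "u \<in> carrier C"
  show "\<zero>\<^bsub>C\<^esub> \<oplus>\<^bsub>C\<^esub> u = u"
    unfolding C_simps(2,3) by (intro ext quot.l_zero C_component_carrier u)
  show "\<exists>v\<in>carrier C. v \<oplus>\<^bsub>C\<^esub> u = \<zero>\<^bsub>C\<^esub>"
  proof (rule bexI[OF _ C_uminus[OF u]])
    show "(\<lambda>r s. \<ominus>\<^bsub>A\<^esub> u r s) \<oplus>\<^bsub>C\<^esub> u = \<zero>\<^bsub>C\<^esub>"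
      unfolding C_simps(2,3) by (intro ext quot.l_neg C_component_carrier u)
  qed
qed (rule C_add C_0; assumption)+

sublocale compl: abelian_group C
  by (rule C_abelian_group)

lemma C_finsum_apply:
  "(\<And>x. x \<in> X \<Longrightarrow> f x \<in> carrier C) \<Longrightarrow> finsum C f X r s = finsum A (\<lambda>x. f x r s) X"
proof (induction X rule: infinite_finite_induct)
  case (infinite X)
  then show ?case by (simp add: finsum_def finprod_def C_simps(2))
next
  case empty
  show ?case by (simp add: C_simps(2))
next
  case (insert x X)
  then have car: "f x \<in> carrier C" "f \<in> X \<rightarrow> carrier C" by auto
  have "finsum C f (insert x X) = f x \<oplus>\<^bsub>C\<^esub> finsum C f X"
    by (rule compl.finsum_insert[OF insert.hyps car(2,1)])
  moreover have "finsum A (\<lambda>x. f x r s) (insert x X) = f x r s \<oplus>\<^bsub>A\<^esub> finsum A (\<lambda>x. f x r s) X"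
    by (rule quot.finsum_insert[OF insert.hyps]) (use car in \<open>auto intro!: C_component_carrier\<close>)
  moreover have "finsum C f X r s = finsum A (\<lambda>x. f x r s) X"
    using insert.IH insert.prems by blast
  ultimately show ?case by (simp only: C_simps(3))
qed

lemma comp_word_carrier:
  assumes "w \<in> triangular N" shows "comp_word N \<kappa> w \<in> carrier C"
proof (rule C_carrierI)
  have "cls (monom_word w) \<in> U_tri N \<kappa> (neg_deg w) (pos_deg w)"
    unfolding U_tri_eq by (rule imageI, rule word_span_monom) (simp add: tri_words_eq assms)
  then show "comp_word N \<kappa> w r s \<in> U_tri N \<kappa> r s" for r s
    using U_tri_0 by (simp add: comp_word_def U_class_eq U_gl_eq neg_deg_def pos_deg_def)
  show "int s - int r \<in> {int (pos_deg w) - int (neg_deg w)}"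
    if "comp_word N \<kappa> w r s \<noteq> \<zero>\<^bsub>A\<^esub>" for r s
    using that by (auto simp: comp_word_def U_gl_eq neg_deg_def pos_deg_def split: if_splits)
qed simp

lemma comp_word_apply:
  "comp_word N \<kappa> w r s = cls (if r = neg_deg w \<and> s = pos_deg w then monom_word w else 0)"
  by (simp add: comp_word_def U_class_eq U_gl_eq neg_deg_def pos_deg_def A_simps(4))

text \<open>
  A choice of polynomials in triangular form representing all components.
\<close>
lemma comp_representatives:
  assumes "u \<in> carrier C"
  shows "\<exists>p D. finite D \<and> (\<forall>r s. p r s \<in> word_span (tri_words N r s) \<and> u r s = cls (p r s) \<and>
    (u r s \<noteq> \<zero>\<^bsub>A\<^esub> \<longrightarrow> int s - int r \<in> D))"
proof -
  obtain D where D: "finite D" "\<forall>r s. u r s \<noteq> \<zero>\<^bsub>A\<^esub> \<longrightarrow> int s - int r \<in> D"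
    using assms unfolding C_carrier_iff by blast
  have "\<forall>r s. \<exists>p. p \<in> word_span (tri_words N r s) \<and> u r s = cls p"
    using C_tri[OF assms] unfolding U_tri_eq by blast
  then have "\<exists>p. \<forall>r s. p r s \<in> word_span (tri_words N r s) \<and> u r s = cls (p r s)"
    by (intro choice allI) (erule allE, erule allE, assumption)
  then obtain p where "\<forall>r s. p r s \<in> word_span (tri_words N r s) \<and> u r s = cls (p r s)"
    by (rule exE)
  with D show ?thesis by (intro exI[of _ p] exI[of _ D]) simp
qed

lemma comp_trunc_rep:
  assumes "\<And>r s. u r s = cls (p r s)" "\<And>r s. p r s \<in> F"
    and "finite X" "X \<subseteq> {(r, s). s < n}" "{(r, s). s < n \<and> u r s \<noteq> \<zero>\<^bsub>A\<^esub>} \<subseteq> X"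
  shows "comp_trunc N \<kappa> u n = cls (\<Sum>(r, s)\<in>X. p r s)"
proof -
  have car: "u r s \<in> carrier A" for r s using assms(1,2) cls_carrier by simp
  have "comp_trunc N \<kappa> u n = finsum A (\<lambda>(r, s). u r s) X"
    unfolding comp_trunc_def U_gl_eq
    by (rule quot.add.finprod_mono_neutral_cong_left) (use assms(3-5) car in auto)
  also have "\<dots> = finsum A (\<lambda>x. cls (case x of (r, s) \<Rightarrow> p r s)) X"
    by (rule quot.finsum_cong') (auto simp: assms(1,2) cls_carrier)
  also have "\<dots> = cls (\<Sum>(r, s)\<in>X. p r s)"
    by (rule A_finsum) (auto simp: assms(2))
  finally show ?thesis .
qed

lemma comp_nbhd_eq: "comp_nbhd N \<kappa> m = cls ` word_span {w \<in> triangular N. m \<le> pos_deg w}"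
proof -
  have "(\<Union>r. \<Union>s\<in>{m..}. tri_words N r s) = {w \<in> triangular N. m \<le> pos_deg w}"
    by (auto simp: tri_words_eq)
  then show ?thesis by (simp add: comp_nbhd_def U_class_eq)
qed

text \<open>
  Multiply components pairwise and straighten each product.  Since elements of the completion have
  finitely many total degrees, a word of positive degree below \<open>n\<close> arises from the pairs of components
  in a finite set \<open>Y n\<close> only, by the lower bounds in \<open>product_words\<close>; this defines the components of
  the product.  The product of the truncations at \<open>n\<close> involves the pairs in \<open>X n \<subseteq> Y n\<close>, and the two
  finite sums differ by words whose positive degree is at least \<open>n\<close> minus a constant.
\<close>
lemma comp_prod_exists:
  assumes "u \<in> carrier C" "v \<in> carrier C"
  shows "\<exists>w. is_comp_prod N \<kappa> u v w"
proof -
  obtain p D where D: "finite D" and p: "\<And>r s. p r s \<in> word_span (tri_words N r s)"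
      "\<And>r s. u r s = cls (p r s)" "\<And>r s. u r s \<noteq> \<zero>\<^bsub>A\<^esub> \<Longrightarrow> int s - int r \<in> D"
    using comp_representatives[OF assms(1)] by blast
  obtain q E where E: "finite E" and q: "\<And>r s. q r s \<in> word_span (tri_words N r s)"
      "\<And>r s. v r s = cls (q r s)" "\<And>r s. v r s \<noteq> \<zero>\<^bsub>A\<^esub> \<Longrightarrow> int s - int r \<in> E"
    using comp_representatives[OF assms(2)] by blast
  have pF: "p r s \<in> F" "q r s \<in> F" for r s using p(1) q(1) tri_span_F by blast+
  have "\<exists>f. f \<in> word_span (product_words r s r' s') \<and> p r s * q r' s' \<approx> f" for r s r' s'
    using tri_span_times_tri_span[OF p(1) q(1)] unfolding reducible_def by blast
  then obtain nf where nf: "\<And>r s r' s'. nf r s r' s' \<in> word_span (product_words r s r' s')"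
      "\<And>r s r' s'. p r s * q r' s' \<approx> nf r s r' s'"
    by metis
  define nf2 where "nf2 = (\<lambda>((r, s), (r', s')). nf r s r' s')"
  note fin = finite_strip
  \<comment> \<open>The excess \<open>r' - s'\<close> of a component of \<open>v\<close> is at most \<open>M\<close>; including 0 keeps the maximum defined
    for empty \<open>E\<close>.\<close>
  define M where "M = Max (insert 0 ((\<lambda>e. nat (- e)) ` E))"
  have M: "- e \<le> int M" if "e \<in> E" for e
  proof -
    have "nat (- e) \<le> M" unfolding M_def using E that by (intro Max_ge) auto
    then show ?thesis by linarith
  qed
  define X where "X n = strip D n \<times> strip E n" for n
  \<comment> \<open>The left factor needs the larger range: a word of positive degree below \<open>n\<close> only forces
    \<open>s < n + (r' - s') \<le> n + M\<close>.\<close>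
  define Y where "Y n = strip D (n + M) \<times> strip E n" for n
  define DE where "DE = (\<lambda>(d, e). d + e) ` (D \<times> E)"
  have finDE: "finite DE" unfolding DE_def using D E by simp
  have finXY: "finite (X n)" "finite (Y n)" for n
    unfolding X_def Y_def using D E by (simp_all add: fin)
  have XY: "X n \<subseteq> Y n" for n unfolding X_def Y_def strip_def by auto
  have Ymono: "Y n \<subseteq> Y n'" if "n \<le> n'" for n n' unfolding Y_def strip_def using that by auto
  \<comment> \<open>\<open>W n\<close> agrees with the infinite sum of all straightened products in positive degrees below \<open>n\<close>, so
    the component of positive degree \<open>S\<close> is taken from \<open>W (Suc S)\<close>.\<close>
  define W where "W n = (\<Sum>x\<in>Y n. nf2 x)" for n
  define prods where "prods = (\<lambda>((r, s), (r', s')). product_words r s r' s')"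
  have nf2: "nf2 x \<in> word_span (prods x)" for x
    unfolding nf2_def prods_def using nf(1) by (simp add: split_beta)
  have deg: "w \<in> triangular N \<and> word_deg w \<in> DE" if "x \<in> Y n" "w \<in> prods x" for x w n
  proof -
    obtain r s r' s' where x: "x = ((r, s), (r', s'))" by (metis surj_pair)
    have "int s - int r \<in> D" "int s' - int r' \<in> E"
      using that(1) unfolding x Y_def strip_def by auto
    then have "(int s - int r) + (int s' - int r') \<in> DE"
      unfolding DE_def by (intro image_eqI[of _ _ "(int s - int r, int s' - int r')"]) auto
    then show ?thesis using that(2) unfolding x prods_def product_words_def by auto
  qed
  have inX: "n \<le> pos_deg w" if "x \<in> Y n'" "x \<notin> Y n" "w \<in> prods x" for x w n n'
  proof -
    obtain r s r' s' where x: "x = ((r, s), (r', s'))" by (metis surj_pair)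
    have "- (int s' - int r') \<le> int M" "n + M \<le> s \<or> n \<le> s'"
      using that(1,2) M[of "int s' - int r'"] unfolding x Y_def strip_def by auto
    then show ?thesis using that(3) unfolding x prods_def product_words_def by auto
  qed
  have inXM: "n \<le> pos_deg w + M" if "x \<in> Y n" "x \<notin> X n" "w \<in> prods x" for x w n
  proof -
    obtain r s r' s' where x: "x = ((r, s), (r', s'))" by (metis surj_pair)
    have "- (int s' - int r') \<le> int M" "n \<le> s"
      using that(1,2) M[of "int s' - int r'"] unfolding x X_def Y_def strip_def by auto
    then show ?thesis using that(3) unfolding x prods_def product_words_def by auto
  qed
  have Wspan: "W n \<in> word_span {w \<in> triangular N. word_deg w \<in> DE}" for n
    unfolding W_def
  proof (rule word_span_sum)
    fix x assume "x \<in> Y n"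
    then show "nf2 x \<in> word_span {w \<in> triangular N. word_deg w \<in> DE}"
      by (intro word_span_mono[OF _ nf2]) (use deg in blast)
  qed
  define part where "part R S = word_part (\<lambda>w. (neg_deg w, pos_deg w) = (R, S))" for R S
  define c where "c R S = part R S (W (Suc S))" for R S
  have c_span: "c R S \<in> word_span {w \<in> {w \<in> triangular N. word_deg w \<in> DE}. (neg_deg w, pos_deg w) = (R, S)}" for R S
    unfolding c_def part_def by (rule word_span_part[OF Wspan])
  have c_tri: "c R S \<in> word_span (tri_words N R S)" for R S
    by (rule word_span_mono[OF _ c_span]) (auto simp: tri_words_eq)
  have c_0: "c R S = 0" if "int S - int R \<notin> DE" for R S
  proof -
    have "word_part (\<lambda>_. True) (c R S) = c R S"
      by (rule poly_mapping_eqI) (simp add: lookup_word_part)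
    moreover have "{w \<in> {w \<in> triangular N. word_deg w \<in> DE}. (neg_deg w, pos_deg w) = (R, S)} = {}"
      using that by (auto simp: word_deg_eq)
    ultimately show ?thesis
      using word_part_eq_0[OF c_span, of R S "\<lambda>_. True"] by auto
  qed
  define w where "w R S = cls (c R S)" for R S
  have w_0: "w R S = \<zero>\<^bsub>A\<^esub>" if "int S - int R \<notin> DE" for R S
    using c_0[OF that] by (simp add: w_def A_simps(4))
  have w_carrier: "w \<in> carrier C"
    unfolding C_carrier_iff
  proof (intro conjI allI exI[of _ DE] impI)
    show "w R S \<in> U_tri N \<kappa> R S" for R S
      unfolding w_def U_tri_eq using c_tri by (rule imageI)
    show "int S - int R \<in> DE" if "w R S \<noteq> \<zero>\<^bsub>A\<^esub>" for R S
      using that w_0 by blast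
  qed (rule finDE)
  have c_eq: "c R S = part R S (W n)" if "S < n" for R S n
  proof -
    have "W n = W (Suc S) + (\<Sum>x\<in>Y n - Y (Suc S). nf2 x)"
      unfolding W_def using sum.subset_diff[OF Ymono finXY(2), of "Suc S" n nf2] that
      by (simp add: add.commute)
    moreover have "part R S (\<Sum>x\<in>Y n - Y (Suc S). nf2 x) = 0"
      unfolding part_def word_part_sum
    proof (rule sum.neutral, rule ballI)
      fix x assume x: "x \<in> Y n - Y (Suc S)"
      show "word_part (\<lambda>w. (neg_deg w, pos_deg w) = (R, S)) (nf2 x) = 0"
        by (rule word_part_eq_0[OF nf2]) (use inX[of x n "Suc S"] x in fastforce)
    qed
    ultimately show ?thesis unfolding c_def part_def by (simp add: word_part_add)
  qed
  \<comment> \<open>Adding up components recovers the part of \<open>W n\<close> below \<open>n\<close>, because its words have total degrees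
    in \<open>DE\<close>.\<close>
  have sum_parts: "(\<Sum>(R, S)\<in>strip DE n. c R S) = word_part (\<lambda>w. pos_deg w < n) (W n)" for n
  proof (rule poly_mapping_eqI)
    fix k
    let ?d = "(neg_deg (letters k), pos_deg (letters k))"
    have "Poly_Mapping.lookup (\<Sum>(R, S)\<in>strip DE n. c R S) k
        = (\<Sum>x\<in>strip DE n. if ?d = x then Poly_Mapping.lookup (W n) k else 0)"
      unfolding lookup_sum
      by (rule sum.cong[OF refl]) (auto simp: strip_def c_eq part_def lookup_word_part split: if_splits)
    also have "\<dots> = (if ?d \<in> strip DE n then Poly_Mapping.lookup (W n) k else 0)"
      using fin[OF finDE] by simp
    also have "\<dots> = (if pos_deg (letters k) < n then Poly_Mapping.lookup (W n) k else 0)"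
    proof (cases "Poly_Mapping.lookup (W n) k = 0")
      case False
      then have "letters k \<in> {w \<in> triangular N. word_deg w \<in> DE}"
        using Wspan[of n] by (auto simp: in_keys_iff[symmetric])
      then show ?thesis by (simp add: strip_def word_deg_eq)
    qed simp
    finally show "Poly_Mapping.lookup (\<Sum>(R, S)\<in>strip DE n. c R S) k =
        Poly_Mapping.lookup (word_part (\<lambda>w. pos_deg w < n) (W n)) k"
      by (simp add: lookup_word_part)
  qed
  have trunc_w: "comp_trunc N \<kappa> w n = cls (word_part (\<lambda>w. pos_deg w < n) (W n))" for n
    unfolding sum_parts[symmetric]
  proof (rule comp_trunc_rep)
    show "c r s \<in> F" for r s using c_tri tri_span_F by blast
    show "{(r, s). s < n \<and> w r s \<noteq> \<zero>\<^bsub>A\<^esub>} \<subseteq> strip DE n"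
      using w_0 unfolding strip_def by blast
    show "finite (strip DE n)" by (rule fin[OF finDE])
    show "strip DE n \<subseteq> {(r, s). s < n}" unfolding strip_def by blast
  qed (simp add: w_def)
  have nz: "{(r, s). s < n \<and> u r s \<noteq> \<zero>\<^bsub>A\<^esub>} \<subseteq> strip D n"
    "{(r, s). s < n \<and> v r s \<noteq> \<zero>\<^bsub>A\<^esub>} \<subseteq> strip E n" for n
    using p(3) q(3) unfolding strip_def by blast+
  have low: "strip Z n \<subseteq> {(r, s). s < n}" for Z n
    unfolding strip_def by blast
  have trunc_uv: "comp_trunc N \<kappa> u n = cls (\<Sum>(r, s)\<in>strip D n. p r s)"
    "comp_trunc N \<kappa> v n = cls (\<Sum>(r, s)\<in>strip E n. q r s)" for n
    by (rule comp_trunc_rep[OF p(2) pF(1) fin[OF D] low nz(1)])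
      (rule comp_trunc_rep[OF q(2) pF(2) fin[OF E] low nz(2)])
  have trunc_uv_F: "(\<Sum>(r, s)\<in>strip D n. p r s) \<in> F" "(\<Sum>(r, s)\<in>strip E n. q r s) \<in> F" for n
    using pF by (auto intro!: F_sum)
  have prod_uv: "(\<Sum>(r, s)\<in>strip D n. p r s) * (\<Sum>(r, s)\<in>strip E n. q r s) \<approx> (\<Sum>x\<in>X n. nf2 x)" for n
    unfolding X_def sum_product sum.cartesian_product
    by (rule eqv_sum) (auto simp: nf2_def nf(2))
  have "is_comp_prod N \<kappa> u v w"
    unfolding is_comp_prod_def
  proof (intro conjI allI)
    show "w \<in> comp_carrier N \<kappa>" using w_carrier by (simp add: C_simps(1))
    fix m
    show "\<forall>\<^sub>F n in sequentially. comp_trunc N \<kappa> u n \<otimes>\<^bsub>U_gl N \<kappa>\<^esub> comp_trunc N \<kappa> v n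
        \<ominus>\<^bsub>U_gl N \<kappa>\<^esub> comp_trunc N \<kappa> w n \<in> comp_nbhd N \<kappa> m"
      using eventually_ge_at_top[of "m + M"]
    proof eventually_elim
      case (elim n)
      let ?high = "word_span {w \<in> triangular N. m \<le> pos_deg w}"
      let ?d = "word_part (\<lambda>w. \<not> pos_deg w < n) (W n) - (\<Sum>x\<in>Y n - X n. nf2 x)"
      have "(\<Sum>(r, s)\<in>strip D n. p r s) * (\<Sum>(r, s)\<in>strip E n. q r s) - word_part (\<lambda>w. pos_deg w < n) (W n)
          \<approx> (\<Sum>x\<in>X n. nf2 x) - word_part (\<lambda>w. pos_deg w < n) (W n)"
        by (rule eqv_diff[OF prod_uv eqv_refl])
      also have "\<dots> = ?d"
        using word_part_compl[of "W n" "\<lambda>w. pos_deg w < n"]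
          sum.subset_diff[OF XY finXY(2), of nf2 n] by (simp add: W_def algebra_simps)
      finally have "comp_trunc N \<kappa> u n \<otimes>\<^bsub>A\<^esub> comp_trunc N \<kappa> v n \<ominus>\<^bsub>A\<^esub> comp_trunc N \<kappa> w n = cls ?d"
        unfolding trunc_uv trunc_w
        using trunc_uv_F word_span_part[OF Wspan, of "\<lambda>w. pos_deg w < n" n] triangular_span_F
        by (simp add: A_mult A_diff F_mult cls_eq_iff conj_assoc)
      moreover have "?d \<in> ?high"
      proof (rule word_span_diff[OF _ word_span_sum])
        show "word_part (\<lambda>w. \<not> pos_deg w < n) (W n) \<in> ?high"
          by (rule word_span_mono[OF _ word_span_part[OF Wspan]]) (use elim in auto)
        fix x assume x: "x \<in> Y n - X n"
        show "nf2 x \<in> ?high"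
          by (rule word_span_mono[OF _ nf2]) (use inXM[of x n] deg[of x n] x elim in fastforce)
      qed
      ultimately show ?case
        unfolding comp_nbhd_eq U_gl_eq by (simp only:) (rule imageI)
    qed
  qed
  then show ?thesis by blast
qed

text \<open>
  Hence the choice operator in the multiplication selects a limit of the products of truncations.
\<close>
lemma C_mult:
  assumes "u \<in> carrier C" "v \<in> carrier C"
  shows "is_comp_prod N \<kappa> u v (u \<otimes>\<^bsub>C\<^esub> v)"
  unfolding C_simps(6) using someI_ex[OF comp_prod_exists[OF assms]] .

end

section \<open>Highest weight modules over the completion\<close>

text \<open>
  Highest weight modules are taken in the wide sense: generated by a vector that
  $\hat{\mathfrak n}_+$ annihilates.
\<close>
locale highest_weight_module = affine_gl N \<kappa>
  for N :: nat and \<kappa> :: complex +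
  fixes scale :: "complex \<Rightarrow> 'v::ab_group_add \<Rightarrow> 'v"
    and \<rho> :: "gl_gen free set \<Rightarrow> 'v \<Rightarrow> 'v" and v :: 'v
  assumes vector_space: "vector_space scale"
    and hom: "\<rho> \<in> alg_hom A (end_algebra scale)"
    and cyclic: "\<exists>p\<in>F. x = \<rho> (cls p) v"
    and annihilated: "g \<in> n_plus N \<Longrightarrow> \<rho> (cls (gen g)) v = 0"
begin

sublocale V: vector_space scale
  by (rule vector_space)

lemma rho_linear: "a \<in> carrier A \<Longrightarrow> Vector_Spaces.linear scale scale (\<rho> a)"
  using hom by (auto simp: alg_hom_def ring_hom_def end_algebra_def)

lemma rho_vec:
  assumes "a \<in> carrier A"
  shows "\<rho> a (x + y) = \<rho> a x + \<rho> a y" "\<rho> a (scale c x) = scale c (\<rho> a x)" "\<rho> a 0 = 0"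
proof -
  interpret L: Vector_Spaces.linear scale scale "\<rho> a"
    by (rule rho_linear[OF assms])
  show "\<rho> a (x + y) = \<rho> a x + \<rho> a y" "\<rho> a (scale c x) = scale c (\<rho> a x)" "\<rho> a 0 = 0"
    by (rule L.add L.scale L.zero)+
qed

lemma rho_add: "a \<in> carrier A \<Longrightarrow> b \<in> carrier A \<Longrightarrow> \<rho> (a \<oplus>\<^bsub>A\<^esub> b) x = \<rho> a x + \<rho> b x"
  using hom by (simp add: alg_hom_def ring_hom_def end_algebra_def)

lemma rho_mult: "a \<in> carrier A \<Longrightarrow> b \<in> carrier A \<Longrightarrow> \<rho> (a \<otimes>\<^bsub>A\<^esub> b) x = \<rho> a (\<rho> b x)"
  using hom by (simp add: alg_hom_def ring_hom_def end_algebra_def)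

lemma rho_smult: "a \<in> carrier A \<Longrightarrow> \<rho> (c \<odot>\<^bsub>A\<^esub> a) x = scale c (\<rho> a x)"
  using hom by (simp add: alg_hom_def ring_hom_def end_algebra_def)

lemma rho_0: "\<rho> \<zero>\<^bsub>A\<^esub> x = 0"
  using rho_add[OF quot.zero_closed quot.zero_closed, of x] by simp

lemma rho_uminus: "a \<in> carrier A \<Longrightarrow> \<rho> (\<ominus>\<^bsub>A\<^esub> a) x = - \<rho> a x"
  using rho_add[OF _ quot.a_inv_closed, of a a x] by (simp add: quot.r_neg rho_0 eq_neg_iff_add_eq_0 add.commute)

lemma rho_diff: "a \<in> carrier A \<Longrightarrow> b \<in> carrier A \<Longrightarrow> \<rho> (a \<ominus>\<^bsub>A\<^esub> b) x = \<rho> a x - \<rho> b x"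
  by (simp add: a_minus_def rho_add rho_uminus)

abbreviation act where "act p \<equiv> \<rho> (cls p)"

lemma act_add: "p \<in> F \<Longrightarrow> q \<in> F \<Longrightarrow> act (p + q) x = act p x + act q x"
  by (simp add: A_add[symmetric] rho_add cls_carrier)

lemma act_mult: "p \<in> F \<Longrightarrow> q \<in> F \<Longrightarrow> act (p * q) x = act p (act q x)"
  by (simp add: A_mult[symmetric] rho_mult cls_carrier)

lemma act_cst: "p \<in> F \<Longrightarrow> act (cst c * p) x = scale c (act p x)"
  by (simp add: A_smult[symmetric] rho_smult cls_carrier)

lemma act_0: "act 0 x = 0"
  using rho_0 by (simp add: A_simps(4))

lemma act_eqv: "p \<approx> q \<Longrightarrow> act p x = act q x"
  by (simp add: cls_eq_iff[THEN iffD2])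

lemma act_sum:
  "(\<And>i. i \<in> X \<Longrightarrow> f i \<in> F) \<Longrightarrow> act (\<Sum>i\<in>X. f i) x = (\<Sum>i\<in>X. act (f i) x)"
proof (induction X rule: infinite_finite_induct)
  case (insert i X)
  then have "act (f i + sum f X) x = act (f i) x + act (sum f X) x"
    by (intro act_add F_sum) auto
  with insert show ?case by simp
qed (simp_all add: act_0)

lemma span_annihilates:
  assumes "p \<in> word_span S" "\<And>w. w \<in> S \<Longrightarrow> set w \<subseteq> gl_gens N"
    and "\<And>w. w \<in> S \<Longrightarrow> act (monom_word w) x = 0"
  shows "act p x = 0"
proof -
  have "p \<in> F \<and> act p x = 0"
    using assms(1)
  proof (induction rule: word_span_induct)
    case (monom c w)
    then show ?case
      using assms(2,3) F_mult[OF F_cst F_monom] by (simp add: act_cst F_monom)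
  qed (simp_all add: act_0 act_add F_0 F_add)
  then show ?thesis ..
qed

text \<open>
  Positive degree forces a letter of $\hat{\mathfrak n}_+$ at the right end of the word.
\<close>
lemma triangular_annihilates:
  assumes "w \<in> triangular N" "0 < pos_deg w"
  shows "act (monom_word w) v = 0"
proof -
  obtain a b d where w: "w = a @ b @ d" "set a \<subseteq> n_minus N" "set b \<subseteq> h_cartan N" "set d \<subseteq> n_plus N"
    using assms(1) unfolding triangular_def by blast
  have "d \<noteq> []"
    using assms(2) w n_minus_pos_deg[of a N] h_cartan_deg[of b N] by auto
  then obtain d' g where d: "d = d' @ [g]" by (metis rev_exhaust)
  have g: "g \<in> n_plus N" using w d by simp
  have "monom_word w = monom_word (a @ b @ d') * gen g"
    unfolding w d gen_def monom_word_append[symmetric] by simp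
  moreover have "monom_word (a @ b @ d') \<in> F"
    using triangular_gens[OF assms(1)] unfolding w d by (intro F_monom) auto
  moreover have "gen g \<in> F" using g triangular_part_subset[of N] by (intro F_gen) auto
  ultimately show ?thesis
    using annihilated[OF g] by (simp add: act_mult rho_vec(3) cls_carrier)
qed

text \<open>
  A word of positive total degree straightens to triangular words of positive total degree, whose
  positive degrees are positive all the more.
\<close>
lemma positive_word_annihilates:
  assumes "set w \<subseteq> gl_gens N" "0 < word_deg w"
  shows "act (monom_word w) v = 0"
proof -
  obtain q where q: "monom_word w \<approx> q" "q \<in> word_span {u \<in> triangular N. word_deg u = word_deg w}"
    using triangular_straightening[OF assms(1)] unfolding reducible_def by blast
  have "act q v = 0"
    by (rule span_annihilates[OF q(2)])
      (use assms(2) triangular_annihilates triangular_gens[of _ N] word_deg_eq in auto)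
  then show ?thesis using act_eqv[OF q(1)] by simp
qed

text \<open>
  Write the vector as \<open>p v\<close>.  If the $\hat{\mathfrak n}_+$ part of a triangular word outweighs the
  negative degrees of the finitely many words of \<open>p\<close>, then in front of \<open>p\<close> it gives words of positive
  total degree, which annihilate \<open>v\<close>.
\<close>
lemma smooth:
  "\<exists>t. \<forall>w\<in>triangular N. t \<le> pos_deg w \<longrightarrow> act (monom_word w) x = 0"
proof -
  obtain p where p: "p \<in> F" "x = act p v" using cyclic by blast
  define t where "t = Suc (Max (insert 0 ((\<lambda>u. nat (- word_deg (letters u))) ` Poly_Mapping.keys p)))"
  let ?S = "letters ` Poly_Mapping.keys p"
  have t: "- word_deg u < int t" if "u \<in> ?S" for u
  proof -
    have "nat (- word_deg u) \<le> Max (insert 0 ((\<lambda>u. nat (- word_deg (letters u))) ` Poly_Mapping.keys p))"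
      using that by (intro Max_ge) auto
    then show ?thesis unfolding t_def by linarith
  qed
  have S: "set u \<subseteq> gl_gens N" if "u \<in> ?S" for u
    using p(1) that by (auto simp: free_algebra_def)
  have pS: "p \<in> word_span ?S"
    by (auto simp: image_iff intro!: bexI)
  have "act (monom_word w) x = 0" if w: "w \<in> triangular N" "t \<le> pos_deg w" for w
  proof -
    obtain a b d where abd: "w = a @ b @ d" "set a \<subseteq> n_minus N" "set b \<subseteq> h_cartan N" "set d \<subseteq> n_plus N"
      using w(1) unfolding triangular_def by blast
    have d: "int t \<le> word_deg d"
      using w(2) abd n_minus_pos_deg[of a N] h_cartan_deg[of b N] n_plus_neg_deg[of d N]
      by (simp add: word_deg_eq)
    have gens: "set (a @ b) \<subseteq> gl_gens N" "set d \<subseteq> gl_gens N"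
      using triangular_gens[OF w(1)] abd(1) by auto
    have "monom_word d * p \<in> word_span ((@) d ` ?S)"
      by (rule word_span_mult[OF word_span_monom[of d "{d}"] pS]) auto
    then have "act (monom_word d * p) v = 0"
    proof (rule span_annihilates)
      fix u assume "u \<in> (@) d ` ?S"
      then obtain u' where u: "u = d @ u'" "u' \<in> ?S" by blast
      then show "set u \<subseteq> gl_gens N" using S[OF u(2)] gens by simp
      then show "act (monom_word u) v = 0"
        by (rule positive_word_annihilates) (use t[OF u(2)] d u(1) in simp)
    qed
    then have "act (monom_word d) x = 0"
      using p gens by (simp add: act_mult F_monom)
    then show ?thesis
      using act_mult[OF F_monom[OF gens(1)] F_monom[OF gens(2)], of x] rho_vec(3)[OF cls_carrier[OF F_monom[OF gens(1)]]]
      unfolding abd monom_word_append[symmetric] by simp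
  qed
  then show ?thesis by blast
qed

text \<open>
  Together with \<open>smooth\<close>: from the threshold \<open>t\<close> on, components of elements of the completion do not
  contribute to the action on \<open>x\<close>.
\<close>
definition killed_from :: "nat \<Rightarrow> 'v \<Rightarrow> bool" where
  "killed_from t x \<longleftrightarrow> (\<forall>w\<in>triangular N. t \<le> pos_deg w \<longrightarrow> act (monom_word w) x = 0)"

lemma killed_from_span:
  assumes "killed_from t x" "p \<in> word_span {w \<in> triangular N. t \<le> pos_deg w}"
  shows "act p x = 0"
  by (rule span_annihilates[OF assms(2)]) (use assms(1) triangular_gens[of _ N] in \<open>auto simp: killed_from_def\<close>)

lemma killed_from_U_tri:
  assumes "killed_from t x" "a \<in> U_tri N \<kappa> r s" "t \<le> s"
  shows "\<rho> a x = 0"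
proof -
  obtain p where p: "a = cls p" "p \<in> word_span (tri_words N r s)"
    using assms(2) unfolding U_tri_eq by blast
  have "p \<in> word_span {w \<in> triangular N. t \<le> pos_deg w}"
    by (rule word_span_mono[OF _ p(2)]) (use assms(3) in \<open>auto simp: tri_words_eq\<close>)
  then show ?thesis using killed_from_span[OF assms(1)] p(1) by simp
qed

lemma highest_weight_vector_killed: "killed_from 1 v"
  unfolding killed_from_def using triangular_annihilates by auto

lemma comp_act_strip:
  assumes "u \<in> carrier C" "finite D" "\<And>r s. u r s \<noteq> \<zero>\<^bsub>A\<^esub> \<Longrightarrow> int s - int r \<in> D" "killed_from t x" "t \<le> n"
  shows "comp_act \<rho> u x = (\<Sum>(r, s)\<in>strip D n. \<rho> (u r s) x)"
  unfolding comp_act_def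
proof (rule sum.mono_neutral_left)
  show "finite (strip D n)" by (rule finite_strip[OF assms(2)])
  show "{(r, s). \<rho> (u r s) x \<noteq> 0} \<subseteq> strip D n"
  proof clarify
    fix r s assume nz: "\<rho> (u r s) x \<noteq> 0"
    have "\<not> t \<le> s" using killed_from_U_tri[OF assms(4) C_tri[OF assms(1)]] nz by blast
    moreover have "u r s \<noteq> \<zero>\<^bsub>A\<^esub>" using nz rho_0 by metis
    ultimately show "(r, s) \<in> strip D n" using assms(3,5) by (simp add: strip_def)
  qed
qed auto

text \<open>
  On a fixed vector an element of the completion acts through any sufficiently long truncation, which is
  an element of the enveloping algebra.
\<close>
lemma comp_act_trunc:
  assumes "u \<in> carrier C" "killed_from t x" "t \<le> n"
  shows "comp_act \<rho> u x = \<rho> (comp_trunc N \<kappa> u n) x" "comp_trunc N \<kappa> u n \<in> carrier A"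
proof -
  obtain p D where D: "finite D" "\<And>r s. p r s \<in> word_span (tri_words N r s)" "\<And>r s. u r s = cls (p r s)"
      "\<And>r s. u r s \<noteq> \<zero>\<^bsub>A\<^esub> \<Longrightarrow> int s - int r \<in> D"
    using comp_representatives[OF assms(1)] by blast
  have pF: "p r s \<in> F" for r s using tri_span_F[OF D(2)] .
  have sub: "strip D n \<subseteq> {(r, s). s < n}" "{(r, s). s < n \<and> u r s \<noteq> \<zero>\<^bsub>A\<^esub>} \<subseteq> strip D n"
    using D(4) unfolding strip_def by blast+
  have fin: "finite (strip D n)" by (rule finite_strip[OF D(1)])
  have tr: "comp_trunc N \<kappa> u n = cls (\<Sum>(r, s)\<in>strip D n. p r s)"
    by (rule comp_trunc_rep[OF D(3) pF fin sub])
  have F: "(case x of (r, s) \<Rightarrow> p r s) \<in> F" for x using pF by (cases x) simp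
  show "comp_trunc N \<kappa> u n \<in> carrier A"
    unfolding tr by (rule cls_carrier, rule F_sum, rule F)
  have "comp_act \<rho> u x = (\<Sum>(r, s)\<in>strip D n. \<rho> (u r s) x)"
    by (rule comp_act_strip[OF assms(1) D(1,4) assms(2,3)])
  also have "\<dots> = (\<Sum>x'\<in>strip D n. act (case x' of (r, s) \<Rightarrow> p r s) x)"
    by (rule sum.cong) (auto simp: D(3))
  also have "\<dots> = act (\<Sum>(r, s)\<in>strip D n. p r s) x"
    by (rule act_sum[symmetric]) (rule F)
  finally show "comp_act \<rho> u x = \<rho> (comp_trunc N \<kappa> u n) x" unfolding tr .
qed

lemma obtain_killed_from: obtains t where "killed_from t x"
  using smooth[of x] unfolding killed_from_def by blast

lemma comp_act_add:
  assumes "u \<in> carrier C" "w \<in> carrier C"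
  shows "comp_act \<rho> (u \<oplus>\<^bsub>C\<^esub> w) x = comp_act \<rho> u x + comp_act \<rho> w x"
proof -
  obtain t where t: "killed_from t x" by (rule obtain_killed_from)
  obtain D where D: "finite D" "\<And>r s. u r s \<noteq> \<zero>\<^bsub>A\<^esub> \<Longrightarrow> int s - int r \<in> D"
    using C_degrees[OF assms(1)] by blast
  obtain E where E: "finite E" "\<And>r s. w r s \<noteq> \<zero>\<^bsub>A\<^esub> \<Longrightarrow> int s - int r \<in> E"
    using C_degrees[OF assms(2)] by blast
  obtain E' where E': "finite E'" "\<And>r s. (u \<oplus>\<^bsub>C\<^esub> w) r s \<noteq> \<zero>\<^bsub>A\<^esub> \<Longrightarrow> int s - int r \<in> E'"
    using C_degrees[OF C_add[OF assms]] by blast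
  let ?D = "D \<union> E \<union> E'"
  have fin: "finite ?D" using D E E' by simp
  have "comp_act \<rho> (u \<oplus>\<^bsub>C\<^esub> w) x = (\<Sum>(r, s)\<in>strip ?D t. \<rho> ((u \<oplus>\<^bsub>C\<^esub> w) r s) x)"
    by (rule comp_act_strip[OF C_add[OF assms] fin _ t order_refl]) (use E'(2) in blast)
  also have "\<dots> = (\<Sum>(r, s)\<in>strip ?D t. \<rho> (u r s) x + \<rho> (w r s) x)"
    unfolding C_simps(3) by (intro sum.cong refl) (simp add: split_beta rho_add[OF C_component_carrier[OF assms(1)] C_component_carrier[OF assms(2)]])
  also have "\<dots> = (\<Sum>(r, s)\<in>strip ?D t. \<rho> (u r s) x) + (\<Sum>(r, s)\<in>strip ?D t. \<rho> (w r s) x)"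
    by (simp add: split_beta sum.distrib)
  also have "(\<Sum>(r, s)\<in>strip ?D t. \<rho> (u r s) x) = comp_act \<rho> u x"
    by (rule comp_act_strip[OF assms(1) fin _ t order_refl, symmetric]) (use D(2) in blast)
  also have "(\<Sum>(r, s)\<in>strip ?D t. \<rho> (w r s) x) = comp_act \<rho> w x"
    by (rule comp_act_strip[OF assms(2) fin _ t order_refl, symmetric]) (use E(2) in blast)
  finally show ?thesis .
qed

lemma comp_act_0: "comp_act \<rho> \<zero>\<^bsub>C\<^esub> x = 0"
  using comp_act_add[OF C_0 C_0, of x] by simp

lemma comp_act_uminus: "u \<in> carrier C \<Longrightarrow> comp_act \<rho> (\<ominus>\<^bsub>C\<^esub> u) x = - comp_act \<rho> u x"
  using comp_act_add[OF _ compl.a_inv_closed, of u u x]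
  by (simp add: compl.r_neg comp_act_0 eq_neg_iff_add_eq_0 add.commute)

lemma comp_act_diff:
  "u \<in> carrier C \<Longrightarrow> w \<in> carrier C \<Longrightarrow> comp_act \<rho> (u \<ominus>\<^bsub>C\<^esub> w) x = comp_act \<rho> u x - comp_act \<rho> w x"
  by (simp add: a_minus_def comp_act_add comp_act_uminus)

lemma comp_act_finsum:
  "(\<And>i. i \<in> X \<Longrightarrow> f i \<in> carrier C) \<Longrightarrow> comp_act \<rho> (finsum C f X) x = (\<Sum>i\<in>X. comp_act \<rho> (f i) x)"
proof (induction X rule: infinite_finite_induct)
  case (infinite X)
  then show ?case by (simp add: finsum_def finprod_def comp_act_0[unfolded C_simps(2)] C_simps(2))
next
  case empty
  show ?case by (simp add: comp_act_0)
next
  case (insert i X)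
  then have car: "f i \<in> carrier C" "f \<in> X \<rightarrow> carrier C" by auto
  have "finsum C f (insert i X) = f i \<oplus>\<^bsub>C\<^esub> finsum C f X"
    by (rule compl.finsum_insert[OF insert.hyps car(2,1)])
  then show ?case
    using insert car comp_act_add[OF car(1) compl.finsum_closed[OF car(2)], of x] by simp
qed

lemma comp_act_smult:
  assumes "u \<in> carrier C"
  shows "comp_act \<rho> (c \<odot>\<^bsub>C\<^esub> u) x = scale c (comp_act \<rho> u x)"
proof -
  obtain t where t: "killed_from t x" by (rule obtain_killed_from)
  obtain D where D: "finite D" "\<And>r s. u r s \<noteq> \<zero>\<^bsub>A\<^esub> \<Longrightarrow> int s - int r \<in> D"
    using C_degrees[OF assms(1)] by blast
  obtain E where E: "finite E" "\<And>r s. (c \<odot>\<^bsub>C\<^esub> u) r s \<noteq> \<zero>\<^bsub>A\<^esub> \<Longrightarrow> int s - int r \<in> E"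
    using C_degrees[OF C_smult[OF assms]] by blast
  let ?D = "D \<union> E"
  have fin: "finite ?D" using D E by simp
  have "comp_act \<rho> (c \<odot>\<^bsub>C\<^esub> u) x = (\<Sum>(r, s)\<in>strip ?D t. \<rho> ((c \<odot>\<^bsub>C\<^esub> u) r s) x)"
    by (rule comp_act_strip[OF C_smult[OF assms] fin _ t order_refl]) (use E(2) in blast)
  also have "\<dots> = (\<Sum>(r, s)\<in>strip ?D t. scale c (\<rho> (u r s) x))"
    unfolding C_simps(4) by (intro sum.cong refl) (simp add: split_beta rho_smult[OF C_component_carrier[OF assms]])
  also have "\<dots> = scale c (\<Sum>(r, s)\<in>strip ?D t. \<rho> (u r s) x)"
    by (simp add: split_beta V.scale_sum_right)
  also have "(\<Sum>(r, s)\<in>strip ?D t. \<rho> (u r s) x) = comp_act \<rho> u x"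
    by (rule comp_act_strip[OF assms(1) fin _ t order_refl, symmetric]) (use D(2) in blast)
  finally show ?thesis .
qed

lemma comp_act_vec:
  assumes "u \<in> carrier C"
  shows "comp_act \<rho> u (x + y) = comp_act \<rho> u x + comp_act \<rho> u y"
    and "comp_act \<rho> u (scale c x) = scale c (comp_act \<rho> u x)"
proof -
  obtain t1 where t1: "killed_from t1 x" by (rule obtain_killed_from)
  obtain t2 where t2: "killed_from t2 y" by (rule obtain_killed_from)
  obtain t3 where t3: "killed_from t3 (x + y)" by (rule obtain_killed_from)
  obtain t4 where t4: "killed_from t4 (scale c x)" by (rule obtain_killed_from)
  define n where "n = max (max t1 t2) (max t3 t4)"
  have n: "t1 \<le> n" "t2 \<le> n" "t3 \<le> n" "t4 \<le> n" unfolding n_def by auto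
  note car = comp_act_trunc(2)[OF assms t1 n(1)]
  show "comp_act \<rho> u (x + y) = comp_act \<rho> u x + comp_act \<rho> u y"
    unfolding comp_act_trunc(1)[OF assms t1 n(1)] comp_act_trunc(1)[OF assms t2 n(2)]
      comp_act_trunc(1)[OF assms t3 n(3)] by (rule rho_vec(1)[OF car])
  show "comp_act \<rho> u (scale c x) = scale c (comp_act \<rho> u x)"
    unfolding comp_act_trunc(1)[OF assms t1 n(1)] comp_act_trunc(1)[OF assms t4 n(4)]
    by (rule rho_vec(2)[OF car])
qed

text \<open>
  At a sufficiently large \<open>n\<close> all three elements act through their truncations, and the defect of
  the truncations lies in a neighbourhood that annihilates \<open>x\<close>.  The argument applies to every limit of
  the products of truncations, in particular to the chosen one.
\<close>
lemma comp_act_mult: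
  assumes "u \<in> carrier C" "w \<in> carrier C"
  shows "comp_act \<rho> (u \<otimes>\<^bsub>C\<^esub> w) x = comp_act \<rho> u (comp_act \<rho> w x)"
proof -
  define y where "y = comp_act \<rho> w x"
  obtain t where t: "killed_from t x" by (rule obtain_killed_from)
  obtain t' where t': "killed_from t' y" by (rule obtain_killed_from)
  have prod: "is_comp_prod N \<kappa> u w (u \<otimes>\<^bsub>C\<^esub> w)" by (rule C_mult[OF assms])
  then have uw: "u \<otimes>\<^bsub>C\<^esub> w \<in> carrier C" by (simp add: is_comp_prod_def C_simps(1))
  have "\<forall>\<^sub>F n in sequentially. comp_trunc N \<kappa> u n \<otimes>\<^bsub>A\<^esub> comp_trunc N \<kappa> w n
      \<ominus>\<^bsub>A\<^esub> comp_trunc N \<kappa> (u \<otimes>\<^bsub>C\<^esub> w) n \<in> comp_nbhd N \<kappa> t"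
    using prod unfolding is_comp_prod_def U_gl_eq by blast
  then have "\<forall>\<^sub>F n in sequentially. comp_trunc N \<kappa> u n \<otimes>\<^bsub>A\<^esub> comp_trunc N \<kappa> w n
      \<ominus>\<^bsub>A\<^esub> comp_trunc N \<kappa> (u \<otimes>\<^bsub>C\<^esub> w) n \<in> comp_nbhd N \<kappa> t \<and> max t t' \<le> n"
    by (rule eventually_conj[OF _ eventually_ge_at_top])
  then obtain n where n: "comp_trunc N \<kappa> u n \<otimes>\<^bsub>A\<^esub> comp_trunc N \<kappa> w n
      \<ominus>\<^bsub>A\<^esub> comp_trunc N \<kappa> (u \<otimes>\<^bsub>C\<^esub> w) n \<in> comp_nbhd N \<kappa> t" "t \<le> n" "t' \<le> n"
    using eventually_happens'[OF sequentially_bot] by fastforce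
  note u = comp_act_trunc[OF assms(1) t' n(3)] and w = comp_act_trunc[OF assms(2) t n(2)]
    and m = comp_act_trunc[OF uw t n(2)]
  have "\<rho> (comp_trunc N \<kappa> u n \<otimes>\<^bsub>A\<^esub> comp_trunc N \<kappa> w n \<ominus>\<^bsub>A\<^esub> comp_trunc N \<kappa> (u \<otimes>\<^bsub>C\<^esub> w) n) x = 0"
    using n(1) killed_from_span[OF t] unfolding comp_nbhd_eq by auto
  then have "\<rho> (comp_trunc N \<kappa> u n) (\<rho> (comp_trunc N \<kappa> w n) x) = \<rho> (comp_trunc N \<kappa> (u \<otimes>\<^bsub>C\<^esub> w) n) x"
    using rho_diff[OF quot.m_closed[OF u(2) w(2)] m(2)] rho_mult[OF u(2) w(2)] by simp
  then show ?thesis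
    using u(1) w(1) m(1) unfolding y_def by simp
qed

text \<open>
  The highest weight vector is annihilated by all components with \<open>s > 0\<close>.
\<close>
lemma comp_act_cong_highest:
  assumes "u \<in> carrier C" "w \<in> carrier C" "\<And>r. u r 0 = w r 0"
  shows "comp_act \<rho> u v = comp_act \<rho> w v"
proof -
  have "\<rho> (u r s) v = \<rho> (w r s) v" for r s
  proof (cases "s = 0")
    case False
    then have "1 \<le> s" by simp
    then show ?thesis
      using killed_from_U_tri[OF highest_weight_vector_killed C_tri[OF assms(1)]]
        killed_from_U_tri[OF highest_weight_vector_killed C_tri[OF assms(2)]] by simp
  qed (simp add: assms(3))
  then show ?thesis unfolding comp_act_def by simp
qed

lemma comp_act_word:
  assumes "w \<in> triangular N"
  shows "comp_act \<rho> (comp_word N \<kappa> w) x = act (monom_word w) x"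
proof -
  let ?f = "\<lambda>(r, s). \<rho> (comp_word N \<kappa> w r s) x"
  have "comp_act \<rho> (comp_word N \<kappa> w) x = sum ?f {(neg_deg w, pos_deg w)}"
    unfolding comp_act_def
    by (rule sum.mono_neutral_left) (auto simp: comp_word_apply act_0 split: if_splits)
  then show ?thesis by (simp add: comp_word_apply)
qed

end

section \<open>Rank one reduction\<close>

text \<open>
  The operators \<open>X r\<close>, \<open>Z r\<close>, \<open>H r\<close> stand for $x^+_{i,r}$, $x^-_{i,r}$, $h_{i,r}$ with a fixed \<open>i\<close>,
  and \<open>b\<close> for $\hbar$.  The relation with \<open>H 1\<close> expresses \<open>X (Suc r) v\<close> and \<open>Z (Suc r) v\<close> through
  \<open>X r v\<close> and \<open>Z r v\<close>.
\<close>
lemma rank_one_highest_weight: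
  fixes scale :: "complex \<Rightarrow> 'v::ab_group_add \<Rightarrow> 'v" and X Z H :: "nat \<Rightarrow> 'v \<Rightarrow> 'v"
  assumes "vector_space scale"
    and hom: "\<And>r c x. X r (scale c x) = scale c (X r x)" "\<And>r c x. Z r (scale c x) = scale c (Z r x)"
      "\<And>r c x. H r (scale c x) = scale c (H r x)"
    and xz: "\<And>r s x. X r (Z s x) - Z s (X r x) = H (r + s) x"
    and h0x: "\<And>r x. H 0 (X r x) - X r (H 0 x) = scale 2 (X r x)"
    and h0z: "\<And>r x. H 0 (Z r x) - Z r (H 0 x) = scale (- 2) (Z r x)"
    and h1x: "\<And>r x. H 1 (X r x) - X r (H 1 x) - (H 0 (X (Suc r) x) - X (Suc r) (H 0 x))
      = scale b (H 0 (X r x) + X r (H 0 x))"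
    and h1z: "\<And>r x. H 1 (Z r x) - Z r (H 1 x) - (H 0 (Z (Suc r) x) - Z (Suc r) (H 0 x))
      = scale (- b) (H 0 (Z r x) + Z r (H 0 x))"
    and v: "X 0 v = 0" "H 0 v = scale h v" "Z 1 v = scale a (Z 0 v)"
  shows "X r v = 0" "H r v = scale (a ^ r * h) v"
proof -
  interpret V: vector_space scale by fact
  have zero: "X r 0 = 0" "Z r 0 = 0" "H r 0 = 0" for r
    using hom[of r 0] by simp_all
  \<comment> \<open>\<open>H 1 = [X 0, Z 1]\<close>, and \<open>Z 1 v\<close> is a multiple of \<open>Z 0 v\<close>.\<close>
  have H1: "H 1 v = scale (a * h) v"
    using xz[of 0 1 v] xz[of 0 0 v] by (simp add: v[unfolded One_nat_def] zero hom)
  have X: "X r v = 0" for r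
  proof (induction r)
    case (Suc r)
    have "scale 2 (X (Suc r) v) = 0"
      using h1x[of r v] h0x[of "Suc r" v] H1 v(2) Suc by (simp add: hom zero)
    then show ?case by simp
  qed (rule v)
  show "X r v = 0" by (rule X)
  \<comment> \<open>This expresses \<open>2 Z (Suc r) v\<close> by an operator applied to \<open>Z r v\<close> that is independent of \<open>r\<close> and
    commutes with scalars; so \<open>Z r v = a^r Z 0 v\<close> follows from the case \<open>r = 0\<close>.\<close>
  have rec: "scale 2 (Z (Suc r) v) = scale (- b) (H 0 (Z r v) + scale h (Z r v))
      - (H 1 (Z r v) - scale (a * h) (Z r v))" for r
  proof -
    have h0: "H 0 (Z (Suc r) v) - scale h (Z (Suc r) v) = scale (- 2) (Z (Suc r) v)"
      using h0z[of "Suc r" v] unfolding v(2) hom .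
    have "H 1 (Z r v) - scale (a * h) (Z r v) - scale (- 2) (Z (Suc r) v)
        = scale (- b) (H 0 (Z r v) + scale h (Z r v))"
      using h1z[of r v] unfolding v(2) hom h0 H1 .
    then have "H 1 (Z r v) - scale (a * h) (Z r v) + scale 2 (Z (Suc r) v)
        = scale (- b) (H 0 (Z r v) + scale h (Z r v))"
      by (simp only: V.scale_minus_left diff_minus_eq_add)
    then show ?thesis by (simp only: eq_diff_eq add.commute)
  qed
  have Z: "Z r v = scale (a ^ r) (Z 0 v)" for r
  proof (induction r)
    case (Suc r)
    have "scale 2 (Z (Suc r) v) = scale (a ^ r) (scale 2 (Z 1 v))"
      unfolding rec[of r] rec[of 0, simplified] One_nat_def Suc
      by (simp add: hom V.scale_right_distrib V.scale_right_diff_distrib mult.commute)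
    also have "\<dots> = scale 2 (scale (a ^ Suc r) (Z 0 v))"
      by (simp add: v(3)[unfolded One_nat_def] mult.commute)
    finally show ?case by (rule V.scale_left_imp_eq[rotated]) simp
  qed simp
  have "H r v = scale (a ^ r) (X 0 (Z 0 v))"
    using xz[of 0 r v] Z[of r] by (simp add: v(1) zero hom)
  also have "X 0 (Z 0 v) = scale h v"
    using xz[of 0 0 v] v by (simp add: zero)
  finally show "H r v = scale (a ^ r * h) v" by simp
qed

section \<open>Evaluation modules\<close>

lemma yangian_rels_carrier:
  "yangian_rels N \<epsilon>1 \<epsilon>2 \<subseteq> carrier (free_algebra (yangian_gens N))"
proof -
  have pres: "presentation (yangian_gens N) {}" by unfold_locales simp
  let ?F = "carrier (free_algebra (yangian_gens N))"
  note F = presentation.F_diff[OF pres] presentation.F_add[OF pres] presentation.F_mult[OF pres]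
    presentation.F_cst[OF pres] presentation.F_0[OF pres]
  have X: "xg \<sigma> i r \<in> ?F" if "i < N" for \<sigma> i r
    by (rule presentation.F_gen[OF pres]) (use that in \<open>auto simp: yangian_gens_def\<close>)
  have H: "hg i r \<in> ?F" if "i < N" for i r
    by (rule presentation.F_gen[OF pres]) (use that in \<open>auto simp: yangian_gens_def\<close>)
  have comm: "comm p q \<in> ?F" "anticomm p q \<in> ?F" if "p \<in> ?F" "q \<in> ?F" for p q
    using that F(1-3) by (simp_all add: comm_def anticomm_def)
  have foldr: "foldr (\<lambda>k z. comm (f k) z) ks z \<in> ?F" if "\<And>k. f k \<in> ?F" "z \<in> ?F"
    for f :: "nat \<Rightarrow> yangian_gen free" and ks z
    by (induction ks) (use that comm in simp_all)
  show ?thesis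
  proof
    fix p assume "p \<in> yangian_rels N \<epsilon>1 \<epsilon>2"
    then show "p \<in> ?F"
    proof cases
      case (hh i j r s)
      show ?thesis unfolding hh(1) using hh(2-) by (intro comm H)
    next
      case (xx i j r s)
      have "(if i = j then hg i (r + s) else 0) \<in> ?F"
        using H[OF xx(2)] H[OF xx(3)] presentation.F_0[OF pres] by simp
      then show ?thesis unfolding xx(1) using xx(2-) by (intro F(1) comm X)
    next
      case (h0x i j \<sigma> r)
      show ?thesis unfolding h0x(1) using h0x(2-) by (intro F comm X H)
    next
      case (hx i j r \<sigma> s)
      show ?thesis unfolding hx(1) using hx(2-) by (intro F comm X H)
    next
      case (xx_same i j \<sigma> r s)
      show ?thesis unfolding xx_same(1) using xx_same(2-) by (intro F comm X H)
    next
      case (serre i j m \<sigma> r s)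
      show ?thesis unfolding serre(1) using serre(2-)
        by (intro presentation.F_sum[OF pres] foldr X)
    qed
  qed
qed

locale evaluation_module = highest_weight_module N \<kappa> scale \<rho> v
  for N :: nat and \<kappa> :: complex and scale :: "complex \<Rightarrow> 'v::ab_group_add \<Rightarrow> 'v"
    and \<rho> :: "gl_gen free set \<Rightarrow> 'v \<Rightarrow> 'v" and v :: 'v +
  fixes \<epsilon>1 \<epsilon>2 \<alpha> :: complex and lam :: "nat \<Rightarrow> complex"
    and ev :: "yangian_gen free set \<Rightarrow> nat \<Rightarrow> nat \<Rightarrow> gl_gen free set"
  assumes N: "2 \<le> N"
    and ev: "is_evaluation_map N \<epsilon>1 \<epsilon>2 \<kappa> \<alpha> ev"
    and weight: "i \<in> {1..N} \<Longrightarrow> \<rho> (cls (gen (EE i i 0))) v = scale (lam i) v"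
    and central_charge: "\<rho> (cls (gen CC)) v = scale \<kappa> v"
begin

sublocale Y: presentation "yangian_gens N" "yangian_rels N \<epsilon>1 \<epsilon>2"
  by unfold_locales (rule yangian_rels_carrier)

lemma affine_yangian_eq: "affine_yangian N \<epsilon>1 \<epsilon>2 = Y.A"
  by (simp add: affine_yangian_def)

lemma ev_hom:
  assumes "a \<in> carrier Y.A"
  shows "ev a \<in> carrier C" "ev (z \<odot>\<^bsub>Y.A\<^esub> a) = z \<odot>\<^bsub>C\<^esub> ev a"
    and "b \<in> carrier Y.A \<Longrightarrow> ev (a \<oplus>\<^bsub>Y.A\<^esub> b) = ev a \<oplus>\<^bsub>C\<^esub> ev b"
    and "b \<in> carrier Y.A \<Longrightarrow> ev (a \<otimes>\<^bsub>Y.A\<^esub> b) = ev a \<otimes>\<^bsub>C\<^esub> ev b"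
proof -
  have "ev \<in> alg_hom Y.A C"
    using ev unfolding is_evaluation_map_def affine_yangian_eq by blast
  then show "ev a \<in> carrier C" "ev (z \<odot>\<^bsub>Y.A\<^esub> a) = z \<odot>\<^bsub>C\<^esub> ev a"
    "b \<in> carrier Y.A \<Longrightarrow> ev (a \<oplus>\<^bsub>Y.A\<^esub> b) = ev a \<oplus>\<^bsub>C\<^esub> ev b"
    "b \<in> carrier Y.A \<Longrightarrow> ev (a \<otimes>\<^bsub>Y.A\<^esub> b) = ev a \<otimes>\<^bsub>C\<^esub> ev b"
    using assms by (simp_all add: alg_hom_def ring_hom_def Pi_iff)
qed

text \<open>
  The action of the Yangian by polynomials in its generators.  It respects the ring operations because
  the completion acts multiplicatively, and it annihilates the relations because the evaluation map is
  defined on residue classes.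
\<close>
definition yact :: "yangian_gen free \<Rightarrow> 'v \<Rightarrow> 'v" where
  "yact p x = comp_act \<rho> (ev (Y.cls p)) x"

lemma yact_add: "p \<in> Y.F \<Longrightarrow> q \<in> Y.F \<Longrightarrow> yact (p + q) x = yact p x + yact q x"
  unfolding yact_def
  by (simp add: Y.A_add[symmetric] ev_hom Y.cls_carrier comp_act_add)

lemma yact_mult: "p \<in> Y.F \<Longrightarrow> q \<in> Y.F \<Longrightarrow> yact (p * q) x = yact p (yact q x)"
  unfolding yact_def
  by (simp add: Y.A_mult[symmetric] ev_hom Y.cls_carrier comp_act_mult)

lemma yact_cst: "p \<in> Y.F \<Longrightarrow> yact (cst c * p) x = scale c (yact p x)"
  unfolding yact_def
  by (simp add: Y.A_smult[symmetric] ev_hom Y.cls_carrier comp_act_smult)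

lemma yact_scale: "p \<in> Y.F \<Longrightarrow> yact p (scale c x) = scale c (yact p x)"
  unfolding yact_def by (rule comp_act_vec(2)[OF ev_hom(1)[OF Y.cls_carrier]])

lemma yact_0: "yact 0 x = 0"
  using yact_add[OF Y.F_0 Y.F_0, of x] by simp

lemma yact_diff: "p \<in> Y.F \<Longrightarrow> q \<in> Y.F \<Longrightarrow> yact (p - q) x = yact p x - yact q x"
  using yact_add[OF Y.F_diff, of p q q x] by simp

lemma yact_rel:
  assumes "p \<in> yangian_rels N \<epsilon>1 \<epsilon>2" shows "yact p x = 0"
proof -
  have "Y.cls p = Y.cls 0"
    using Y.rel_J[OF assms] by (simp add: Y.cls_eq_iff Y.eqv_def)
  then show ?thesis using yact_0[of x] by (simp add: yact_def)
qed

lemma yact_comm: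
  "p \<in> Y.F \<Longrightarrow> q \<in> Y.F \<Longrightarrow> yact (comm p q) x = yact p (yact q x) - yact q (yact p x)"
  "p \<in> Y.F \<Longrightarrow> q \<in> Y.F \<Longrightarrow> yact (anticomm p q) x = yact p (yact q x) + yact q (yact p x)"
  "p \<in> Y.F \<Longrightarrow> q \<in> Y.F \<Longrightarrow> comm p q \<in> Y.F"
  "p \<in> Y.F \<Longrightarrow> q \<in> Y.F \<Longrightarrow> anticomm p q \<in> Y.F"
  unfolding comm_def anticomm_def
  by (simp_all add: yact_diff yact_add yact_mult Y.F_mult Y.F_diff Y.F_add)

lemma xg_F: "i < N \<Longrightarrow> xg \<sigma> i r \<in> Y.F"
  by (rule Y.F_gen) (auto simp: yangian_gens_def)

lemma hg_F: "i < N \<Longrightarrow> hg i r \<in> Y.F"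
  by (rule Y.F_gen) (auto simp: yangian_gens_def)

text \<open>
  The Yangian relations for \<open>i = j\<close>, where $a_{ii} = 2$ and $m_{ii} = 0$.
\<close>
lemma yact_rank_one_relations:
  assumes "i < N"
  shows "yact (xg Pl i r) (yact (xg Mi i s) x) - yact (xg Mi i s) (yact (xg Pl i r) x) = yact (hg i (r + s)) x"
    and "yact (hg i 0) (yact (xg \<sigma> i r) x) - yact (xg \<sigma> i r) (yact (hg i 0) x)
      = scale (pm_sign \<sigma> * 2) (yact (xg \<sigma> i r) x)"
    and "yact (hg i 1) (yact (xg \<sigma> i r) x) - yact (xg \<sigma> i r) (yact (hg i 1) x)
      - (yact (hg i 0) (yact (xg \<sigma> i (Suc r)) x) - yact (xg \<sigma> i (Suc r)) (yact (hg i 0) x))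
      = scale (pm_sign \<sigma> * (\<epsilon>1 + \<epsilon>2)) (yact (hg i 0) (yact (xg \<sigma> i r) x) + yact (xg \<sigma> i r) (yact (hg i 0) x))"
proof -
  note F = xg_F[OF assms] hg_F[OF assms]
  have mats: "cartan_mat N i i = 2" "m_mat N i i = 0"
  proof -
    have "i \<noteq> (i + 1) mod N" using assms N by (cases "i + 1 = N") auto
    then show "m_mat N i i = 0" by (simp add: m_mat_def)
  qed (simp add: cartan_mat_def)
  show "yact (xg Pl i r) (yact (xg Mi i s) x) - yact (xg Mi i s) (yact (xg Pl i r) x) = yact (hg i (r + s)) x"
    using yact_rel[OF yangian_rels.xx[OF assms assms], of r s x]
    by (simp add: yact_diff yact_comm F)
  show "yact (hg i 0) (yact (xg \<sigma> i r) x) - yact (xg \<sigma> i r) (yact (hg i 0) x)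
      = scale (pm_sign \<sigma> * 2) (yact (xg \<sigma> i r) x)"
    using yact_rel[OF yangian_rels.h0x[OF assms assms], of \<sigma> r x]
    by (simp add: yact_diff yact_comm F mats yact_cst Y.F_mult Y.F_cst)
  show "yact (hg i 1) (yact (xg \<sigma> i r) x) - yact (xg \<sigma> i r) (yact (hg i 1) x)
      - (yact (hg i 0) (yact (xg \<sigma> i (Suc r)) x) - yact (xg \<sigma> i (Suc r)) (yact (hg i 0) x))
      = scale (pm_sign \<sigma> * (\<epsilon>1 + \<epsilon>2)) (yact (hg i 0) (yact (xg \<sigma> i r) x) + yact (xg \<sigma> i r) (yact (hg i 0) x))"
    using yact_rel[OF yangian_rels.hx[OF assms assms], of 0 \<sigma> r x]
    by (simp add: yact_diff yact_comm F mats yact_cst Y.F_mult Y.F_cst Y.F_diff)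
qed

lemma act_word2:
  "g \<in> gl_gens N \<Longrightarrow> g' \<in> gl_gens N \<Longrightarrow> act (monom_word [g, g']) x = act (gen g) (act (gen g') x)"
  using act_mult[OF F_gen F_gen, of g g' x] by (simp add: gen_def monom_word_append[symmetric])

lemma gl_gens_EE: "i \<in> {1..N} \<Longrightarrow> j \<in> {1..N} \<Longrightarrow> EE i j s \<in> gl_gens N"
  by (auto simp: gl_gens_def)

lemma triangular_two_letters:
  assumes "g \<in> n_minus N" "g' \<in> gl_gens N" shows "[g, g'] \<in> triangular N"
  using assms(2)
proof (cases rule: gl_gens_cases)
  case 1
  then show ?thesis using triangularI[of "[g, g']" N "[]" "[]"] assms(1) by simp
next
  case 2
  then show ?thesis using triangularI[of "[g]" N "[g']" "[]"] assms(1) by simp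
next
  case 3
  then show ?thesis using triangularI[of "[g]" N "[]" "[g']"] assms(1) by simp
qed

lemma triangular_letter: "g \<in> gl_gens N \<Longrightarrow> [g] \<in> triangular N"
proof (erule gl_gens_cases)
  show "[g] \<in> triangular N" if "g \<in> n_minus N"
    using triangularI[of "[g]" N "[]" "[]"] that by simp
  show "[g] \<in> triangular N" if "g \<in> h_cartan N"
    using triangularI[of "[]" N "[g]" "[]"] that by simp
  show "[g] \<in> triangular N" if "g \<in> n_plus N"
    using triangularI[of "[]" N "[]" "[g]"] that by simp
qed

lemma comp_act_letter: "g \<in> gl_gens N \<Longrightarrow> comp_act \<rho> (comp_word N \<kappa> [g]) x = act (gen g) x"
  using comp_act_word[OF triangular_letter] by (simp add: gen_def)

lemma chevalley_gens: "i < N \<Longrightarrow> chevalley N Pl i \<in> n_plus N" "i < N \<Longrightarrow> chevalley N Mi i \<in> n_minus N"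
  using N by (auto simp: n_plus_def n_minus_def)

lemma yact_x0_plus: assumes "i < N" shows "yact (xg Pl i 0) v = 0"
proof -
  have "ev (Y.cls (xg Pl i 0)) = comp_word N \<kappa> [chevalley N Pl i]"
    using ev assms unfolding is_evaluation_map_def yX_def ev_x0_def by blast
  then show ?thesis
    using chevalley_gens(1)[OF assms] triangular_part_subset(3)[of N] annihilated
    unfolding yact_def by (simp only: comp_act_letter subsetD)
qed

lemma yact_x0_minus:
  assumes "i < N" shows "yact (xg Mi i 0) x = act (gen (chevalley N Mi i)) x"
proof -
  have "ev (Y.cls (xg Mi i 0)) = comp_word N \<kappa> [chevalley N Mi i]"
    using ev assms unfolding is_evaluation_map_def yX_def ev_x0_def by blast
  then show ?thesis
    using chevalley_gens(2)[OF assms] triangular_part_subset(1)[of N]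
    unfolding yact_def by (simp only: comp_act_letter subsetD)
qed

definition coroot_value :: "nat \<Rightarrow> complex" where
  "coroot_value i = (if i = 0 then lam N - lam 1 + \<kappa> else lam i - lam (i + 1))"

lemma yact_h0: assumes "i < N" shows "yact (hg i 0) v = scale (coroot_value i) v"
proof -
  have ev_h: "ev (Y.cls (hg i 0)) = ev_h0 N \<kappa> i"
    using ev assms unfolding is_evaluation_map_def yH_def by blast
  have EE: "comp_word N \<kappa> [EE j j 0] \<in> carrier C"
    "comp_act \<rho> (comp_word N \<kappa> [EE j j 0]) v = scale (lam j) v" if "j \<in> {1..N}" for j
    using that gl_gens_EE[OF that that] comp_word_carrier[OF triangular_letter] by (auto simp: comp_act_letter weight)
  have CC: "comp_word N \<kappa> [CC] \<in> carrier C" "comp_act \<rho> (comp_word N \<kappa> [CC]) v = scale \<kappa> v"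
  proof -
    have "CC \<in> gl_gens N" by (simp add: gl_gens_def)
    then show "comp_word N \<kappa> [CC] \<in> carrier C" "comp_act \<rho> (comp_word N \<kappa> [CC]) v = scale \<kappa> v"
      by (simp_all add: comp_word_carrier triangular_letter comp_act_letter central_charge)
  qed
  show ?thesis
  proof (cases "i = 0")
    case True
    have N1: "N \<in> {1..N}" "1 \<in> {1..N}" using N by auto
    show ?thesis
      unfolding yact_def ev_h ev_h0_def coroot_value_def Let_def using True
      by (simp add: comp_act_add comp_act_diff EE[OF N1(1)] EE[OF N1(2)] CC compl.minus_closed
          EE[OF N1(2), unfolded One_nat_def] V.scale_left_distrib V.scale_left_diff_distrib)
  next
    case False
    then have ii: "i \<in> {1..N}" "i + 1 \<in> {1..N}" using assms by auto
    show ?thesis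
      unfolding yact_def ev_h ev_h0_def coroot_value_def Let_def using False
      by (simp add: comp_act_diff EE[OF ii(1)] EE[OF ii(2), simplified] V.scale_left_diff_distrib)
  qed
qed

text \<open>
  In the component with \<open>s = 0\<close> only the initial term of the series survives, so no infinite sum has to
  be evaluated on the highest weight vector.
\<close>
lemma comp_series_0:
  assumes "f 0 r 0 \<in> carrier A" "\<And>n. 0 < n \<Longrightarrow> f n r 0 = \<zero>\<^bsub>A\<^esub>"
  shows "comp_series N \<kappa> f r 0 = f 0 r 0"
proof (cases "f 0 r 0 = \<zero>\<^bsub>A\<^esub>")
  case True
  then have "f n r 0 = \<zero>\<^bsub>A\<^esub>" for n using assms(2)[of n] by (cases n) simp_all
  then show ?thesis unfolding comp_series_def U_gl_eq by simp
next
  case False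
  then have "f n r 0 \<noteq> \<zero>\<^bsub>A\<^esub> \<longleftrightarrow> n = 0" for n using assms(2)[of n] by (cases n) simp_all
  then show ?thesis unfolding comp_series_def U_gl_eq using assms(1) by simp
qed

text \<open>
  Both forms of $\mathrm{ev}(x^-_{i,1})$ are a multiple of $\mathrm{ev}(x^-_{i,0})$ plus $\hbar$ times
  a series whose later terms only have components with \<open>s > 0\<close>.  On the highest weight vector the series
  can be replaced by its initial term.
\<close>
lemma yact_xm1_from_leading_term:
  assumes i: "i < N" and z: "ev_xm1 N \<epsilon>1 \<epsilon>2 \<kappa> \<alpha> i = (z \<odot>\<^bsub>C\<^esub> ev_x0 N \<kappa> Mi i) \<oplus>\<^bsub>C\<^esub> ((\<epsilon>1 + \<epsilon>2) \<odot>\<^bsub>C\<^esub> comp_series N \<kappa> f)"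
    and f: "f 0 \<in> carrier C" "\<And>n r. 0 < n \<Longrightarrow> f n r 0 = \<zero>\<^bsub>A\<^esub>"
    and m: "comp_act \<rho> (f 0) v = scale m (yact (xg Mi i 0) v)"
  shows "yact (xg Mi i 1) v = scale (z + (\<epsilon>1 + \<epsilon>2) * m) (yact (xg Mi i 0) v)"
proof -
  let ?x = "ev_x0 N \<kappa> Mi i"
  have x0: "ev (Y.cls (xg Mi i 0)) = ?x"
    using ev i unfolding is_evaluation_map_def yX_def by blast
  have x1: "ev (Y.cls (xg Mi i 1)) = ev_xm1 N \<epsilon>1 \<epsilon>2 \<kappa> \<alpha> i"
    using ev i unfolding is_evaluation_map_def yX_def by blast
  have car: "?x \<in> carrier C" "ev_xm1 N \<epsilon>1 \<epsilon>2 \<kappa> \<alpha> i \<in> carrier C"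
    unfolding x0[symmetric] x1[symmetric] by (rule ev_hom(1)[OF Y.cls_carrier[OF xg_F[OF i]]])+
  let ?u = "(z \<odot>\<^bsub>C\<^esub> ?x) \<oplus>\<^bsub>C\<^esub> ((\<epsilon>1 + \<epsilon>2) \<odot>\<^bsub>C\<^esub> f 0)"
  have u: "z \<odot>\<^bsub>C\<^esub> ?x \<in> carrier C" "(\<epsilon>1 + \<epsilon>2) \<odot>\<^bsub>C\<^esub> f 0 \<in> carrier C" "?u \<in> carrier C"
    using car(1) f(1) by (auto intro!: C_smult C_add)
  have "comp_series N \<kappa> f r 0 = f 0 r 0" for r
    using C_component_carrier[OF f(1)] f(2) by (rule comp_series_0)
  then have "ev_xm1 N \<epsilon>1 \<epsilon>2 \<kappa> \<alpha> i r 0 = ?u r 0" for r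
    unfolding z C_simps(3,4) by simp
  then have "yact (xg Mi i 1) v = comp_act \<rho> ?u v"
    unfolding yact_def x1 by (rule comp_act_cong_highest[OF car(2) u(3)])
  also have "\<dots> = scale z (comp_act \<rho> ?x v) + scale (\<epsilon>1 + \<epsilon>2) (comp_act \<rho> (f 0) v)"
    by (simp add: comp_act_add[OF u(1,2)] comp_act_smult[OF car(1)] comp_act_smult[OF f(1)])
  also have "comp_act \<rho> ?x v = yact (xg Mi i 0) v"
    unfolding yact_def x0 ..
  finally show ?thesis
    unfolding m by (simp add: V.scale_left_distrib)
qed

lemma word_component_0: "0 < pos_deg w \<Longrightarrow> comp_word N \<kappa> w r 0 = \<zero>\<^bsub>A\<^esub>"
  by (simp add: comp_word_apply A_simps(4))

text \<open>
  In the initial term $\sum_k E_{1,k}(-1) E_{k,N}(0)$ the right factor lies in $\hat{\mathfrak n}_+$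
  unless $k = N$, where it acts on the highest weight vector by $\lambda_N$.
\<close>
lemma yact_xm1_zero:
  "yact (xg Mi 0 1) v = scale (\<alpha> - of_nat N * \<epsilon>1 + (\<epsilon>1 + \<epsilon>2) * lam N) (yact (xg Mi 0 0) v)"
proof (rule yact_xm1_from_leading_term)
  let ?w = "\<lambda>s k. [EE 1 k (- int s - 1), EE k N (int s)]"
  let ?f = "\<lambda>s. \<Oplus>\<^bsub>C\<^esub>k\<in>{1..N}. comp_word N \<kappa> (?w s k)"
  show "0 < N" using N by simp
  show "ev_xm1 N \<epsilon>1 \<epsilon>2 \<kappa> \<alpha> 0 = ((\<alpha> - of_nat N * \<epsilon>1) \<odot>\<^bsub>C\<^esub> ev_x0 N \<kappa> Mi 0) \<oplus>\<^bsub>C\<^esub>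
      ((\<epsilon>1 + \<epsilon>2) \<odot>\<^bsub>C\<^esub> comp_series N \<kappa> ?f)"
    by (simp add: ev_xm1_def Let_def)
  have tri: "?w s k \<in> triangular N" if "k \<in> {1..N}" for s k
    by (rule triangular_two_letters) (use that N in \<open>auto simp: n_minus_def gl_gens_def\<close>)
  have car: "comp_word N \<kappa> (?w s k) \<in> carrier C" if "k \<in> {1..N}" for s k
    by (rule comp_word_carrier[OF tri[OF that]])
  show "?f 0 \<in> carrier C"
    by (rule compl.finsum_closed) (use car in blast)
  show "?f n r 0 = \<zero>\<^bsub>A\<^esub>" if "0 < n" for n r
  proof -
    have "?f n r 0 = finsum A (\<lambda>k. comp_word N \<kappa> (?w n k) r 0) {1..N}"
      by (rule C_finsum_apply[OF car])
    also have "\<dots> = finsum A (\<lambda>k. \<zero>\<^bsub>A\<^esub>) {1..N}"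
      by (rule arg_cong[where f = "\<lambda>g. finsum A g {1..N}"], rule ext, rule word_component_0) (use that in simp)
    finally show ?thesis by simp
  qed
  have "comp_act \<rho> (?f 0) v = (\<Sum>k\<in>{1..N}. comp_act \<rho> (comp_word N \<kappa> (?w 0 k)) v)"
    by (rule comp_act_finsum[OF car])
  also have "\<dots> = (\<Sum>k\<in>{1..N}. if k = N then scale (lam N) (yact (xg Mi 0 0) v) else 0)"
  proof (rule sum.cong[OF refl])
    fix k assume k: "k \<in> {1..N}"
    have g: "EE 1 k (- 1) \<in> gl_gens N" "EE k N 0 \<in> gl_gens N"
      using k N by (auto intro!: gl_gens_EE)
    have "comp_act \<rho> (comp_word N \<kappa> (?w 0 k)) v = act (gen (EE 1 k (- 1))) (act (gen (EE k N 0)) v)"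
      using comp_act_word[OF tri[OF k], of 0 v] act_word2[OF g, of v] by simp
    also have "\<dots> = (if k = N then scale (lam N) (yact (xg Mi 0 0) v) else 0)"
    proof (cases "k = N")
      case True
      then show ?thesis
        using weight[of N] k yact_x0_minus[of 0 v] rho_vec(2)[OF cls_carrier[OF F_gen[OF g(1)]], of "lam N" v] N
        by simp
    next
      case False
      then have "EE k N 0 \<in> n_plus N" using k by (auto simp: n_plus_def)
      then show ?thesis
        using False rho_vec(3)[OF cls_carrier[OF F_gen[OF g(1)]]] by (simp add: annihilated)
    qed
    finally show "comp_act \<rho> (comp_word N \<kappa> (?w 0 k)) v =
        (if k = N then scale (lam N) (yact (xg Mi 0 0) v) else 0)" .
  qed
  also have "\<dots> = scale (lam N) (yact (xg Mi 0 0) v)"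
    using N by simp
  finally show "comp_act \<rho> (?f 0) v = scale (lam N) (yact (xg Mi 0 0) v)" .
qed

text \<open>
  The initial term is $\sum_{k \le i} E_{i+1,k}(0) E_{k,i}(0) + \sum_{k > i} E_{i+1,k}(-1) E_{k,i}(1)$.
  The second sum kills the highest weight vector, and so does the first one apart from the summand with
  $k = i$, which contributes $\lambda_i$ times $x^-_{i,0}$.
\<close>
lemma yact_xm1_nonzero:
  assumes "i \<in> {1..N-1}"
  shows "yact (xg Mi i 1) v = scale (\<alpha> - of_nat i * \<epsilon>1 + (\<epsilon>1 + \<epsilon>2) * lam i) (yact (xg Mi i 0) v)"
proof (rule yact_xm1_from_leading_term)
  let ?w = "\<lambda>s k. [EE (i + 1) k (- int s), EE k i (int s)]"
  let ?w' = "\<lambda>s k. [EE (i + 1) k (- int s - 1), EE k i (int s + 1)]"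
  let ?f1 = "\<lambda>s. \<Oplus>\<^bsub>C\<^esub>k\<in>{1..i}. comp_word N \<kappa> (?w s k)"
  let ?f2 = "\<lambda>s. \<Oplus>\<^bsub>C\<^esub>k\<in>{i+1..N}. comp_word N \<kappa> (?w' s k)"
  let ?f = "\<lambda>s. ?f1 s \<oplus>\<^bsub>C\<^esub> ?f2 s"
  show i: "i < N" using assms N by auto
  show "ev_xm1 N \<epsilon>1 \<epsilon>2 \<kappa> \<alpha> i = ((\<alpha> - of_nat i * \<epsilon>1) \<odot>\<^bsub>C\<^esub> ev_x0 N \<kappa> Mi i) \<oplus>\<^bsub>C\<^esub>
      ((\<epsilon>1 + \<epsilon>2) \<odot>\<^bsub>C\<^esub> comp_series N \<kappa> ?f)"
    using assms by (simp add: ev_xm1_def Let_def)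
  have car: "comp_word N \<kappa> (?w s k) \<in> carrier C" "?w s k \<in> triangular N" if "k \<in> {1..i}" for s k
  proof -
    show "?w s k \<in> triangular N"
      by (rule triangular_two_letters) (use that i in \<open>auto simp: n_minus_def gl_gens_def\<close>)
    then show "comp_word N \<kappa> (?w s k) \<in> carrier C" by (rule comp_word_carrier)
  qed
  have car': "comp_word N \<kappa> (?w' s k) \<in> carrier C" "?w' s k \<in> triangular N" if "k \<in> {i+1..N}" for s k
  proof -
    show "?w' s k \<in> triangular N"
      by (rule triangular_two_letters) (use that i assms in \<open>auto simp: n_minus_def gl_gens_def\<close>)
    then show "comp_word N \<kappa> (?w' s k) \<in> carrier C" by (rule comp_word_carrier)
  qed
  have f12: "?f1 s \<in> carrier C" "?f2 s \<in> carrier C" for s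
    by (rule compl.finsum_closed, use car car' in blast)+
  show "?f 0 \<in> carrier C"
    by (rule C_add[OF f12])
  show "?f n r 0 = \<zero>\<^bsub>A\<^esub>" if "0 < n" for n r
  proof -
    have "?f1 n r 0 = finsum A (\<lambda>k. comp_word N \<kappa> (?w n k) r 0) {1..i}"
      by (rule C_finsum_apply[OF car(1)])
    also have "\<dots> = finsum A (\<lambda>k. \<zero>\<^bsub>A\<^esub>) {1..i}"
      by (rule arg_cong[where f = "\<lambda>g. finsum A g {1..i}"], rule ext, rule word_component_0) (use that in simp)
    finally have 1: "?f1 n r 0 = \<zero>\<^bsub>A\<^esub>" by simp
    have "?f2 n r 0 = finsum A (\<lambda>k. comp_word N \<kappa> (?w' n k) r 0) {i+1..N}"
      by (rule C_finsum_apply[OF car'(1)])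
    also have "\<dots> = finsum A (\<lambda>k. \<zero>\<^bsub>A\<^esub>) {i+1..N}"
      by (rule arg_cong[where f = "\<lambda>g. finsum A g {i+1..N}"], rule ext, rule word_component_0) simp
    finally have 2: "?f2 n r 0 = \<zero>\<^bsub>A\<^esub>" by simp
    show ?thesis unfolding C_simps(3) 1 2 by simp
  qed
  have ii: "i \<in> {1..N}" "i + 1 \<in> {1..N}" using assms N by auto
  have "comp_act \<rho> (?f1 0) v = (\<Sum>k\<in>{1..i}. comp_act \<rho> (comp_word N \<kappa> (?w 0 k)) v)"
    by (rule comp_act_finsum[OF car(1)])
  also have "\<dots> = (\<Sum>k\<in>{1..i}. if k = i then scale (lam i) (yact (xg Mi i 0) v) else 0)"
  proof (rule sum.cong[OF refl])
    fix k assume k: "k \<in> {1..i}"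
    have g: "EE (i + 1) k 0 \<in> gl_gens N" "EE k i 0 \<in> gl_gens N"
      using k ii by (auto intro!: gl_gens_EE)
    have "comp_act \<rho> (comp_word N \<kappa> (?w 0 k)) v = act (gen (EE (i + 1) k 0)) (act (gen (EE k i 0)) v)"
      using comp_act_word[OF car(2)[OF k], of 0 v] act_word2[OF g, of v] by simp
    also have "\<dots> = (if k = i then scale (lam i) (yact (xg Mi i 0) v) else 0)"
    proof (cases "k = i")
      case True
      then show ?thesis
        using weight[OF ii(1)] k yact_x0_minus[OF i, of v] rho_vec(2)[OF cls_carrier[OF F_gen[OF g(1)]], of "lam i" v]
        by simp
    next
      case False
      then have "EE k i 0 \<in> n_plus N" using k i by (auto simp: n_plus_def)
      then show ?thesis
        using False rho_vec(3)[OF cls_carrier[OF F_gen[OF g(1)]]] by (simp add: annihilated)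
    qed
    finally show "comp_act \<rho> (comp_word N \<kappa> (?w 0 k)) v =
        (if k = i then scale (lam i) (yact (xg Mi i 0) v) else 0)" .
  qed
  also have "\<dots> = scale (lam i) (yact (xg Mi i 0) v)"
    using assms by simp
  finally have 1: "comp_act \<rho> (?f1 0) v = scale (lam i) (yact (xg Mi i 0) v)" .
  have "comp_act \<rho> (?f2 0) v = (\<Sum>k\<in>{i+1..N}. comp_act \<rho> (comp_word N \<kappa> (?w' 0 k)) v)"
    by (rule comp_act_finsum[OF car'(1)])
  also have "\<dots> = 0"
  proof (rule sum.neutral, rule ballI)
    fix k assume k: "k \<in> {i+1..N}"
    show "comp_act \<rho> (comp_word N \<kappa> (?w' 0 k)) v = 0"
      using comp_act_word[OF car'(2)[OF k], of 0 v] triangular_annihilates[OF car'(2)[OF k], of 0] by simp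
  qed
  finally have 2: "comp_act \<rho> (?f2 0) v = 0" .
  show "comp_act \<rho> (?f 0) v = scale (lam i) (yact (xg Mi i 0) v)"
    unfolding comp_act_add[OF f12] 1 2 by simp
qed

definition spectral_parameter :: "nat \<Rightarrow> complex" where
  "spectral_parameter i = (if i = 0 then \<alpha> - of_nat N * \<epsilon>1 + (\<epsilon>1 + \<epsilon>2) * lam N else \<alpha> - of_nat i * \<epsilon>1 + (\<epsilon>1 + \<epsilon>2) * lam i)"

theorem evaluation_highest_weight:
  assumes "i < N"
  shows "yact (xg Pl i r) v = 0" "yact (hg i r) v = scale (spectral_parameter i ^ r * coroot_value i) v"
proof -
  have Z1: "yact (xg Mi i 1) v = scale (spectral_parameter i) (yact (xg Mi i 0) v)"
    using yact_xm1_zero yact_xm1_nonzero[of i] assms by (cases "i = 0") (auto simp: spectral_parameter_def)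
  note sgn = pm_sign.simps mult_1 mult_minus_left
  note rels = yact_rank_one_relations[OF assms]
  note top = rank_one_highest_weight[of scale "\<lambda>r. yact (xg Pl i r)" "\<lambda>r. yact (xg Mi i r)"
      "\<lambda>r. yact (hg i r)" "\<epsilon>1 + \<epsilon>2" v "coroot_value i" "spectral_parameter i", OF vector_space
      yact_scale[OF xg_F[OF assms]] yact_scale[OF xg_F[OF assms]] yact_scale[OF hg_F[OF assms]]
      rels(1) rels(2)[of Pl, unfolded sgn] rels(2)[of Mi, unfolded sgn]
      rels(3)[of Pl, unfolded sgn] rels(3)[of Mi, unfolded sgn]
      yact_x0_plus[OF assms] yact_h0[OF assms] Z1]
  show "yact (xg Pl i r) v = 0" "yact (hg i r) v = scale (spectral_parameter i ^ r * coroot_value i) v"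
    by (rule top)+
qed

end

text \<open>
  The vectors \<open>\<rho> a v\<close> form a submodule, which contains \<open>v = \<rho> 1 v\<close>.
\<close>
lemma irreducible_cyclic:
  assumes "is_gl_module N \<kappa> scale \<rho>" "is_irreducible N \<kappa> scale \<rho>" "v \<noteq> 0"
  shows "\<exists>a\<in>carrier (U_gl N \<kappa>). x = \<rho> a v"
proof -
  interpret affine_gl N \<kappa> .
  have vs: "vector_space scale" and hom: "\<rho> \<in> alg_hom A (end_algebra scale)"
    using assms(1) by (auto simp: is_gl_module_def U_gl_eq)
  interpret V: vector_space scale by (rule vs)
  let ?W = "{\<rho> a v |a. a \<in> carrier A}"
  have add: "\<rho> (a \<oplus>\<^bsub>A\<^esub> b) x = \<rho> a x + \<rho> b x" "\<rho> (a \<otimes>\<^bsub>A\<^esub> b) x = \<rho> a (\<rho> b x)"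
    if "a \<in> carrier A" "b \<in> carrier A" for a b x
    using hom that by (simp_all add: alg_hom_def ring_hom_def end_algebra_def)
  have smult: "\<rho> (c \<odot>\<^bsub>A\<^esub> a) x = scale c (\<rho> a x)" if "a \<in> carrier A" for a c x
    using hom that by (simp add: alg_hom_def ring_hom_def end_algebra_def)
  have one: "\<rho> \<one>\<^bsub>A\<^esub> v = v"
    using hom by (simp add: alg_hom_def ring_hom_def end_algebra_def)
  have closed: "c \<odot>\<^bsub>A\<^esub> a \<in> carrier A" if "a \<in> carrier A" for c a
    using that A_smult F_mult[OF F_cst] cls_carrier by (auto simp: A_simps(1))
  have "V.subspace ?W"
  proof (rule V.subspaceI)
    have "0 = \<rho> \<zero>\<^bsub>A\<^esub> v" using add(1)[OF quot.zero_closed quot.zero_closed, of v] by simp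
    then show "0 \<in> ?W" using quot.zero_closed by blast
    show "x + y \<in> ?W" if "x \<in> ?W" "y \<in> ?W" for x y
      using that add(1) quot.a_closed by (smt (verit) mem_Collect_eq)
    show "scale c x \<in> ?W" if "x \<in> ?W" for c x
      using that smult closed by (smt (verit) mem_Collect_eq)
  qed
  moreover have "\<rho> u x \<in> ?W" if "u \<in> carrier (U_gl N \<kappa>)" "x \<in> ?W" for u x
    using that add(2) quot.m_closed unfolding U_gl_eq by (smt (verit) mem_Collect_eq)
  moreover have "v \<in> ?W" using one quot.one_closed by force
  ultimately have "?W = UNIV"
    using assms(2,3) unfolding is_irreducible_def by blast
  then show ?thesis unfolding U_gl_eq by blast
qed

theorem theorem4p1:
  fixes N K :: nat
    and \<epsilon>1 \<epsilon>2 \<alpha> hb :: complex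
    and lam a :: "nat \<Rightarrow> complex"
    and scale :: "complex \<Rightarrow> 'v::ab_group_add \<Rightarrow> 'v"
    and \<rho> :: "gl_gen free set \<Rightarrow> 'v \<Rightarrow> 'v"
    and v :: 'v
    and ev :: "yangian_gen free set \<Rightarrow> nat \<Rightarrow> nat \<Rightarrow> gl_gen free set"
  assumes N: "3 \<le> N"
    and K: "1 \<le> K"
    and hbar: "hb = \<epsilon>1 + \<epsilon>2"
    and level: "of_nat K * hb = - (of_nat N * \<epsilon>1)"
    and dominant: "dominant_integral_weight N lam K"
    and L: "is_L N lam K scale \<rho> v"
    and ev: "is_evaluation_map N \<epsilon>1 \<epsilon>2 (of_nat K) \<alpha> ev"
    and a_0: "a 0 = \<alpha> - of_nat N * \<epsilon>1 + hb * lam N"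
    and a_i: "\<And>i. i \<in> {1..N-1} \<Longrightarrow> a i = \<alpha> - of_nat i * \<epsilon>1 + hb * lam i"
  shows "(\<forall>i<N. \<forall>r. eval_act \<rho> ev (yX N \<epsilon>1 \<epsilon>2 Pl i r) v = 0 \<and>
            eval_act \<rho> ev (yH N \<epsilon>1 \<epsilon>2 i r) v = scale (a i ^ r * coroot_pairing N lam K i) v) \<and>
         a 0 = \<alpha> + (lam N + of_nat K) * hb \<and>
         (\<forall>i\<in>{1..N-1}. a i = \<alpha> + (lam i + of_nat i / of_nat N * of_nat K) * hb)"
proof -
  interpret U: affine_gl N "of_nat K" .
  have gl: "is_gl_module N (of_nat K) scale \<rho>" and irr: "is_irreducible N (of_nat K) scale \<rho>"
    and hw: "is_highest_weight_vector N lam K scale \<rho> v"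
    using L by (auto simp: is_L_def)
  interpret evaluation_module N "of_nat K" scale \<rho> v \<epsilon>1 \<epsilon>2 \<alpha> lam ev
  proof (intro evaluation_module.intro highest_weight_module.intro evaluation_module_axioms.intro)
    show "vector_space scale" "\<rho> \<in> alg_hom U.A (end_algebra scale)"
      using gl by (auto simp: is_gl_module_def U.U_gl_eq)
    show "\<exists>p\<in>U.F. x = \<rho> (U.cls p) v" for x
      using irreducible_cyclic[OF gl irr, of v x] hw
      unfolding U.U_gl_eq U.A_simps(1) is_highest_weight_vector_def by blast
  qed (use hw N ev in \<open>auto simp: is_highest_weight_vector_def U.U_class_eq\<close>)
  have "a i = spectral_parameter i" if "i < N" for i
    using that a_0 a_i[of i] hbar by (cases "i = 0") (auto simp: spectral_parameter_def)
  moreover have "coroot_pairing N lam K i = coroot_value i" for i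
    by (simp add: coroot_pairing_def coroot_value_def)
  ultimately have "\<forall>i<N. \<forall>r. eval_act \<rho> ev (yX N \<epsilon>1 \<epsilon>2 Pl i r) v = 0 \<and>
      eval_act \<rho> ev (yH N \<epsilon>1 \<epsilon>2 i r) v = scale (a i ^ r * coroot_pairing N lam K i) v"
    using evaluation_highest_weight unfolding yact_def eval_act_def yX_def yH_def by simp
  moreover have "a 0 = \<alpha> + (lam N + of_nat K) * hb"
    unfolding a_0 using level by (simp add: algebra_simps)
  moreover have "a i = \<alpha> + (lam i + of_nat i / of_nat N * of_nat K) * hb" if "i \<in> {1..N-1}" for i
  proof -
    \<comment> \<open>Eliminating \<open>\<epsilon>1\<close> by the level condition gives the second form of \<open>a i\<close>.\<close>
    have "\<epsilon>1 = - (of_nat K * hb / of_nat N)"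
      using level N by (simp add: field_simps)
    then show ?thesis unfolding a_i[OF that] by (simp add: algebra_simps)
  qed
  ultimately show ?thesis by blast
qed

end
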